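(* Let $M$ be a lattice of rank $n$ with dual lattice $N$, let $P\subset M_{\mathbb{R}}$ be an $n$-dimensional convex simple lattice polytope, let $\Delta$ be the associated complete simplicial fan in $N$, and let $a_k(P)$ be the coefficients of the Ehrhart polynomial $\#(\ell P)=\sum_{k=0}^n a_k(P)\,\ell^{\,n-k}$ ($\ell$ a positive integer). Then for $1\le k\le n$ $$a_k(P)=\sum_{J\in\Sigma^{(k)}}\mu_k(J)\,\mathrm{vol}\,P_J$$ with $$\mu_k(J)=\frac{1}{|H_J|}\sum_{h\in H_J}\nu^*\left(\prod_{j\in J}\frac{1}{1-\chi(u_j^J,h)\,e^{-f^J(x_j)}}\right)_0$$ in $\mathrm{Rat}(G_{n-k+1}(N_{\mathbb{C}}))_0$.
   Context: Subscripts $\mathbb{Q},\mathbb{R},\mathbb{C}$ denote tensoring; $\langle\ ,\ \rangle$ is the pairing between $M$ and $N=\mathrm{Hom}(M,\mathbb{Z})$. A lattice polytope has its vertices in $M$; $\#(Q)$ is the number of points of $M$ in $Q$. Fan of $P$. Write $P=\{u\in M_{\mathbb{R}}\mid\langle u,v_i\rangle\le d_i,\ i\in\Sigma^{(1)}\}$, where $\Sigma^{(1)}$ indexes the facets of $P$, $v_i\in N$ is the primitive outward normal of the $i$-th facet, and $d_i\in\mathbb{Z}$. $\Sigma$ is the simplicial complex on $\Sigma^{(1)}$ of those $J$ for which $P_J=\{u\in P\mid\langle u,v_j\rangle=d_j\ \forall j\in J\}$ is nonempty; $P_J$ is then a face of $P$ of codimension $|J|$, and the cones $C(J)$ spanned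 by $\{v_j\}_{j\in J}$, $J\in\Sigma$, form the fan $\Delta$. $\Sigma^{(k)}=\{J\in\Sigma: |J|=k\}$. $\mathrm{vol}\,P_J$ is the volume in the affine hull of $P_J$ normalized so that the lattice $M\cap(\text{affine hull of }P_J)$ has covolume $1$ (the volume of a point is $1$). For $J\in\Sigma$: $N_{J,\mathcal V}$ is the sublattice generated by $\{v_j\}_{j\in J}$, $N_J$ the minimal primitive (saturated) sublattice of $N$ containing it, $H_J=N_J/N_{J,\mathcal V}$, and $\{u_j^J\}_{j\in J}$ is the basis of $N_{J,\mathcal V}^*$ dual to $\{v_j\}_{j\in J}$. For $I\in\Sigma^{(n)}$ the $u_i^I$ are regarded as elements of $M_{\mathbb{Q}}$. For $u\in N_{J,\mathcal V}^*$ and $h\in H_J$, $\chi(u,h)=e^{2\pi\sqrt{-1}\langle u,v(h)\rangle}$, where $v(h)\in N_J$ is a lift of $h$. For $J\in\Sigma^{(k)}$ let $M_J\subset M$ be the annihilator of $N_J$ and $\omega_J=u_1\wedge\cdots\wedge u_{n-k}\in\bigwedge^{n-k}M$ for a basis $u_1,\dots,u_{n-k}$ of $M_J$ (oriented by a choice of orientation). For $j\in J$, $f^J(x_j)=u_j^I\wedge\omega_J\in\bigwedge^{n-k+1}M_{\mathbb{Q}}$, where $I\in\Sigma^{(n)}$ is any simplex containing $J$ (independent of $I$). $(\cdot)_0$ denotes the homogeneous component of degree $0$: each factor is expanded as a Laurent series in $f^J(x_j)$ (with a simple pole if $\chi(u_j^J,h)=1$), the elements of $\bigwedge^{n-k+1}M_{\mathbb{Q}}$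 having degree $1$ in the symmetric algebra $S^*(\bigwedge^{n-k+1}M_{\mathbb{Q}})\otimes\mathbb{C}$. The degree-$0$ component lies in the fraction field of this algebra and is viewed as a rational function on $\mathbb{P}(\bigwedge^{n-k+1}N_{\mathbb{C}})$; $\nu^*$ is its pull-back under the Plücker embedding $\nu:G_{n-k+1}(N_{\mathbb{C}})\to\mathbb{P}(\bigwedge^{n-k+1}N_{\mathbb{C}})$ of the Grassmannian of $(n-k+1)$-planes. $\mathrm{Rat}(G_{n-k+1}(N_{\mathbb{C}}))_0$ is the field of rational functions (of degree $0$) on $G_{n-k+1}(N_{\mathbb{C}})$. The equation means that the right-hand side is a constant rational function with value $a_k(P)$. *)

theory Defs
  imports "HOL-Analysis.Analysis" "HOL-Computational_Algebra.Formal_Laurent_Series"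
begin

section \<open>Lattices\<close>

text \<open>
  A lattice \<open>M\<close> of rank \<open>n\<close> is the integral span of a basis of \<open>M\<^sub>\<real> = real ^ 'n\<close>, where
  \<open>n = CARD('n)\<close>.  Its dual \<open>N = Hom(M,\<int>)\<close> is realised in the same space, with the inner
  product as pairing; \<open>N\<^sub>\<complex>\<close> is \<open>complex ^ 'n\<close>.
\<close>

definition int_span :: "'a::real_vector set \<Rightarrow> 'a set" where
  "int_span B = {x. \<exists>T c. finite T \<and> T \<subseteq> B \<and> x = (\<Sum>b\<in>T. real_of_int (c b) *\<^sub>R b)}"

definition full_lattice :: "'a::real_vector set \<Rightarrow> bool" where
  "full_lattice M \<longleftrightarrow> (\<exists>B. independent B \<and> span B = UNIV \<and> M = int_span B)"

definition dual_lattice :: "'a::real_inner set \<Rightarrow> 'a set" where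
  "dual_lattice M = {v. \<forall>u\<in>M. u \<bullet> v \<in> \<int>}"

definition lattice_basis :: "'a::real_vector set \<Rightarrow> 'a list \<Rightarrow> bool" where
  "lattice_basis L us \<longleftrightarrow> distinct us \<and> independent (set us) \<and> L = int_span (set us)"

definition primitive_vector :: "'a::real_vector set \<Rightarrow> 'a \<Rightarrow> bool" where
  "primitive_vector N v \<longleftrightarrow>
     v \<in> N \<and> v \<noteq> 0 \<and> (\<forall>w\<in>N. \<forall>m::int. v = real_of_int m *\<^sub>R w \<longrightarrow> \<bar>m\<bar> = 1)"

definition primitive_sublattice :: "'a::real_vector set \<Rightarrow> 'a set \<Rightarrow> bool" where
  "primitive_sublattice N L \<longleftrightarrow>
     L \<subseteq> N \<and> int_span L = L \<and>
     (\<forall>w\<in>N. \<forall>m::int. m \<noteq> 0 \<and> real_of_int m *\<^sub>R w \<in> L \<longrightarrow> w \<in> L)"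

text \<open>
  The volume of \<open>Q\<close> inside its affine hull, normalised so that \<open>M \<inter> affine hull Q\<close> has
  covolume 1: Lebesgue measure in the coordinates given by an origin and a basis of that affine
  lattice.  The value does not depend on these choices; a lattice point has volume 1, since the
  empty product measure has total mass 1.
\<close>

definition lattice_volume :: "'a::real_normed_vector set \<Rightarrow> 'a set \<Rightarrow> real" where
  "lattice_volume M Q = (SOME r. \<exists>p us.
     p \<in> M \<inter> affine hull Q \<and>
     lattice_basis ((\<lambda>x. x - p) ` (M \<inter> affine hull Q)) us \<and>
     r = measure (Pi\<^sub>M {..<length us} (\<lambda>_. lborel))
           {t \<in> {..<length us} \<rightarrow>\<^sub>E UNIV. p + (\<Sum>i<length us. t i *\<^sub>R us ! i) \<in> Q})"


section \<open>Simple lattice polytopes and their fans\<close>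

definition lattice_polytope :: "'a::euclidean_space set \<Rightarrow> 'a set \<Rightarrow> bool" where
  "lattice_polytope M P \<longleftrightarrow> polytope P \<and> {x. x extreme_point_of P} \<subseteq> M"

definition facets :: "'a::euclidean_space set \<Rightarrow> 'a set set" where
  "facets P = {F. F facet_of P}"

definition simple_polytope :: "'a::euclidean_space set \<Rightarrow> bool" where
  "simple_polytope P \<longleftrightarrow>
     polytope P \<and> (\<forall>x. x extreme_point_of P \<longrightarrow> int (card {F \<in> facets P. x \<in> F}) = aff_dim P)"

text \<open>
  The index set \<open>\<Sigma>\<^sup>(\<^sup>1\<^sup>)\<close> is the set of facets itself.  For a facet \<open>F\<close>, \<open>facet_normal M P F\<close> and
  \<open>facet_level M P F\<close> are its \<open>v\<^sub>i\<close> and \<open>d\<^sub>i\<close>.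
\<close>

definition facet_normal :: "'a::euclidean_space set \<Rightarrow> 'a set \<Rightarrow> 'a set \<Rightarrow> 'a" where
  "facet_normal M P F = (THE v. primitive_vector (dual_lattice M) v \<and>
     (\<exists>d. (\<forall>u\<in>P. u \<bullet> v \<le> d) \<and> F = {u \<in> P. u \<bullet> v = d}))"

definition facet_level :: "'a::euclidean_space set \<Rightarrow> 'a set \<Rightarrow> 'a set \<Rightarrow> real" where
  "facet_level M P F = (THE d. F = {u \<in> P. u \<bullet> facet_normal M P F = d})"

definition face :: "'a::euclidean_space set \<Rightarrow> 'a set \<Rightarrow> 'a set set \<Rightarrow> 'a set" where
  "face M P J = {u \<in> P. \<forall>F\<in>J. u \<bullet> facet_normal M P F = facet_level M P F}"

definition simplices :: "'a::euclidean_space set \<Rightarrow> 'a set \<Rightarrow> nat \<Rightarrow> 'a set set set" where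
  "simplices M P k = {J. J \<subseteq> facets P \<and> card J = k \<and> face M P J \<noteq> {}}"

definition N_gen :: "'a::euclidean_space set \<Rightarrow> 'a set \<Rightarrow> 'a set set \<Rightarrow> 'a set" where
  "N_gen M P J = int_span (facet_normal M P ` J)"

definition N_sat :: "'a::euclidean_space set \<Rightarrow> 'a set \<Rightarrow> 'a set set \<Rightarrow> 'a set" where
  "N_sat M P J = primitive_sublattice (dual_lattice M) hull (facet_normal M P ` J)"

definition H_grp :: "'a::euclidean_space set \<Rightarrow> 'a set \<Rightarrow> 'a set set \<Rightarrow> 'a set set" where
  "H_grp M P J =
     N_sat M P J // {(x, y). x \<in> N_sat M P J \<and> y \<in> N_sat M P J \<and> x - y \<in> N_gen M P J}"

definition M_ann :: "'a::euclidean_space set \<Rightarrow> 'a set \<Rightarrow> 'a set set \<Rightarrow> 'a set" where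
  "M_ann M P J = {u \<in> M. \<forall>w\<in>N_sat M P J. u \<bullet> w = 0}"

text \<open>
  The dual basis element \<open>u\<^sub>j\<^sup>J\<close>, extended linearly from \<open>N_gen M P J\<close> to the real span of
  \<open>{v\<^sub>j}\<^sub>j\<^sub>\<in>\<^sub>J\<close>, reads off the coefficient of \<open>v\<^sub>j\<close>.  For maximal \<open>I\<close> it is an element of \<open>M\<^sub>\<rat>\<close>.
\<close>

definition dual_basis ::
    "'a::euclidean_space set \<Rightarrow> 'a set \<Rightarrow> 'a set set \<Rightarrow> 'a set \<Rightarrow> 'a \<Rightarrow> real" where
  "dual_basis M P J j x = representation (facet_normal M P ` J) x (facet_normal M P j)"

definition dual_basis_vector ::
    "'a::euclidean_space set \<Rightarrow> 'a set \<Rightarrow> 'a set set \<Rightarrow> 'a set \<Rightarrow> 'a" where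
  "dual_basis_vector M P I i = (THE u. \<forall>x. u \<bullet> x = dual_basis M P I i x)"

definition chi ::
    "'a::euclidean_space set \<Rightarrow> 'a set \<Rightarrow> 'a set set \<Rightarrow> 'a set \<Rightarrow> 'a set \<Rightarrow> complex" where
  "chi M P J j h =
     exp (2 * complex_of_real pi * \<i> * complex_of_real (dual_basis M P J j (SOME w. w \<in> h)))"


section \<open>Exterior powers and rational functions on Grassmannians\<close>

text \<open>
  \<open>\<Lambda>\<^sup>r M\<^sub>\<complex>\<close> is identified with the alternating \<open>r\<close>-linear forms on \<open>N\<^sub>\<complex>\<close>, here functions of
  lists of length \<open>r\<close>: \<open>a\<^sub>1 \<and> \<dots> \<and> a\<^sub>r\<close> maps \<open>w\<^sub>1, \<dots>, w\<^sub>r\<close> to \<open>det \<langle>a\<^sub>i, w\<^sub>j\<rangle>\<close>, which is its value,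
  as a linear form on \<open>\<Lambda>\<^sup>r N\<^sub>\<complex>\<close>, at \<open>w\<^sub>1 \<and> \<dots> \<and> w\<^sub>r\<close>.
\<close>

definition pairing :: "real ^ 'n \<Rightarrow> complex ^ 'n \<Rightarrow> complex" where
  "pairing u w = (\<Sum>i\<in>UNIV. complex_of_real (u $ i) * w $ i)"

definition wedge :: "(real ^ 'n) list \<Rightarrow> (complex ^ 'n) list \<Rightarrow> complex" where
  "wedge as ws = (\<Sum>p | p permutes {..<length as}.
     of_int (sign p) * (\<Prod>i<length as. pairing (as ! i) (ws ! p i)))"

text \<open>
  A frame is an ordered basis of an \<open>r\<close>-plane \<open>E\<close>; its wedge product represents the point
  \<open>\<nu>(E)\<close> in homogeneous coordinates.
\<close>

definition frame :: "nat \<Rightarrow> (complex ^ 'n) list \<Rightarrow> bool" where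
  "frame r ws \<longleftrightarrow> length ws = r \<and> distinct ws \<and> vec.independent (set ws)"

definition plucker_pullback ::
    "nat \<Rightarrow> ((complex ^ 'n) list \<Rightarrow> complex) \<Rightarrow> (complex ^ 'n) set \<Rightarrow> complex" where
  "plucker_pullback r \<Phi> E = \<Phi> (SOME ws. frame r ws \<and> vec.span (set ws) = E)"

text \<open>
  \<open>homogeneous_form r d\<close>: the degree \<open>d\<close> part of the symmetric algebra of \<open>\<Lambda>\<^sup>r M\<^sub>\<complex>\<close>, as functions
  of decomposable vectors, i.e. of the homogeneous coordinate ring of the Grassmannian.
\<close>

inductive homogeneous_form :: "nat \<Rightarrow> nat \<Rightarrow> ((complex ^ 'n) list \<Rightarrow> complex) \<Rightarrow> bool"
  for r :: nat where
  const: "homogeneous_form r 0 (\<lambda>_. c)"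
| wedge: "length as = r \<Longrightarrow> homogeneous_form r 1 (wedge as)"
| add: "homogeneous_form r d g \<Longrightarrow> homogeneous_form r d h \<Longrightarrow>
    homogeneous_form r d (\<lambda>ws. g ws + h ws)"
| mult: "homogeneous_form r d g \<Longrightarrow> homogeneous_form r e h \<Longrightarrow>
    homogeneous_form r (d + e) (\<lambda>ws. g ws * h ws)"

definition nonzero_form :: "nat \<Rightarrow> nat \<Rightarrow> ((complex ^ 'n) list \<Rightarrow> complex) \<Rightarrow> bool" where
  "nonzero_form r d h \<longleftrightarrow> homogeneous_form r d h \<and> (\<exists>ws. frame r ws \<and> h ws \<noteq> 0)"

text \<open>
  Elements of \<open>Rat(G\<^sub>r(N\<^sub>\<complex>))\<^sub>0\<close> are represented by total functions of the \<open>r\<close>-plane that are a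
  quotient of two homogeneous forms of the same degree off the zero set of a nonzero form; the
  values elsewhere are irrelevant.  Two representatives are the same rational function if they
  agree on a nonempty Zariski open set.
\<close>

definition rational_function :: "nat \<Rightarrow> ((complex ^ 'n) set \<Rightarrow> complex) \<Rightarrow> bool" where
  "rational_function r F \<longleftrightarrow> (\<exists>d g h. homogeneous_form r d g \<and> nonzero_form r d h \<and>
     (\<forall>ws. frame r ws \<and> h ws \<noteq> 0 \<longrightarrow> F (vec.span (set ws)) = g ws / h ws))"

definition rational_eq ::
    "nat \<Rightarrow> ((complex ^ 'n) set \<Rightarrow> complex) \<Rightarrow> ((complex ^ 'n) set \<Rightarrow> complex) \<Rightarrow> bool" where
  "rational_eq r F G \<longleftrightarrow> (\<exists>d h. nonzero_form r d h \<and>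
     (\<forall>ws. frame r ws \<and> h ws \<noteq> 0 \<longrightarrow> F (vec.span (set ws)) = G (vec.span (set ws))))"


section \<open>The coefficients\<close>

text \<open>
  \<open>\<omega>\<^sub>J\<close> is given by a basis of \<open>M\<^sub>J\<close>.  Its sign is immaterial below: only components of degree 0
  in the \<open>f\<^sup>J(x\<^sub>j)\<close>, \<open>j \<in> J\<close>, occur.  For \<open>|J| = n\<close> the list is empty and
  \<open>f\<^sup>J(x\<^sub>j) = u\<^sub>j\<^sup>J\<close>.
\<close>

definition omega :: "(real ^ 'n) set \<Rightarrow> (real ^ 'n) set \<Rightarrow> (real ^ 'n) set set \<Rightarrow> (real ^ 'n) list"
  where "omega M P J = (SOME us. lattice_basis (M_ann M P J) us)"

definition f_form :: "(real ^ 'n) set \<Rightarrow> (real ^ 'n) set \<Rightarrow> (real ^ 'n) set set \<Rightarrow>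
    (real ^ 'n) set \<Rightarrow> (complex ^ 'n) list \<Rightarrow> complex" where
  "f_form M P J j =
     (let I = (SOME I. I \<in> simplices M P CARD('n) \<and> J \<subseteq> I)
      in wedge (dual_basis_vector M P I j # omega M P J))"

text \<open>\<open>1 / (1 - c e\<^sup>-\<^sup>t)\<close> as a Laurent series in \<open>t\<close>, with a simple pole exactly when \<open>c = 1\<close>.\<close>

definition todd_series :: "complex \<Rightarrow> complex fls" where
  "todd_series c = 1 / (1 - fls_const c * fps_to_fls (fps_exp (- 1)))"

text \<open>
  The degree 0 component of \<open>\<Prod>\<^sub>j\<^sub>\<in>\<^sub>J \<phi>\<^sub>j(z\<^sub>j)\<close> for Laurent series \<open>\<phi>\<^sub>j\<close> with at most simple poles.
  For finite \<open>J\<close> only finitely many exponent vectors \<open>m \<ge> -1\<close> have sum 0.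
\<close>

definition degree_zero_part :: "'i set \<Rightarrow> ('i \<Rightarrow> complex fls) \<Rightarrow> ('i \<Rightarrow> complex) \<Rightarrow> complex" where
  "degree_zero_part J \<phi> z =
     (\<Sum>m | m \<in> J \<rightarrow>\<^sub>E {-1..} \<and> (\<Sum>j\<in>J. m j) = 0. \<Prod>j\<in>J. fls_nth (\<phi> j) (m j) * z j powi m j)"

definition mu :: "(real ^ 'n) set \<Rightarrow> (real ^ 'n) set \<Rightarrow> (real ^ 'n) set set \<Rightarrow>
    (complex ^ 'n) set \<Rightarrow> complex" where
  "mu M P J E = 1 / of_nat (card (H_grp M P J)) *
     (\<Sum>h\<in>H_grp M P J. plucker_pullback (CARD('n) - card J + 1)
        (\<lambda>ws. degree_zero_part J (\<lambda>j. todd_series (chi M P J j h)) (\<lambda>j. f_form M P J j ws)) E)"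

end

theory Submission
  imports Defs "HOL-Complex_Analysis.Complex_Analysis" "Jordan_Normal_Form.Determinant"
begin

text \<open>
  Let \<open>I \<in> \<Sigma>\<^sup>(\<^sup>n\<^sup>)\<close> run over the vertices \<open>p\<^sub>I\<close> of \<open>P\<close>, let \<open>u\<^sub>i = u\<^sub>i\<^sup>I\<close> be the basis dual to the normals of the
  facets through \<open>p\<^sub>I\<close>, let \<open>\<chi>\<^sub>i(h) = \<chi>(u\<^sub>i, h)\<close> for \<open>h \<in> H\<^sub>I\<close>, and let \<open>\<xi> \<in> N\<^sub>\<complex>\<close> be a point with
  \<open>Re \<langle>u\<^sub>i, \<xi>\<rangle> \<noteq> 0\<close> for all \<open>I\<close> and \<open>i \<in> I\<close>.  Brion's formula (\<open>brion\<close>) writes the sum of \<open>e\<^sup>t\<^sup>\<langle>\<^sup>x\<^sup>,\<^sup>\<xi>\<^sup>\<rangle>\<close> over the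
  lattice points \<open>x\<close> of \<open>l P\<close>, for \<open>t > 0\<close>, as the sum over \<open>I\<close> of
  \<open>e\<^sup>t\<^sup>l\<^sup>\<langle>\<^sup>p\<^sup>,\<^sup>\<xi>\<^sup>\<rangle> / |H\<^sub>I|\<close> times \<open>\<Sum>\<^sub>h \<Prod>\<^sub>i 1 / (1 - \<chi>\<^sub>i(h) e\<^sup>-\<^sup>t\<^sup>\<langle>\<^sup>u\<^sup>,\<^sup>\<xi>\<^sup>\<rangle>)\<close>.  Two facts give it.  The indicator function of
  \<open>P\<close> is a signed sum of indicator functions of cones, one at each vertex, with the edges flipped in
  such a way that \<open>e\<^sup>t\<^sup>\<langle>\<^sup>x\<^sup>,\<^sup>\<xi>\<^sup>\<rangle>\<close> decays on every cone (\<open>polar_decomposition\<close>); this is inclusion and exclusion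
  over the faces of \<open>P\<close>, each of which has exactly one vertex where \<open>Re \<langle>x, \<xi>\<rangle>\<close> is maximal.  And averaging
  over the characters of \<open>H\<^sub>I\<close> singles out the lattice points among the integral combinations of
  the \<open>u\<^sub>i\<close> (\<open>character_orthogonality\<close>).

  Both sides have Laurent expansions at \<open>t = 0\<close>.  The constant terms show that \<open>#(l P)\<close> is a polynomial
  in \<open>l\<close>, in which \<open>l\<^sup>q\<close> has a coefficient made of \<open>\<langle>p\<^sub>I, \<xi>\<rangle>\<^sup>q\<close> and of the coefficients of \<open>t\<^sup>-\<^sup>q\<close> in the
  products over \<open>i \<in> I\<close> (\<open>card_face_points\<close>).  The same holds for every face \<open>P\<^sub>J\<close>, with the products
  over \<open>i \<in> I - J\<close>.  Since the number of lattice points in \<open>l P\<^sub>J\<close> is asymptotic to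
  \<open>l\<^sup>n\<^sup>-\<^sup>k vol P\<^sub>J\<close>, the leading coefficient for \<open>P\<^sub>J\<close> is \<open>vol P\<^sub>J\<close> (\<open>lattice_volume_face\<close>).

  So \<open>a\<^sub>k(P)\<close> and all \<open>vol P\<^sub>J\<close>, \<open>|J| = k\<close>, are sums over vertices, and the theorem reduces to one identity at
  each vertex (\<open>vertex_local_formula\<close>): the coefficient of \<open>t\<^sup>-\<^sup>(\<^sup>n\<^sup>-\<^sup>k\<^sup>)\<close> in the product over \<open>i \<in> I\<close> is a
  sum over the \<open>J \<subseteq> I\<close> with \<open>|J| = k\<close> and \<open>\<chi>\<^sub>i(h) = 1\<close> off \<open>J\<close>, where \<open>J\<close> contributes the degree 0 component
  from \<open>\<mu>\<^sub>k(J)\<close> times \<open>\<Prod>\<^sub>i 1 / \<langle>u\<^sub>i, \<xi>\<rangle>\<close>, \<open>i \<in> I - J\<close>.  This is where \<open>\<xi>\<close> has to lie in the plane \<open>E\<close> at which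
  \<open>\<mu>\<^sub>k\<close> is evaluated.  As \<open>dim E = n - k + 1\<close>, the \<open>n - k\<close> forms \<open>u\<^sub>i\<close>, \<open>i \<in> I - J\<close>, vanish on a line in \<open>E\<close>; it is
  spanned by a vector \<open>e\<^sub>J\<close> with \<open>f\<^sup>J(x\<^sub>j) = \<langle>u\<^sub>j, e\<^sub>J\<rangle>\<close> for \<open>j \<in> J\<close> (\<open>f_form_apex\<close>), by expansion of a
  determinant along its first row.  Interpolation at the points \<open>e\<^sub>J\<close> recovers a homogeneous polynomial of
  suitable degree on \<open>E\<close> from its values there (\<open>lagrange_interpolation\<close>), and applied to the monomials of the
  Laurent expansion it yields the identity (\<open>interpolation_laurent\<close>).  The \<open>h \<in> H\<^sub>I\<close> with \<open>\<chi>\<^sub>i(h) = 1\<close> off \<open>J\<close>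
  form the group \<open>H\<^sub>J\<close> (\<open>sum_H_grp_restrict\<close>), so that the sum over \<open>h\<close> turns these components into
  \<open>|H\<^sub>J| \<mu>\<^sub>k(J)\<close>.

  The identity holds for all \<open>E\<close> on which no \<open>f\<^sup>J(x\<^sub>j)\<close> vanishes.  These \<open>E\<close> form a nonempty open set, because
  finitely many homogeneous forms, none of them identically zero, have a common point where none
  vanishes (\<open>common_nonzero\<close>).
\<close>

text \<open>From here on \<open>\<bullet>\<close> and \<open>$\<close> stand only for the inner product and the components of \<open>real ^ 'n\<close> and \<open>complex ^ 'n\<close>.\<close>

no_notation Matrix.scalar_prod (infix "\<bullet>" 70)
no_notation Matrix.vec_index (infixl "$" 100)
no_notation fps_nth (infixl "$" 75)

section \<open>Lattices and their subgroups\<close>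

definition add_subgroup :: "'a::real_vector set \<Rightarrow> bool" where
  "add_subgroup L \<longleftrightarrow> 0 \<in> L \<and> (\<forall>x\<in>L. \<forall>y\<in>L. x - y \<in> L)"

lemma add_subgroup_closed:
  assumes "add_subgroup L"
  shows "0 \<in> L" and "x \<in> L \<Longrightarrow> y \<in> L \<Longrightarrow> x - y \<in> L" and "x \<in> L \<Longrightarrow> - x \<in> L"
    and "x \<in> L \<Longrightarrow> y \<in> L \<Longrightarrow> x + y \<in> L"
proof -
  show 0: "0 \<in> L" and d: "x \<in> L \<Longrightarrow> y \<in> L \<Longrightarrow> x - y \<in> L" for x y
    using assms by (auto simp: add_subgroup_def)
  show m: "x \<in> L \<Longrightarrow> - x \<in> L" for x
    using d[OF 0, of x] by simp
  show "x \<in> L \<Longrightarrow> y \<in> L \<Longrightarrow> x + y \<in> L" for x y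
    using d[of x "- y"] m[of y] by simp
qed

lemma add_subgroup_nat_scale:
  assumes "add_subgroup L" "x \<in> L"
  shows "real m *\<^sub>R x \<in> L"
  by (induction m) (auto simp: scaleR_left_distrib add_subgroup_closed[OF assms(1)] assms(2))

lemma add_subgroup_int_scale:
  assumes "add_subgroup L" "x \<in> L"
  shows "real_of_int k *\<^sub>R x \<in> L"
proof (cases "k \<ge> 0")
  case True
  then show ?thesis using add_subgroup_nat_scale[OF assms, of "nat k"] by simp
next
  case False
  then show ?thesis
    using add_subgroup_closed(3)[OF assms(1) add_subgroup_nat_scale[OF assms, of "nat (- k)"]] by simp
qed

lemma add_subgroup_sum:
  assumes "add_subgroup L" "\<And>b. b \<in> T \<Longrightarrow> f b \<in> L"
  shows "sum f T \<in> L"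
  using assms(2)
  by (induction T rule: infinite_finite_induct) (auto simp: add_subgroup_closed[OF assms(1)])

lemma int_span_finite:
  assumes "finite B"
  shows "int_span B = {x. \<exists>c. x = (\<Sum>b\<in>B. real_of_int (c b) *\<^sub>R b)}"
proof (intro equalityI subsetI)
  fix x assume "x \<in> int_span B"
  then obtain T c where T: "finite T" "T \<subseteq> B" "x = (\<Sum>b\<in>T. real_of_int (c b) *\<^sub>R b)"
    by (auto simp: int_span_def)
  have "x = (\<Sum>b\<in>B. real_of_int (if b \<in> T then c b else 0) *\<^sub>R b)"
    unfolding T(3) using T assms by (intro sum.mono_neutral_cong_left) auto
  then show "x \<in> {x. \<exists>c. x = (\<Sum>b\<in>B. real_of_int (c b) *\<^sub>R b)}"
    by (intro CollectI exI[of _ "\<lambda>b. if b \<in> T then c b else 0"])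
next
  fix x assume "x \<in> {x. \<exists>c. x = (\<Sum>b\<in>B. real_of_int (c b) *\<^sub>R b)}"
  then show "x \<in> int_span B" using assms by (auto simp: int_span_def)
qed

lemma int_span_subset:
  assumes "add_subgroup L" "B \<subseteq> L" shows "int_span B \<subseteq> L"
  using assms by (auto simp: int_span_def intro!: add_subgroup_sum add_subgroup_int_scale)

lemma int_span_superset: "B \<subseteq> int_span B"
proof
  fix x assume "x \<in> B"
  then show "x \<in> int_span B"
    unfolding int_span_def
    by (intro CollectI exI[of _ "{x}"] exI[of _ "\<lambda>_. 1"]) auto
qed

lemma add_subgroup_int_span: "add_subgroup (int_span B)"
  unfolding add_subgroup_def
proof (intro conjI ballI)
  show "0 \<in> int_span B" unfolding int_span_def by (intro CollectI exI[of _ "{}"]) auto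
  fix x y assume "x \<in> int_span B" "y \<in> int_span B"
  then obtain S c T d where S: "finite S" "S \<subseteq> B" "x = (\<Sum>b\<in>S. real_of_int (c b) *\<^sub>R b)"
    and T: "finite T" "T \<subseteq> B" "y = (\<Sum>b\<in>T. real_of_int (d b) *\<^sub>R b)"
    unfolding int_span_def by blast
  have x: "x \<in> int_span (S \<union> T)"
    unfolding S(3) using S T by (auto simp: int_span_def)
  have y: "y \<in> int_span (S \<union> T)"
    unfolding T(3) using S T by (auto simp: int_span_def)
  obtain c' d' where "x = (\<Sum>b\<in>S\<union>T. real_of_int (c' b) *\<^sub>R b)" "y = (\<Sum>b\<in>S\<union>T. real_of_int (d' b) *\<^sub>R b)"
    using x y int_span_finite[of "S \<union> T"] S(1) T(1) by auto
  then have "x - y = (\<Sum>b\<in>S\<union>T. real_of_int (c' b - d' b) *\<^sub>R b)"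
    by (simp add: sum_subtractf scaleR_left_diff_distrib)
  then show "x - y \<in> int_span B" unfolding int_span_def
    using S T by (intro CollectI exI[of _ "S \<union> T"] exI[of _ "\<lambda>b. c' b - d' b"]) auto
qed

lemma int_span_eq_iff: "int_span L = L \<longleftrightarrow> add_subgroup L"
  by (metis add_subgroup_int_span int_span_subset int_span_superset order_refl subset_antisym)

lemma int_span_mono: "A \<subseteq> B \<Longrightarrow> int_span A \<subseteq> int_span B"
  by (rule int_span_subset[OF add_subgroup_int_span]) (use int_span_superset in blast)

lemma int_span_subset_span: "int_span B \<subseteq> span B"
proof
  fix x assume "x \<in> int_span B"
  then obtain T c where T: "T \<subseteq> B" "x = (\<Sum>b\<in>T. real_of_int (c b) *\<^sub>R b)"
    unfolding int_span_def by blast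
  show "x \<in> span B" unfolding T(2) using T(1) by (intro span_sum span_scale span_base) auto
qed

lemma representation_of_sum:
  assumes "independent B" "finite B" "b \<in> B"
  shows "representation B (\<Sum>a\<in>B. c a *\<^sub>R a) b = c b"
proof -
  have "representation B (\<Sum>a\<in>B. c a *\<^sub>R a) b = (\<Sum>a\<in>B. c a * (if a = b then 1 else 0))"
    using assms by (simp add: representation_sum representation_scale span_base span_scale
        representation_basis eq_commute)
  also have "\<dots> = (\<Sum>a\<in>B. if a = b then c a else 0)" by (intro sum.cong) auto
  finally show ?thesis using assms by simp
qed

lemma int_span_iff_representation:
  assumes "independent B" "finite B"
  shows "x \<in> int_span B \<longleftrightarrow> x \<in> span B \<and> (\<forall>b\<in>B. representation B x b \<in> \<int>)"
proof
  assume x: "x \<in> int_span B"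
  then obtain c where c: "x = (\<Sum>b\<in>B. real_of_int (c b) *\<^sub>R b)"
    using int_span_finite[OF assms(2)] by auto
  have "representation B x b = real_of_int (c b)" if "b \<in> B" for b
    unfolding c by (rule representation_of_sum[OF assms that])
  with x show "x \<in> span B \<and> (\<forall>b\<in>B. representation B x b \<in> \<int>)"
    using int_span_subset_span by auto
next
  assume x: "x \<in> span B \<and> (\<forall>b\<in>B. representation B x b \<in> \<int>)"
  have "x = (\<Sum>b\<in>B. representation B x b *\<^sub>R b)"
    using sum_representation_eq[OF assms(1) _ assms(2), of x] x by simp
  also have "\<dots> = (\<Sum>b\<in>B. real_of_int \<lfloor>representation B x b\<rfloor> *\<^sub>R b)"
    using x by (intro sum.cong) auto
  finally show "x \<in> int_span B"
    unfolding int_span_finite[OF assms(2)] by (intro CollectI exI)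
qed

lemma linear_form_unique_inner:
  fixes f :: "'a::euclidean_space \<Rightarrow> real"
  assumes "linear f"
  shows "\<exists>!u. \<forall>x. u \<bullet> x = f x"
proof (rule ex1I)
  show "\<forall>x. (\<Sum>e\<in>Basis. f e *\<^sub>R e) \<bullet> x = f x"
  proof
    fix x
    have "f x = f (\<Sum>e\<in>Basis. (x \<bullet> e) *\<^sub>R e)" by (simp add: euclidean_representation)
    also have "\<dots> = (\<Sum>e\<in>Basis. (x \<bullet> e) * f e)"
      using assms by (simp add: linear_sum linear_scale)
    finally show "(\<Sum>e\<in>Basis. f e *\<^sub>R e) \<bullet> x = f x"
      by (simp add: inner_sum_left inner_commute[of x] mult.commute)
  qed
  then show "u = (\<Sum>e\<in>Basis. f e *\<^sub>R e)" if "\<forall>x. u \<bullet> x = f x" for u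
    using that by (metis vector_eq_rdot)
qed

lemma linear_representation:
  assumes "independent B" "span B = UNIV"
  shows "linear (\<lambda>x. representation B x b)"
  by (rule linearI) (simp_all add: representation_add[OF assms(1)] representation_scale[OF assms(1)] assms(2))

text \<open>The pairings with \<open>W\<close> map \<open>L \<inter> A\<close> injectively to a bounded set of integer vectors.\<close>

lemma finite_bounded_integral:
  fixes L :: "'a::real_inner set"
  assumes W: "finite W" and inj: "\<And>x. (\<And>w. w \<in> W \<Longrightarrow> x \<bullet> w = 0) \<Longrightarrow> x = 0"
    and int: "\<And>x w. x \<in> L \<Longrightarrow> w \<in> W \<Longrightarrow> x \<bullet> w \<in> \<int>" and bd: "bounded A"
  shows "finite (L \<inter> A)"
proof -
  obtain C where C: "\<And>x. x \<in> A \<Longrightarrow> norm x \<le> C" using bd bounded_iff by blast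
  define R where "R = \<bar>C\<bar> * (\<Sum>w\<in>W. norm w)"
  let ?g = "\<lambda>x. restrict (\<lambda>w. x \<bullet> w) W"
  have "?g ` (L \<inter> A) \<subseteq> PiE W (\<lambda>_. {k \<in> \<int>. \<bar>k\<bar> \<le> R})"
  proof (intro image_subsetI PiE_I)
    fix x w assume x: "x \<in> L \<inter> A" and w: "w \<in> W"
    have "\<bar>x \<bullet> w\<bar> \<le> norm x * norm w" by (rule Cauchy_Schwarz_ineq2)
    also have "\<dots> \<le> \<bar>C\<bar> * (\<Sum>w\<in>W. norm w)"
      using x C[of x] w W by (intro mult_mono member_le_sum) auto
    finally show "?g x w \<in> {k \<in> \<int>. \<bar>k\<bar> \<le> R}" using x w int by (auto simp: R_def)
  qed auto
  moreover have "finite (PiE W (\<lambda>_. {k \<in> \<int>. \<bar>k\<bar> \<le> R}))"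
    by (intro finite_PiE W finite_abs_int_segment)
  ultimately have "finite (?g ` (L \<inter> A))" using finite_subset by blast
  moreover have "inj_on ?g (L \<inter> A)"
  proof (rule inj_onI)
    fix x y assume eq: "?g x = ?g y"
    have "x \<bullet> w = y \<bullet> w" if "w \<in> W" for w using fun_cong[OF eq, of w] that by simp
    then show "x = y" using inj[of "x - y"] by (simp add: inner_diff_left)
  qed
  ultimately show ?thesis using finite_imageD by blast
qed

text \<open>
  The basis dual to a basis of \<open>M\<close> consists of vectors of the dual lattice.  Pairing with it recovers the
  integrality of coordinates, and so the membership in \<open>M\<close>.
\<close>

lemma full_lattice_dual:
  fixes M :: "'a::euclidean_space set"
  assumes "full_lattice M"
  shows "add_subgroup M" and "add_subgroup (dual_lattice M)"
    and "\<And>x. x \<in> M \<longleftrightarrow> (\<forall>w\<in>dual_lattice M. x \<bullet> w \<in> \<int>)"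
    and "\<And>A. bounded A \<Longrightarrow> finite (M \<inter> A)"
    and "\<And>A. bounded A \<Longrightarrow> finite (dual_lattice M \<inter> A)"
    and "span M = UNIV"
proof -
  obtain B where B: "independent B" "span B = UNIV" "M = int_span B"
    using assms by (auto simp: full_lattice_def)
  have fin: "finite B" using B(1) independent_imp_finite by blast
  show "add_subgroup M" using B(3) add_subgroup_int_span by blast
  show "add_subgroup (dual_lattice M)"
    unfolding dual_lattice_def add_subgroup_def by (auto simp: inner_diff_right)
  have BM: "B \<subseteq> M" using int_span_superset B(3) by blast
  then show "span M = UNIV" using B(2) span_mono by blast
  define w where "w = (\<lambda>b. THE u. \<forall>x. u \<bullet> x = representation B x b)"
  have w: "w b \<bullet> x = representation B x b" for b x
    using theI'[OF linear_form_unique_inner[OF linear_representation[OF B(1,2), of b]]]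
    unfolding w_def by blast
  have wN: "w b \<in> dual_lattice M" if "b \<in> B" for b
    unfolding dual_lattice_def B(3)
    using int_span_iff_representation[OF B(1) fin] that by (auto simp: inner_commute[of _ "w b"] w)
  show "x \<in> M \<longleftrightarrow> (\<forall>w\<in>dual_lattice M. x \<bullet> w \<in> \<int>)" for x
  proof
    assume x: "\<forall>w\<in>dual_lattice M. x \<bullet> w \<in> \<int>"
    have "representation B x b \<in> \<int>" if "b \<in> B" for b
      using x wN[OF that] w[of b x] by (metis inner_commute)
    then show "x \<in> M"
      using int_span_iff_representation[OF B(1) fin, of x] B by auto
  qed (auto simp: dual_lattice_def)
  show "finite (M \<inter> A)" if "bounded A" for A
  proof (rule finite_bounded_integral[of "w ` B"])
    fix x assume *: "\<And>v. v \<in> w ` B \<Longrightarrow> x \<bullet> v = 0"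
    have "representation B x b = 0" if "b \<in> B" for b
      using *[of "w b"] that w[of b x] by (simp add: inner_commute)
    then show "x = 0"
      using sum_representation_eq[OF B(1) _ fin, of x] B(2) by simp
  next
    fix x v assume "x \<in> M" "v \<in> w ` B"
    then show "x \<bullet> v \<in> \<int>" using wN by (auto simp: dual_lattice_def)
  qed (use fin that in auto)
  show "finite (dual_lattice M \<inter> A)" if "bounded A" for A
  proof (rule finite_bounded_integral[of B])
    fix x assume *: "\<And>v. v \<in> B \<Longrightarrow> x \<bullet> v = 0"
    have "x \<bullet> y = 0" for y
      using span_induct[of y B "\<lambda>y. x \<bullet> y = 0"] * B(2)
      by (simp add: subspace_def inner_add_right)
    then show "x = 0" by (metis inner_eq_zero_iff)
  next
    fix x v assume "x \<in> dual_lattice M" "v \<in> B"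
    then show "x \<bullet> v \<in> \<int>" using BM by (auto simp: dual_lattice_def inner_commute)
  qed (use fin that in auto)
qed

text \<open>
  Reducing coordinates modulo 1 maps \<open>L\<close> to a bounded and hence finite set \<open>D\<close>.  Among the multiples
  \<open>0, x, \<dots>, card D x\<close> two have the same reduction, so some \<open>k x\<close> with \<open>0 < k \<le> card D\<close> is an integral
  combination of \<open>V\<close>.  The factorial of \<open>card D\<close> is a multiple of all these \<open>k\<close>.
\<close>

lemma sublattice_uniform_multiple:
  fixes L :: "'a::euclidean_space set"
  assumes L: "add_subgroup L" and disc: "\<And>A. bounded A \<Longrightarrow> finite (L \<inter> A)"
    and V: "independent V" "V \<subseteq> L" "span V = UNIV"
  obtains K :: nat where "K > 0" "\<And>x. x \<in> L \<Longrightarrow> real K *\<^sub>R x \<in> int_span V"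
proof -
  have fin: "finite V" using V(1) independent_imp_finite by blast
  define fl where "fl = (\<lambda>x. \<Sum>v\<in>V. real_of_int \<lfloor>representation V x v\<rfloor> *\<^sub>R v)"
  have flV: "fl x \<in> int_span V" for x using int_span_finite[OF fin] by (auto simp: fl_def)
  define D where "D = L \<inter> cball 0 (\<Sum>v\<in>V. norm v)"
  have D: "finite D" unfolding D_def by (rule disc) auto
  have fr: "x - fl x \<in> D" if "x \<in> L" for x
  proof -
    have "x - fl x = (\<Sum>v\<in>V. frac (representation V x v) *\<^sub>R v)"
      using sum_representation_eq[OF V(1) _ fin, of x] V(3)
      by (simp add: fl_def frac_def scaleR_left_diff_distrib sum_subtractf)
    then have "norm (x - fl x) \<le> (\<Sum>v\<in>V. norm (frac (representation V x v) *\<^sub>R v))"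
      by (simp only: norm_sum)
    also have "\<dots> \<le> (\<Sum>v\<in>V. norm v)"
      by (intro sum_mono) (simp add: mult_left_le_one_le frac_lt_1 less_imp_le)
    finally show ?thesis using that flV[of x] int_span_subset[OF L V(2)]
      by (auto simp: D_def intro: add_subgroup_closed[OF L])
  qed
  have "real (fact (card D)) *\<^sub>R x \<in> int_span V" if x: "x \<in> L" for x
  proof -
    let ?g = "\<lambda>j::nat. real j *\<^sub>R x - fl (real j *\<^sub>R x)"
    have "?g ` {0..card D} \<subseteq> D" using fr add_subgroup_nat_scale[OF L x] by auto
    then have "card (?g ` {0..card D}) \<le> card D" by (rule card_mono[OF D])
    then have "\<not> inj_on ?g {0..card D}" using card_image[of ?g "{0..card D}"] by auto
    then obtain a b where ab: "a \<in> {0..card D}" "b \<in> {0..card D}" "a \<noteq> b" "?g a = ?g b"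
      by (auto simp: inj_on_def)
    have *: "real (j - i) *\<^sub>R x \<in> int_span V" if "i < j" "?g i = ?g j" for i j
    proof -
      have "real (j - i) *\<^sub>R x = fl (real j *\<^sub>R x) - fl (real i *\<^sub>R x)"
        using that by (simp add: of_nat_diff scaleR_left_diff_distrib algebra_simps)
      then show ?thesis by (metis flV add_subgroup_closed(2) add_subgroup_int_span)
    qed
    obtain k where k: "k > 0" "k \<le> card D" "real k *\<^sub>R x \<in> int_span V"
    proof (cases "a < b")
      case True then show thesis using that[of "b - a"] *[of a b] ab by auto
    next
      case False then show thesis using that[of "a - b"] *[of b a] ab by auto
    qed
    then obtain q where "fact (card D) = k * q"
      using dvd_fact[of k "card D"] by (auto simp: dvd_def)
    then have "real (fact (card D)) = real q * real k"
      by (simp only: of_nat_mult mult.commute)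
    then have "real (fact (card D)) *\<^sub>R x = real q *\<^sub>R (real k *\<^sub>R x)"
      by (simp only: scaleR_scaleR)
    then show ?thesis using add_subgroup_nat_scale[OF add_subgroup_int_span k(3)] by (simp only:)
  qed
  then show thesis using that[of "fact (card D)"] by (simp only: fact_gt_zero)
qed

lemma int_subgroup_principal:
  fixes Z :: "int set"
  assumes "0 \<in> Z" "\<And>x y. x \<in> Z \<Longrightarrow> y \<in> Z \<Longrightarrow> x - y \<in> Z"
  obtains d where "d \<in> Z" "\<And>x. x \<in> Z \<Longrightarrow> d dvd x"
proof (cases "Z = {0}")
  case True then show thesis using that[of 0] by auto
next
  case False
  have neg: "- x \<in> Z" if "x \<in> Z" for x using assms(2)[OF assms(1) that] by simp
  have add: "x + y \<in> Z" if "x \<in> Z" "y \<in> Z" for x y using assms(2)[OF that(1) neg[OF that(2)]] by simp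
  obtain z where z: "z \<in> Z" "z \<noteq> 0" using False assms(1) by blast
  let ?P = "\<lambda>k. k > 0 \<and> int k \<in> Z"
  have "\<exists>k. ?P k"
    by (rule exI[of _ "nat \<bar>z\<bar>"]) (use z neg in \<open>auto simp: abs_if\<close>)
  then have P: "?P (Least ?P)" by (rule LeastI_ex)
  define d where "d = int (Least ?P)"
  have d: "d > 0" "d \<in> Z" using P by (auto simp: d_def)
  have mult: "int k * d \<in> Z" for k
    by (induction k) (auto simp: assms(1) add d algebra_simps)
  have mult: "k * d \<in> Z" for k
  proof (cases "k \<ge> 0")
    case True then show ?thesis using mult[of "nat k"] by simp
  next
    case False then show ?thesis using neg[OF mult[of "nat (-k)"]] by simp
  qed
  have "d dvd x" if "x \<in> Z" for x
  proof (rule ccontr)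
    assume "\<not> d dvd x"
    then have "x mod d \<noteq> 0" by (simp add: dvd_eq_mod_eq_0)
    then have "x mod d > 0" "x mod d < d"
      using d(1) pos_mod_sign[of d x] pos_mod_bound[of d x] by linarith+
    moreover have "x mod d \<in> Z"
      using assms(2)[OF that mult[of "x div d"]] by (simp add: minus_div_mult_eq_mod)
    ultimately have "?P (nat (x mod d))" "nat (x mod d) < Least ?P" by (auto simp: d_def)
    then show False using not_less_Least by blast
  qed
  then show thesis using that d by blast
qed

text \<open>
  Induction on \<open>B\<close>: the \<open>b\<close>-coordinates of \<open>L\<close> form a subgroup \<open>d \<int>\<close> of \<open>\<int>\<close>, and \<open>L\<close> is generated by
  the elements with \<open>b\<close>-coordinate 0 and a single element \<open>g\<close> with \<open>b\<close>-coordinate \<open>d\<close>.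
\<close>

lemma sublattice_basis:
  fixes B :: "'a::real_vector set"
  assumes "finite B" "independent B" "add_subgroup L" "L \<subseteq> int_span B"
  shows "\<exists>C. finite C \<and> independent C \<and> C \<subseteq> span B \<and> L = int_span C"
  using assms
proof (induction B arbitrary: L rule: finite_induct)
  case empty
  then have "L = int_span {}" using add_subgroup_closed(1)
    by (auto simp: int_span_def)
  then show ?case by (intro exI[of _ "{}"]) (auto simp: independent_empty)
next
  case (insert b B)
  have indB: "independent B" using insert.prems(1) independent_mono by blast
  let ?r = "\<lambda>x. representation (insert b B) x b"
  have fin: "finite (insert b B)" using insert by simp
  have Lsp: "x \<in> span (insert b B)" if "x \<in> L" for x
    using that insert.prems(3) int_span_subset_span by blast
  have rint: "?r x \<in> \<int>" if "x \<in> L" for x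
    using int_span_iff_representation[OF insert.prems(1) fin, of x] that insert.prems(3) by auto
  define Z where "Z = {k::int. \<exists>x\<in>L. ?r x = of_int k}"
  have Z0: "0 \<in> Z" unfolding Z_def
    by (auto intro!: bexI[of _ 0] simp: representation_zero add_subgroup_closed[OF insert.prems(2)])
  have Zd: "x - y \<in> Z" if "x \<in> Z" "y \<in> Z" for x y
  proof -
    from that obtain u v where "u \<in> L" "v \<in> L" "?r u = of_int x" "?r v = of_int y" by (auto simp: Z_def)
    then show ?thesis unfolding Z_def
      using Lsp insert.prems(1) add_subgroup_closed(2)[OF insert.prems(2)]
      by (auto intro!: bexI[of _ "u - v"] simp: representation_diff)
  qed
  obtain d where d: "d \<in> Z" "\<And>x. x \<in> Z \<Longrightarrow> d dvd x"
    using int_subgroup_principal[OF Z0 Zd] by blast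
  obtain g where g: "g \<in> L" "?r g = of_int d" using d(1) by (auto simp: Z_def)
  define L0 where "L0 = {x \<in> L. ?r x = 0}"
  have subL0: "add_subgroup L0"
    unfolding add_subgroup_def L0_def
    using add_subgroup_closed[OF insert.prems(2)] Lsp insert.prems(1)
    by (auto simp: representation_zero representation_diff)
  have "L0 \<subseteq> int_span B"
  proof
    fix x assume x: "x \<in> L0"
    then obtain c where c: "x = (\<Sum>a\<in>insert b B. real_of_int (c a) *\<^sub>R a)"
      using insert.prems(3) int_span_finite[OF fin] by (auto simp: L0_def)
    have "?r x = of_int (c b)" unfolding c
      by (rule representation_of_sum[OF insert.prems(1) fin]) simp
    then have "c b = 0" using x by (simp add: L0_def)
    then have "x = (\<Sum>a\<in>B. real_of_int (c a) *\<^sub>R a)" unfolding c using insert.hyps by simp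
    then show "x \<in> int_span B" using int_span_finite[OF insert.hyps(1)] by blast
  qed
  then obtain C where C: "finite C" "independent C" "C \<subseteq> span B" "L0 = int_span C"
    using insert.IH[OF indB subL0] by blast
  have LC: "\<exists>k. x - real_of_int k *\<^sub>R g \<in> L0" if "x \<in> L" for x
  proof -
    obtain z where z: "?r x = of_int z" using rint[OF \<open>x \<in> L\<close>] by (metis Ints_cases)
    then have "z \<in> Z" using that by (auto simp: Z_def)
    then obtain k where k: "z = d * k" using d(2) by (auto simp: dvd_def)
    have "?r (x - real_of_int k *\<^sub>R g) = 0"
      using Lsp g that insert.prems(1) z k
      by (simp add: representation_diff representation_scale span_scale)
    then show ?thesis using that g(1) add_subgroup_closed(2)[OF insert.prems(2)]
        add_subgroup_int_scale[OF insert.prems(2)] by (auto simp: L0_def)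
  qed
  have spB: "span B \<subseteq> span (insert b B)" by (intro span_mono) auto
  show ?case
  proof (cases "d = 0")
    case True
    have "L = L0"
    proof (intro equalityI subsetI)
      fix x assume x: "x \<in> L"
      obtain z where z: "?r x = of_int z" using rint[OF x] by (metis Ints_cases)
      then have "z = 0" using d(2)[of z] x True by (auto simp: Z_def)
      then show "x \<in> L0" using x z by (simp add: L0_def)
    qed (simp add: L0_def)
    then show ?thesis using C spB by blast
  next
    case False
    have "g \<notin> span B"
    proof
      assume "g \<in> span B"
      then have "representation (insert b B) g = representation B g"
        using representation_extend[OF insert.prems(1), of g B] by auto
      then have "?r g = 0" using representation_ne_zero[of B g b] insert.hyps(2) by metis
      then show False using g False by simp
    qed
    then have "g \<notin> span C" using C(3) span_minimal[OF C(3) subspace_span] by blast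
    then have "independent (insert g C)" using C(2) independent_insert span_base by metis
    moreover have "L = int_span (insert g C)"
    proof (intro equalityI subsetI)
      fix x assume "x \<in> L"
      then obtain k where k: "x - real_of_int k *\<^sub>R g \<in> int_span C" using LC C(4) by blast
      have "int_span C \<subseteq> int_span (insert g C)" by (rule int_span_mono) auto
      moreover have "real_of_int k *\<^sub>R g \<in> int_span (insert g C)"
        using add_subgroup_int_scale[OF add_subgroup_int_span] int_span_superset by blast
      ultimately have "(x - real_of_int k *\<^sub>R g) + real_of_int k *\<^sub>R g \<in> int_span (insert g C)"
        using k add_subgroup_closed(4)[OF add_subgroup_int_span] by blast
      then show "x \<in> int_span (insert g C)" by simp
    next
      fix x assume "x \<in> int_span (insert g C)"
      moreover have "insert g C \<subseteq> L" using g(1) C(4) int_span_superset[of C] by (auto simp: L0_def)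
      ultimately show "x \<in> L" using int_span_subset[OF insert.prems(2)] by blast
    qed
    moreover have "insert g C \<subseteq> span (insert b B)" using C(3) spB Lsp[OF g(1)] by auto
    ultimately show ?thesis using C(1) by blast
  qed
qed

lemma full_lattice_subgroup_basis:
  fixes M :: "'a::euclidean_space set"
  assumes "full_lattice M" "add_subgroup L" "L \<subseteq> M"
  obtains us where "lattice_basis L us"
proof -
  obtain B where "independent B" "M = int_span B" using assms(1) by (auto simp: full_lattice_def)
  then obtain C where C: "finite C" "independent C" "L = int_span C"
    using sublattice_basis[of B L] assms independent_imp_finite[of B] by auto
  obtain us where "set us = C" "distinct us" using finite_distinct_list[OF C(1)] by blast
  then show thesis using that C by (auto simp: lattice_basis_def)
qed

section \<open>Cosets and character sums\<close>

text \<open>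
  The quotients \<open>H\<^sub>J\<close> are sets of classes of this relation, and characters on them are evaluated at
  the representative \<open>SOME w. w \<in> h\<close>.
\<close>

abbreviation coset_rel :: "'a::real_vector set \<Rightarrow> 'a set \<Rightarrow> ('a \<times> 'a) set" where
  "coset_rel G K \<equiv> {(x, y). x \<in> G \<and> y \<in> G \<and> x - y \<in> K}"

lemma equiv_coset_rel:
  assumes "add_subgroup K"
  shows "equiv G (coset_rel G K)"
proof (rule equivI)
  show "refl_on G (coset_rel G K)" using add_subgroup_closed[OF assms] by (auto simp: refl_on_def)
  show "sym (coset_rel G K)"
    using add_subgroup_closed(3)[OF assms] by (force simp: sym_def)
  show "trans (coset_rel G K)"
    using add_subgroup_closed(4)[OF assms] by (force simp: trans_def)
qed auto

lemma coset_representative: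
  assumes "add_subgroup K" "h \<in> G // coset_rel G K"
  shows "(SOME w. w \<in> h) \<in> h" "h \<subseteq> G" "\<And>x y. x \<in> h \<Longrightarrow> y \<in> h \<Longrightarrow> x - y \<in> K"
proof -
  note eq = equiv_coset_rel[OF assms(1), of G]
  have "h \<noteq> {}" using in_quotient_imp_non_empty[OF eq assms(2)] .
  then show "(SOME w. w \<in> h) \<in> h" by (simp add: some_in_eq)
  show "h \<subseteq> G" using in_quotient_imp_subset[OF eq assms(2)] .
  show "x - y \<in> K" if "x \<in> h" "y \<in> h" for x y
    using quotient_eq_iff[OF eq assms(2) assms(2) that] by auto
qed

lemma coset_of_member:
  assumes "add_subgroup K" "g \<in> G"
  shows "coset_rel G K `` {g} \<in> G // coset_rel G K" "g \<in> coset_rel G K `` {g}"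
proof -
  show "coset_rel G K `` {g} \<in> G // coset_rel G K" by (rule quotientI[OF assms(2)])
  show "g \<in> coset_rel G K `` {g}" using assms(2) add_subgroup_closed(1)[OF assms(1)] by auto
qed

lemma coset_eqI:
  assumes "add_subgroup K" "h \<in> G // coset_rel G K" "h' \<in> G // coset_rel G K"
    "x \<in> h" "y \<in> h'" "x - y \<in> K"
  shows "h = h'"
proof -
  have "x \<in> G" "y \<in> G"
    using coset_representative(2)[OF assms(1)] assms(2-5) by blast+
  then show ?thesis
    using quotient_eq_iff[OF equiv_coset_rel[OF assms(1)] assms(2-5)] assms(6) by simp
qed

text \<open>If \<open>f g \<noteq> 1\<close>, adding \<open>g\<close> permutes the cosets and multiplies the sum by \<open>f g\<close>, so the sum is 0.\<close>

lemma sum_cosets_character: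
  fixes f :: "'a::real_vector \<Rightarrow> complex"
  assumes G: "add_subgroup G" and K: "add_subgroup K" "K \<subseteq> G" and fin: "finite (G // coset_rel G K)"
    and mult: "\<And>x y. x \<in> G \<Longrightarrow> y \<in> G \<Longrightarrow> f (x + y) = f x * f y" and triv: "\<And>x. x \<in> K \<Longrightarrow> f x = 1"
  shows "(\<Sum>h\<in>G // coset_rel G K. f (SOME w. w \<in> h)) =
    (if \<forall>g\<in>G. f g = 1 then of_nat (card (G // coset_rel G K)) else 0)"
proof (cases "\<forall>g\<in>G. f g = 1")
  case True
  have "f (SOME w. w \<in> h) = 1" if "h \<in> G // coset_rel G K" for h
    using coset_representative(1,2)[OF K(1) that] True by blast
  then show ?thesis using True by simp
next
  case False
  then obtain g where g: "g \<in> G" "f g \<noteq> 1" by blast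
  let ?Q = "G // coset_rel G K" and ?rep = "\<lambda>h. SOME w. w \<in> h"
  have rep: "?rep h \<in> h" "?rep h \<in> G" if "h \<in> ?Q" for h
    using coset_representative(1,2)[OF K(1) that] by auto
  have same: "f x = f y" if "h \<in> ?Q" "x \<in> h" "y \<in> h" for h x y
  proof -
    have "x - y \<in> K" "y \<in> G" "x - y \<in> G"
      using coset_representative(2,3)[OF K(1) that(1)] that K(2) by auto
    then show ?thesis using mult[of y "x - y"] triv by simp
  qed
  define \<tau> where "\<tau> h = coset_rel G K `` {?rep h + g}" for h
  have \<tau>: "\<tau> h \<in> ?Q" "?rep h + g \<in> \<tau> h" if "h \<in> ?Q" for h
    using coset_of_member[OF K(1) add_subgroup_closed(4)[OF G rep(2)[OF that] g(1)]]
    by (auto simp: \<tau>_def)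
  have "inj_on \<tau> ?Q"
  proof (rule inj_onI)
    fix h h' assume h: "h \<in> ?Q" "h' \<in> ?Q" "\<tau> h = \<tau> h'"
    have "?rep h - ?rep h' = (?rep h + g) - (?rep h' + g)" by simp
    moreover have "(?rep h + g) - (?rep h' + g) \<in> K"
      using coset_representative(3)[OF K(1) \<tau>(1)[OF h(1)] \<tau>(2)[OF h(1)]] \<tau>(2)[OF h(2)] h(3) by blast
    ultimately show "h = h'" using coset_eqI[OF K(1) h(1,2) rep(1)[OF h(1)] rep(1)[OF h(2)]] by simp
  qed
  then have bij: "bij_betw \<tau> ?Q ?Q"
    using endo_inj_surj[OF fin] \<tau>(1) by (auto simp: bij_betw_def)
  have "(\<Sum>h\<in>?Q. f (?rep h)) = (\<Sum>h\<in>?Q. f (?rep (\<tau> h)))"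
    by (rule sum.reindex_bij_betw[OF bij, symmetric])
  also have "\<dots> = (\<Sum>h\<in>?Q. f (?rep h) * f g)"
    using same[OF \<tau>(1) rep(1)[OF \<tau>(1)] \<tau>(2)] mult rep g(1) by (intro sum.cong) auto
  also have "\<dots> = (\<Sum>h\<in>?Q. f (?rep h)) * f g" by (simp add: sum_distrib_right)
  finally show ?thesis using g(2) False by auto
qed

section \<open>Facet normals of a lattice polytope\<close>

lemma inner_span_eq_0:
  fixes y :: "'a::real_inner"
  assumes "x \<in> span V" "\<And>v. v \<in> V \<Longrightarrow> y \<bullet> v = 0"
  shows "y \<bullet> x = 0"
  using assms(1) by (induction rule: span_induct_alt) (auto simp: inner_add_right assms(2))

lemma orthogonal_spanning_eq_0:
  fixes y :: "'a::real_inner"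
  assumes "span V = UNIV" "\<And>v. v \<in> V \<Longrightarrow> y \<bullet> v = 0"
  shows "y = 0"
  using inner_span_eq_0[of y V y] assms by simp

text \<open>
  By discreteness there is a smallest \<open>t > 0\<close> with \<open>t a \<in> N\<close>.  Division with remainder shows that the
  multiples of \<open>a\<close> in \<open>N\<close> are the integral multiples of \<open>t a\<close>.
\<close>

lemma primitive_multiple:
  fixes a :: "'a::euclidean_space"
  assumes N: "add_subgroup N" and disc: "\<And>A. bounded A \<Longrightarrow> finite (N \<inter> A)"
    and a: "a \<noteq> 0" and s: "s \<noteq> 0" "s *\<^sub>R a \<in> N"
  obtains t where "t > 0" "primitive_vector N (t *\<^sub>R a)"
    "\<And>r. r > 0 \<Longrightarrow> primitive_vector N (r *\<^sub>R a) \<Longrightarrow> r = t"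
proof -
  define S where "S = {t. 0 < t \<and> t *\<^sub>R a \<in> N}"
  have abs: "\<bar>r\<bar> \<in> S" if "r \<noteq> 0" "r *\<^sub>R a \<in> N" for r
    using that add_subgroup_closed(3)[OF N that(2)] by (auto simp: S_def abs_if)
  let ?T = "{t \<in> S. t \<le> \<bar>s\<bar>}"
  have "(\<lambda>t. t *\<^sub>R a) ` ?T \<subseteq> N \<inter> cball 0 (\<bar>s\<bar> * norm a)"
    by (auto simp: S_def mult_right_mono)
  moreover have "finite (N \<inter> cball 0 (\<bar>s\<bar> * norm a))" by (rule disc) auto
  ultimately have "finite ((\<lambda>t. t *\<^sub>R a) ` ?T)" by (rule finite_subset)
  then have fin: "finite ?T"
    by (rule finite_imageD) (use a in \<open>auto simp: inj_on_def\<close>)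
  have ne: "\<bar>s\<bar> \<in> ?T" using abs[OF s] by simp
  define t where "t = Min ?T"
  have t: "t \<in> ?T" unfolding t_def using Min_in[OF fin] ne by blast
  have tmin: "t \<le> r" if "r \<in> S" for r
  proof (cases "r \<le> \<bar>s\<bar>")
    case True then show ?thesis unfolding t_def using Min_le[OF fin] that by blast
  next
    case False then show ?thesis using t by auto
  qed
  have t0: "t > 0" "t *\<^sub>R a \<in> N" using t by (auto simp: S_def)
  have mult: "\<exists>q::int. r = q * t" if r: "r *\<^sub>R a \<in> N" for r
  proof -
    define q where "q = \<lfloor>r / t\<rfloor>"
    define e where "e = r - q * t"
    have e: "0 \<le> e" "e < t"
      unfolding e_def q_def using t0(1) floor_divide_lower[of t r] floor_divide_upper[of t r]
      by (auto simp: algebra_simps)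
    have "r *\<^sub>R a - of_int q *\<^sub>R (t *\<^sub>R a) \<in> N"
      using add_subgroup_closed(2)[OF N r add_subgroup_int_scale[OF N t0(2)]] .
    then have "e *\<^sub>R a \<in> N" by (simp add: e_def scaleR_left_diff_distrib)
    then have "e = 0" using e tmin[of e] by (force simp: S_def)
    then show ?thesis by (auto simp: e_def)
  qed
  have prim: "primitive_vector N (t *\<^sub>R a)"
    unfolding primitive_vector_def
  proof (intro conjI ballI allI impI)
    show "t *\<^sub>R a \<in> N" "t *\<^sub>R a \<noteq> 0" using t0 a by auto
    fix w and m :: int assume w: "w \<in> N" "t *\<^sub>R a = of_int m *\<^sub>R w"
    then have m: "m \<noteq> 0" using t0 a by auto
    then have "w = (t / m) *\<^sub>R a"
      using w(2) by (metis divide_inverse_commute left_inverse of_int_eq_0_iff scaleR_one scaleR_scaleR)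
    then have "\<bar>t / m\<bar> \<in> S" using abs[of "t / m"] w(1) t0 m by auto
    then have "t \<le> t / \<bar>of_int m\<bar>" using tmin t0 by (auto simp: abs_divide)
    then have "\<bar>real_of_int m\<bar> \<le> 1" using m t0 by (simp add: field_simps)
    then show "\<bar>m\<bar> = 1" using m by linarith
  qed
  show thesis
  proof (rule that[OF t0(1) prim])
    fix r :: real assume r: "r > 0" "primitive_vector N (r *\<^sub>R a)"
    then obtain q :: int where q: "r = q * t"
      using mult[of r] by (auto simp only: primitive_vector_def)
    then have "q > 0" using r(1) t0(1) by (simp add: zero_less_mult_iff)
    moreover have "\<bar>q\<bar> = 1" using r(2) t0(2) q unfolding primitive_vector_def
      by (metis scaleR_scaleR)
    ultimately show "r = t" using q by simp
  qed
qed

locale simple_lattice_polytope =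
  fixes M P :: "'a::euclidean_space set"
  assumes full_M: "full_lattice M" and lattice_P: "lattice_polytope M P"
    and simple_P: "simple_polytope P" and dim_P: "aff_dim P = int DIM('a)"
begin

abbreviation N where "N \<equiv> dual_lattice M"
abbreviation normal ("\<nu>") where "normal \<equiv> facet_normal M P"
abbreviation level ("\<delta>") where "level \<equiv> facet_level M P"

lemmas M_facts = full_lattice_dual[OF full_M]

lemma polytope_P: "polytope P" using lattice_P by (simp add: lattice_polytope_def)
lemma polyhedron_P: "polyhedron P" using polytope_P by (rule polytope_imp_polyhedron)
lemma compact_P: "compact P" using polytope_P by (rule polytope_imp_compact)
lemma convex_P: "convex P" using polytope_P by (rule polytope_imp_convex)

lemma affine_hull_P: "affine hull P = UNIV" using dim_P by (simp add: aff_dim_eq_full)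

lemma P_ne: "P \<noteq> {}" using dim_P by auto

lemma finite_facets: "finite (facets P)"
  using finite_polyhedron_facets[OF polyhedron_P] by (simp add: facets_def)

text \<open>
  The vertices of a facet are lattice points, so their differences are lattice vectors that span the
  hyperplane parallel to the facet.
\<close>

lemma facet_directions:
  assumes F: "F facet_of P" and a: "a \<noteq> 0" "F = P \<inter> {x. a \<bullet> x = b}"
  obtains C where "C \<subseteq> M" "independent C" "\<And>c. c \<in> C \<Longrightarrow> a \<bullet> c = 0" "card C = DIM('a) - 1"
    "\<And>y. (\<And>u u'. u \<in> F \<Longrightarrow> u' \<in> F \<Longrightarrow> y \<bullet> u = y \<bullet> u') \<Longrightarrow> (\<And>c. c \<in> C \<Longrightarrow> y \<bullet> c = 0)"
proof -
  define V where "V = {x. x extreme_point_of F}"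
  have FP: "F face_of P" using F facet_of_imp_face_of by blast
  have VM: "V \<subseteq> M" "V \<subseteq> F"
    using extreme_point_of_face[OF FP] lattice_P by (auto simp: V_def lattice_polytope_def)
  have F_hull: "F = convex hull V"
    unfolding V_def using Krein_Milman_Minkowski[of F] face_of_imp_compact[OF convex_P compact_P FP]
      face_of_imp_convex[OF FP] by blast
  have "F \<noteq> {}" using F by (auto simp: facet_of_def)
  then obtain x0 where x0: "x0 \<in> V" using F_hull by fastforce
  let ?T = "(+) (- x0) ` V"
  have "aff_dim F = int DIM('a) - 1" using F dim_P by (simp add: facet_of_def)
  then have "aff_dim V = int DIM('a) - 1" using F_hull aff_dim_convex_hull by metis
  then have dimT: "int (dim ?T) = int DIM('a) - 1"
    using aff_dim_eq_dim[of x0 V] x0 hull_inc[of x0 V affine] by simp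
  obtain C where C: "C \<subseteq> ?T" "independent C" "card C = dim ?T"
    using basis_exists[of ?T] by metis
  show thesis
  proof (rule that[OF _ C(2)])
    show "C \<subseteq> M" using C(1) VM x0 add_subgroup_closed(2)[OF M_facts(1)]
      by (force simp: add.commute[of "- x0"])
    show "card C = DIM('a) - 1" using C(3) dimT by simp
    show yc: "y \<bullet> c = 0" if "\<And>u u'. u \<in> F \<Longrightarrow> u' \<in> F \<Longrightarrow> y \<bullet> u = y \<bullet> u'" "c \<in> C" for c y
    proof -
      obtain u where u: "u \<in> V" "c = - x0 + u" using C(1) \<open>c \<in> C\<close> by blast
      then show ?thesis using that(1)[of u x0] VM(2) x0 by (auto simp: inner_diff_right)
    qed
    show "a \<bullet> c = 0" if "c \<in> C" for c by (rule yc[OF _ that]) (use a(2) in simp)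
  qed
qed

lemma facet_parallel:
  assumes F: "F facet_of P" and a: "a \<noteq> 0" "F = P \<inter> {x. a \<bullet> x = b}"
    and y: "\<And>u u'. u \<in> F \<Longrightarrow> u' \<in> F \<Longrightarrow> y \<bullet> u = y \<bullet> u'"
  shows "\<exists>s. y = s *\<^sub>R a"
proof -
  obtain C where C: "C \<subseteq> M" "independent C" "\<And>c. c \<in> C \<Longrightarrow> a \<bullet> c = 0" "card C = DIM('a) - 1"
    and yC: "\<And>c. c \<in> C \<Longrightarrow> y \<bullet> c = 0"
    using facet_directions[OF F a] y by (metis (no_types, lifting))
  have fin: "finite C" using C(2) independent_imp_finite by blast
  have "a \<notin> span C"
  proof
    assume "a \<in> span C"
    then have "a \<bullet> a = 0" by (rule inner_span_eq_0) (use C in simp)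
    then show False using a by simp
  qed
  then have ind: "independent (insert a C)" "a \<notin> C" using C(2) independent_insert span_base by metis+
  have "card (insert a C) = DIM('a)" using ind(2) C(4) fin by (simp add: DIM_positive)
  then have sp: "span (insert a C) = UNIV"
    using card_eq_dim[of "insert a C" UNIV] ind fin by (auto simp: dim_UNIV)
  define s where "s = (y \<bullet> a) / (a \<bullet> a)"
  have "y - s *\<^sub>R a = 0"
    by (rule orthogonal_spanning_eq_0[OF sp])
      (use yC C(3) a in \<open>auto simp: s_def inner_diff_left\<close>)
  then show ?thesis by auto
qed

text \<open>
  The point is that the normal direction of a facet is rational, so that a primitive normal exists.
  For a lattice vector \<open>m\<close> outside the hyperplane of the directions \<open>C\<close>, the form \<open>w\<close> that is 1 at
  \<open>m\<close> and 0 on \<open>C\<close> has a multiple in \<open>N\<close>, and it is proportional to \<open>a\<close>.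
\<close>

lemma facet_normal_direction:
  assumes F: "F facet_of P" and a: "a \<noteq> 0" "P \<subseteq> {x. a \<bullet> x \<le> b}" "F = P \<inter> {x. a \<bullet> x = b}"
  shows "\<exists>t>0. \<nu> F = t *\<^sub>R a \<and> \<delta> F = t * b \<and> primitive_vector N (\<nu> F)"
proof -
  obtain C where C: "C \<subseteq> M" "independent C" "\<And>c. c \<in> C \<Longrightarrow> a \<bullet> c = 0" "card C = DIM('a) - 1"
    using facet_directions[OF F a(1,3)] by metis
  have fin: "finite C" using C(2) independent_imp_finite by blast
  have "\<exists>m\<in>M. a \<bullet> m \<noteq> 0"
    using orthogonal_spanning_eq_0[OF M_facts(6), of a] a(1) by blast
  then obtain m where m: "m \<in> M" "a \<bullet> m \<noteq> 0" by blast
  have "m \<notin> span C"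
  proof
    assume "m \<in> span C"
    then have "a \<bullet> m = 0" by (rule inner_span_eq_0) (use C in simp)
    then show False using m by simp
  qed
  then have ind: "independent (insert m C)" "m \<notin> C" using C(2) independent_insert span_base by metis+
  have "card (insert m C) = DIM('a)" using ind(2) C(4) fin by (simp add: DIM_positive)
  then have sp: "span (insert m C) = UNIV"
    using card_eq_dim[of "insert m C" UNIV] ind fin by (auto simp: dim_UNIV)
  obtain K :: nat where K: "K > 0" "\<And>x. x \<in> M \<Longrightarrow> real K *\<^sub>R x \<in> int_span (insert m C)"
    using sublattice_uniform_multiple[OF M_facts(1,4) ind(1) _ sp] C(1) m(1) by blast
  obtain w where w: "\<And>x. w \<bullet> x = representation (insert m C) x m"
    using linear_form_unique_inner[OF linear_representation[OF ind(1) sp, of m]] by blast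
  have KwN: "real K *\<^sub>R w \<in> N"
    unfolding dual_lattice_def
  proof (intro CollectI ballI)
    fix u assume "u \<in> M"
    then have "representation (insert m C) (real K *\<^sub>R u) m \<in> \<int>"
      using K(2) int_span_iff_representation[OF ind(1)] fin by blast
    moreover have "u \<bullet> (real K *\<^sub>R w) = representation (insert m C) (real K *\<^sub>R u) m"
      using w[of "real K *\<^sub>R u"] by (simp add: inner_commute)
    ultimately show "u \<bullet> (real K *\<^sub>R w) \<in> \<int>" by simp
  qed
  have wC: "w \<bullet> c = 0" if "c \<in> C" for c
    using w[of c] representation_basis[OF ind(1), of c] that ind(2) by (auto split: if_splits)
  have wm: "w \<bullet> m = 1" using w[of m] representation_basis[OF ind(1), of m] by simp
  have "w - (1 / (a \<bullet> m)) *\<^sub>R a = 0"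
    by (rule orthogonal_spanning_eq_0[OF sp])
      (use wC wm C(3) m in \<open>auto simp: inner_diff_left\<close>)
  then have "(real K / (a \<bullet> m)) *\<^sub>R a \<in> N" using KwN by (simp add: eq_iff_diff_eq_0[symmetric])
  moreover have "real K / (a \<bullet> m) \<noteq> 0" using K m by simp
  ultimately obtain t where t: "t > 0" "primitive_vector N (t *\<^sub>R a)"
    and uniq: "\<And>r. r > 0 \<Longrightarrow> primitive_vector N (r *\<^sub>R a) \<Longrightarrow> r = t"
    using primitive_multiple[OF M_facts(2,5) a(1)] by metis
  have "F \<noteq> {}" "F \<noteq> P" using F by (auto simp: facet_of_def)
  then obtain u0 u1 where u0: "u0 \<in> P" "a \<bullet> u0 = b" and u1: "u1 \<in> P" "a \<bullet> u1 < b"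
    using a(2,3) by (force simp: order_less_le)
  have nu: "\<nu> F = t *\<^sub>R a"
    unfolding facet_normal_def
  proof (rule the_equality)
    show "primitive_vector N (t *\<^sub>R a) \<and>
        (\<exists>d. (\<forall>u\<in>P. u \<bullet> t *\<^sub>R a \<le> d) \<and> F = {u \<in> P. u \<bullet> t *\<^sub>R a = d})"
      using t a by (auto intro!: exI[of _ "t * b"] simp: inner_commute)
    fix v assume v: "primitive_vector N v \<and>
        (\<exists>d. (\<forall>u\<in>P. u \<bullet> v \<le> d) \<and> F = {u \<in> P. u \<bullet> v = d})"
    then obtain d where d: "\<And>u. u \<in> P \<Longrightarrow> u \<bullet> v \<le> d" "F = {u \<in> P. u \<bullet> v = d}" by blast
    have "v \<bullet> u = v \<bullet> u'" if "u \<in> F" "u' \<in> F" for u u'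
      using d(2) that by (auto simp: inner_commute)
    then obtain s where s: "v = s *\<^sub>R a" using facet_parallel[OF F a(1,3), of v] by blast
    have "u0 \<in> F" using u0 a(3) by simp
    then have "s * (a \<bullet> u1) \<le> s * (a \<bullet> u0)"
      using d(1)[OF u1(1)] d(2) s by (auto simp: inner_commute)
    then have "\<not> s < 0" using u0 u1 by (simp add: mult_le_cancel_left)
    moreover have "s \<noteq> 0" using v s by (auto simp: primitive_vector_def)
    ultimately have "s > 0" by simp
    then show "v = t *\<^sub>R a" using uniq[of s] v s by blast
  qed
  have "\<delta> F = t * b"
    unfolding facet_level_def nu
  proof (rule the_equality)
    show "F = {u \<in> P. u \<bullet> t *\<^sub>R a = t * b}" using t a(3) by (auto simp: inner_commute)
    show "d = t * b" if "F = {u \<in> P. u \<bullet> t *\<^sub>R a = d}" for d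
    proof -
      have "u0 \<in> F" using u0 a(3) by simp
      then show ?thesis using that u0 by (auto simp: inner_commute)
    qed
  qed
  then show ?thesis using t nu by auto
qed

lemma facet_facts:
  assumes "F \<in> facets P"
  shows "primitive_vector N (\<nu> F)" "u \<in> P \<Longrightarrow> u \<bullet> \<nu> F \<le> \<delta> F" "F = {u \<in> P. u \<bullet> \<nu> F = \<delta> F}" "F \<noteq> {}"
proof -
  have F: "F facet_of P" using assms by (simp add: facets_def)
  obtain a b where ab: "a \<noteq> 0" "P \<subseteq> {x. a \<bullet> x \<le> b}" "F = P \<inter> {x. a \<bullet> x = b}"
    using facet_of_polyhedron[OF polyhedron_P F] by metis
  obtain t where t: "t > 0" "\<nu> F = t *\<^sub>R a" "\<delta> F = t * b" "primitive_vector N (\<nu> F)"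
    using facet_normal_direction[OF F ab] by blast
  show "primitive_vector N (\<nu> F)" "F \<noteq> {}" using t F by (auto simp: facet_of_def)
  show "u \<in> P \<Longrightarrow> u \<bullet> \<nu> F \<le> \<delta> F" using t ab by (auto simp: inner_commute)
  show "F = {u \<in> P. u \<bullet> \<nu> F = \<delta> F}" using t ab by (auto simp: inner_commute)
qed

text \<open>Each half-space of a minimal description of the full-dimensional polytope \<open>P\<close> cuts out a facet.\<close>

lemma P_eq_halfspaces: "P = {u. \<forall>F\<in>facets P. u \<bullet> \<nu> F \<le> \<delta> F}"
proof
  show "P \<subseteq> {u. \<forall>F\<in>facets P. u \<bullet> \<nu> F \<le> \<delta> F}" using facet_facts(2) by blast
next
  obtain H where H: "finite H" and seq: "P = affine hull P \<inter> \<Inter>H"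
    and faces: "\<And>h. h \<in> H \<Longrightarrow> \<exists>a b. a \<noteq> 0 \<and> h = {x. a \<bullet> x \<le> b}"
    and min: "\<And>F'. F' \<subset> H \<Longrightarrow> P \<subset> (affine hull P) \<inter> \<Inter>F'"
    using polyhedron_P by (simp add: polyhedron_Int_affine_minimal) meson
  then obtain a b where ab: "\<And>h. h \<in> H \<Longrightarrow> a h \<noteq> 0 \<and> h = {x. a h \<bullet> x \<le> b h}"
    by metis
  show "{u. \<forall>F\<in>facets P. u \<bullet> \<nu> F \<le> \<delta> F} \<subseteq> P"
  proof
    fix u assume u: "u \<in> {u. \<forall>F\<in>facets P. u \<bullet> \<nu> F \<le> \<delta> F}"
    have "u \<in> h" if h: "h \<in> H" for h
    proof -
      let ?F = "P \<inter> {x. a h \<bullet> x = b h}"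
      have F: "?F facet_of P"
        using facet_of_polyhedron_explicit[OF H seq ab min] h by blast
      have "P \<subseteq> {x. a h \<bullet> x \<le> b h}" using seq ab[OF h] h by blast
      then obtain t where t: "t > 0" "\<nu> ?F = t *\<^sub>R a h" "\<delta> ?F = t * b h"
        using facet_normal_direction[OF F] ab[OF h] by blast
      have "u \<bullet> \<nu> ?F \<le> \<delta> ?F" using u F by (simp add: facets_def)
      then have "a h \<bullet> u \<le> b h" using t by (simp add: inner_commute)
      then show ?thesis using ab[OF h] by blast
    qed
    then show "u \<in> P" using seq affine_hull_P by blast
  qed
qed

lemma inj_normal: "inj_on \<nu> (facets P)"
proof (rule inj_onI)
  fix F G assume FG: "F \<in> facets P" "G \<in> facets P" "\<nu> F = \<nu> G"
  obtain x y where x: "x \<in> F" and y: "y \<in> G" using facet_facts(4) FG by blast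
  have "x \<in> P" "x \<bullet> \<nu> F = \<delta> F" using x facet_facts(3)[OF FG(1)] by auto
  moreover have "y \<in> P" "y \<bullet> \<nu> G = \<delta> G" using y facet_facts(3)[OF FG(2)] by auto
  ultimately have "\<delta> F = \<delta> G" using facet_facts(2)[OF FG(1), of y] facet_facts(2)[OF FG(2), of x] FG(3) by simp
  then show "F = G" using facet_facts(3)[OF FG(1)] facet_facts(3)[OF FG(2)] FG(3) by simp
qed

section \<open>Faces and vertices of a simple lattice polytope\<close>

text \<open>\<open>Simp\<close> is the complex \<open>\<Sigma>\<close>; its maximal simplices \<open>Ver\<close> correspond to the vertices of \<open>P\<close>.\<close>

definition Simp where "Simp = {J. J \<subseteq> facets P \<and> face M P J \<noteq> {}}"
abbreviation Ver where "Ver \<equiv> simplices M P DIM('a)"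

lemma simplices_Simp: "J \<in> simplices M P k \<longleftrightarrow> J \<in> Simp \<and> card J = k"
  by (auto simp: simplices_def Simp_def)

lemma finite_Simp: "finite Simp"
  by (rule finite_subset[of _ "Pow (facets P)"]) (auto simp: Simp_def finite_facets)

lemma finite_simplices [simp]: "finite (simplices M P k)"
  by (rule finite_subset[OF _ finite_Simp]) (auto simp: simplices_Simp)

lemma Simp_finite: "J \<in> Simp \<Longrightarrow> finite J"
  using finite_facets finite_subset by (auto simp: Simp_def)

lemma face_eq_Int: "J \<subseteq> facets P \<Longrightarrow> face M P J = P \<inter> \<Inter>J"
proof (intro equalityI subsetI)
  fix u assume J: "J \<subseteq> facets P" and u: "u \<in> face M P J"
  have "u \<in> F" if "F \<in> J" for F
    by (subst facet_facts(3)) (use J u that in \<open>auto simp: face_def\<close>)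
  then show "u \<in> P \<inter> \<Inter>J" using u by (simp add: face_def)
next
  fix u assume J: "J \<subseteq> facets P" and u: "u \<in> P \<inter> \<Inter>J"
  have "u \<bullet> \<nu> F = \<delta> F" if "F \<in> J" for F
    using facet_facts(3)[of F] J u that by blast
  then show "u \<in> face M P J" using u by (simp add: face_def)
qed

lemma face_face_of:
  assumes "J \<subseteq> facets P" shows "face M P J face_of P"
proof (cases "J = {}")
  case True then show ?thesis using face_eq_Int[OF assms] face_of_refl[OF convex_P] by simp
next
  case False
  then have "\<Inter>J face_of P"
    using assms by (intro face_of_Inter) (auto simp: facets_def intro: facet_of_imp_face_of)
  moreover have "\<Inter>J \<subseteq> P" using False assms facet_of_imp_subset by (fastforce simp: facets_def)
  ultimately show ?thesis using face_eq_Int[OF assms] by (simp add: Int_absorb1)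
qed

lemma face_compact_convex:
  assumes "J \<subseteq> facets P" shows "compact (face M P J)" "convex (face M P J)"
  using face_of_imp_compact[OF convex_P compact_P face_face_of[OF assms]]
    face_of_imp_convex[OF face_face_of[OF assms]] by auto

lemma small_step_in_P:
  assumes p: "p \<in> P" and y: "\<And>F. F \<in> facets P \<Longrightarrow> p \<in> F \<Longrightarrow> y \<bullet> \<nu> F \<le> 0"
  shows "\<exists>\<epsilon>>0. p + \<epsilon> *\<^sub>R y \<in> P"
proof -
  have "eventually (\<lambda>\<epsilon>. \<forall>F\<in>facets P. (p + \<epsilon> *\<^sub>R y) \<bullet> \<nu> F \<le> \<delta> F) (at_right (0::real))"
  proof (rule eventually_ball_finite[OF finite_facets], rule ballI)
    fix F assume F: "F \<in> facets P"
    show "eventually (\<lambda>\<epsilon>. (p + \<epsilon> *\<^sub>R y) \<bullet> \<nu> F \<le> \<delta> F) (at_right (0::real))"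
    proof (cases "p \<in> F")
      case True
      have "p \<bullet> \<nu> F \<le> \<delta> F" using facet_facts(2)[OF F p] .
      then have *: "(p + \<epsilon> *\<^sub>R y) \<bullet> \<nu> F \<le> \<delta> F" if "\<epsilon> > 0" for \<epsilon>
        using y[OF F True] mult_nonneg_nonpos[of \<epsilon> "y \<bullet> \<nu> F"] that by (simp add: inner_add_left)
      show ?thesis using eventually_at_right_less[of 0] by eventually_elim (rule *)
    next
      case False
      then have "p \<bullet> \<nu> F < \<delta> F" using facet_facts(2,3)[OF F] p by (force simp: order_less_le)
      moreover have "((\<lambda>\<epsilon>. (p + \<epsilon> *\<^sub>R y) \<bullet> \<nu> F) \<longlongrightarrow> (p + 0 *\<^sub>R y) \<bullet> \<nu> F) (at_right 0)"
        by (intro tendsto_intros)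
      ultimately have "eventually (\<lambda>\<epsilon>. (p + \<epsilon> *\<^sub>R y) \<bullet> \<nu> F < \<delta> F) (at_right 0)"
        by (intro order_tendstoD(2)) auto
      then show ?thesis by eventually_elim simp
    qed
  qed
  then have "eventually (\<lambda>\<epsilon>. p + \<epsilon> *\<^sub>R y \<in> P) (at_right (0::real))"
    by eventually_elim (use P_eq_halfspaces in blast)
  then have "eventually (\<lambda>\<epsilon>. p + \<epsilon> *\<^sub>R y \<in> P \<and> \<epsilon> > 0) (at_right (0::real))"
    using eventually_at_right_less[of "0::real"] by eventually_elim simp
  then show ?thesis using eventually_happens by force
qed

text \<open>
  A direction orthogonal to the normals of all facets through \<open>p\<close> can be followed a little in both
  senses without leaving \<open>P\<close>; at an extreme point there is none but 0.
\<close>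

lemma extreme_point_simplex:
  assumes p: "p extreme_point_of P"
  shows "card {F \<in> facets P. p \<in> F} = DIM('a)" "face M P {F \<in> facets P. p \<in> F} = {p}"
    "span (\<nu> ` {F \<in> facets P. p \<in> F}) = UNIV"
proof -
  let ?I = "{F \<in> facets P. p \<in> F}"
  show "card ?I = DIM('a)" using simple_P p dim_P by (simp add: simple_polytope_def)
  have pP: "p \<in> P" using p by (simp add: extreme_point_of_def)
  have "{p} face_of P" using p by (simp add: face_of_singleton)
  moreover have "{p} \<noteq> P" using dim_P aff_dim_sing[of p] DIM_positive[where 'a='a] by auto
  ultimately have *: "{p} = \<Inter>{F. F facet_of P \<and> {p} \<subseteq> F}"
    using face_of_polyhedron[OF polyhedron_P, of "{p}"] by blast
  have If: "?I \<subseteq> facets P" by blast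
  show f: "face M P ?I = {p}"
  proof
    show "face M P ?I \<subseteq> {p}"
    proof
      fix u assume "u \<in> face M P ?I"
      then have "u \<in> \<Inter>{F. F facet_of P \<and> {p} \<subseteq> F}" using face_eq_Int[OF If] by (auto simp: facets_def)
      then show "u \<in> {p}" using * by blast
    qed
    show "{p} \<subseteq> face M P ?I" using face_eq_Int[OF If] pP by auto
  qed
  show "span (\<nu> ` ?I) = UNIV"
  proof (rule ccontr)
    assume "span (\<nu> ` ?I) \<noteq> UNIV"
    then obtain y where y: "y \<noteq> 0" "\<And>x. x \<in> span (\<nu> ` ?I) \<Longrightarrow> y \<bullet> x = 0"
      using span_not_UNIV_orthogonal by blast
    have y0: "y \<bullet> \<nu> F = 0" if "F \<in> ?I" for F using y(2)[OF span_base] that by blast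
    obtain e where e: "e > 0" "p + e *\<^sub>R y \<in> P" using small_step_in_P[OF pP, of y] y0 by force
    have "p \<in> face M P ?I" using f by simp
    then have "\<forall>F\<in>?I. p \<bullet> \<nu> F = \<delta> F" unfolding face_def by blast
    then have "\<forall>F\<in>?I. (p + e *\<^sub>R y) \<bullet> \<nu> F = \<delta> F"
      using y0 by (simp add: inner_add_left)
    then have "p + e *\<^sub>R y \<in> face M P ?I" unfolding face_def using e(2) by blast
    then show False using f y e by simp
  qed
qed

definition vtx where "vtx I = (THE p. face M P I = {p})"

text \<open>
  A nonempty face \<open>face M P I\<close> contains an extreme point \<open>p\<close> of \<open>P\<close>.  If \<open>|I| = n\<close>, simplicity leaves no
  facets through \<open>p\<close> other than those in \<open>I\<close>, and the face is \<open>{p}\<close>.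
\<close>

lemma Ver_facts:
  assumes I: "I \<in> Ver"
  shows "face M P I = {vtx I}" "vtx I extreme_point_of P" "I = {F \<in> facets P. vtx I \<in> F}"
    "card I = DIM('a)" "span (\<nu> ` I) = UNIV" "independent (\<nu> ` I)" "finite I" "I \<subseteq> facets P"
    "vtx I \<in> P" "vtx I \<in> M" "\<And>F. F \<in> I \<Longrightarrow> vtx I \<bullet> \<nu> F = \<delta> F" "inj_on \<nu> I" "I \<in> Simp"
proof -
  show Ip: "I \<subseteq> facets P" and cI: "card I = DIM('a)" using I by (auto simp: simplices_def)
  have ne: "face M P I \<noteq> {}" using I by (simp add: simplices_def)
  show "I \<in> Simp" using Ip ne by (simp add: Simp_def)
  obtain p where p: "p extreme_point_of face M P I"
    using extreme_point_exists_convex[OF face_compact_convex[OF Ip] ne] by blast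
  then have pP: "p extreme_point_of P" "p \<in> face M P I"
    using extreme_point_of_face[OF face_face_of[OF Ip]] by auto
  show fin: "finite I" using Ip finite_facets finite_subset by blast
  have "I \<subseteq> {F \<in> facets P. p \<in> F}" using pP(2) face_eq_Int[OF Ip] Ip by auto
  then have Ieq: "I = {F \<in> facets P. p \<in> F}"
    using extreme_point_simplex(1)[OF pP(1)] cI finite_facets by (intro card_subset_eq) auto
  then have fp: "face M P I = {p}" using extreme_point_simplex(2)[OF pP(1)] by simp
  have v: "vtx I = p" unfolding vtx_def fp by auto
  show "face M P I = {vtx I}" "vtx I extreme_point_of P" "I = {F \<in> facets P. vtx I \<in> F}"
    using fp pP Ieq v by auto
  show sp: "span (\<nu> ` I) = UNIV" using extreme_point_simplex(3)[OF pP(1)] Ieq by simp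
  show inj: "inj_on \<nu> I" using inj_normal Ip inj_on_subset by blast
  show "independent (\<nu> ` I)"
    by (rule card_le_dim_spanning[of _ UNIV]) (use sp fin cI card_image[OF inj] in auto)
  show "vtx I \<in> P" "vtx I \<in> M" using pP(1) v lattice_P by (auto simp: extreme_point_of_def lattice_polytope_def)
  show "vtx I \<bullet> \<nu> F = \<delta> F" if "F \<in> I" for F using pP(2) v that by (auto simp: face_def)
qed

lemma extreme_point_vertex:
  assumes "p extreme_point_of P"
  shows "{F \<in> facets P. p \<in> F} \<in> Ver" "vtx {F \<in> facets P. p \<in> F} = p"
proof -
  show "{F \<in> facets P. p \<in> F} \<in> Ver"
    using extreme_point_simplex(1,2)[OF assms] by (simp add: simplices_def)
  show "vtx {F \<in> facets P. p \<in> F} = p" unfolding vtx_def extreme_point_simplex(2)[OF assms] by auto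
qed

lemma Simp_face_vertex:
  assumes J: "J \<in> Simp" and p: "p extreme_point_of face M P J"
  obtains I where "I \<in> Ver" "J \<subseteq> I" "vtx I = p"
proof -
  have Jf: "J \<subseteq> facets P" using J by (simp add: Simp_def)
  have pP: "p extreme_point_of P" "p \<in> face M P J"
    using extreme_point_of_face[OF face_face_of[OF Jf]] p by auto
  have "J \<subseteq> {F \<in> facets P. p \<in> F}" using pP(2) face_eq_Int[OF Jf] Jf by auto
  then show thesis using that extreme_point_vertex[OF pP(1)] by blast
qed

lemma Simp_extend:
  assumes J: "J \<in> Simp" obtains I where "I \<in> Ver" "J \<subseteq> I"
proof -
  have "J \<subseteq> facets P" "face M P J \<noteq> {}" using J by (auto simp: Simp_def)
  then obtain p where "p extreme_point_of face M P J"
    using extreme_point_exists_convex face_compact_convex by metis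
  then show thesis using Simp_face_vertex[OF J] that by metis
qed

lemma Ver_subset_Simp:
  assumes "I \<in> Ver" "J \<subseteq> I"
  shows "J \<in> Simp" "vtx I \<in> face M P J"
proof -
  show "vtx I \<in> face M P J" using Ver_facts[OF assms(1)] assms(2) by (auto simp: face_def)
  then show "J \<in> Simp" using Ver_facts(8)[OF assms(1)] assms(2) by (auto simp: Simp_def)
qed

abbreviation dual ("\<upsilon>") where "dual \<equiv> dual_basis_vector M P"

lemma dual_inner:
  assumes "I \<in> Ver" shows "\<upsilon> I i \<bullet> x = dual_basis M P I i x"
proof -
  have "\<exists>!u. \<forall>x. u \<bullet> x = dual_basis M P I i x"
    unfolding dual_basis_def
    by (rule linear_form_unique_inner[OF linear_representation[OF Ver_facts(6,5)[OF assms]]])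
  then show ?thesis unfolding dual_basis_vector_def using theI'[of "\<lambda>u. \<forall>x. u \<bullet> x = dual_basis M P I i x"] by blast
qed

lemma dual_normal:
  assumes "I \<in> Ver" "i \<in> I" "j \<in> I" shows "\<upsilon> I i \<bullet> \<nu> j = (if i = j then 1 else 0)"
proof -
  have "\<nu> i = \<nu> j \<longleftrightarrow> i = j" using Ver_facts(12)[OF assms(1)] assms by (auto simp: inj_on_def)
  then show ?thesis unfolding dual_inner[OF assms(1)] dual_basis_def
    using representation_basis[OF Ver_facts(6)[OF assms(1)], of "\<nu> j"] assms by auto
qed

lemma dual_expansion:
  assumes "I \<in> Ver" shows "y = (\<Sum>i\<in>I. (y \<bullet> \<nu> i) *\<^sub>R \<upsilon> I i)"
proof -
  have "y - (\<Sum>i\<in>I. (y \<bullet> \<nu> i) *\<^sub>R \<upsilon> I i) = 0"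
  proof (rule orthogonal_spanning_eq_0[OF Ver_facts(5)[OF assms]])
    fix w assume "w \<in> \<nu> ` I"
    then obtain j where j: "j \<in> I" "w = \<nu> j" by blast
    have "(\<Sum>i\<in>I. (y \<bullet> \<nu> i) *\<^sub>R \<upsilon> I i) \<bullet> \<nu> j = (\<Sum>i\<in>I. if i = j then y \<bullet> \<nu> i else 0)"
      unfolding inner_sum_left using dual_normal[OF assms _ j(1)] by (intro sum.cong) auto
    also have "\<dots> = y \<bullet> \<nu> j" using j Ver_facts(7)[OF assms] by simp
    finally show "(y - (\<Sum>i\<in>I. (y \<bullet> \<nu> i) *\<^sub>R \<upsilon> I i)) \<bullet> w = 0" using j by (simp add: inner_diff_left)
  qed
  then show ?thesis by simp
qed

section \<open>Polar decomposition\<close>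

text \<open>
  Up to scaling, the vectors \<open>- \<upsilon> I i\<close> are the directions of the edges of \<open>P\<close> at the vertex \<open>I\<close>.  A
  functional is generic if it is not constant on any edge.
\<close>

definition generic where
  "generic \<zeta> \<longleftrightarrow> (\<forall>I\<in>Ver. \<forall>i\<in>I. \<upsilon> I i \<bullet> \<zeta> \<noteq> 0)"

lemma vertex_expansion:
  assumes I: "I \<in> Ver" "J \<subseteq> I" and x: "\<And>j. j \<in> J \<Longrightarrow> x \<bullet> \<nu> j = \<delta> j"
  shows "x = vtx I - (\<Sum>i\<in>I-J. (\<delta> i - x \<bullet> \<nu> i) *\<^sub>R \<upsilon> I i)"
proof -
  have "vtx I - x = (\<Sum>i\<in>I. ((vtx I - x) \<bullet> \<nu> i) *\<^sub>R \<upsilon> I i)" by (rule dual_expansion[OF I(1)])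
  also have "\<dots> = (\<Sum>i\<in>I. (\<delta> i - x \<bullet> \<nu> i) *\<^sub>R \<upsilon> I i)"
    using Ver_facts(11)[OF I(1)] by (intro sum.cong) (auto simp: inner_diff_left)
  also have "\<dots> = (\<Sum>i\<in>I-J. (\<delta> i - x \<bullet> \<nu> i) *\<^sub>R \<upsilon> I i)"
    using x Ver_facts(7)[OF I(1)] by (intro sum.mono_neutral_right) auto
  finally show ?thesis by (simp add: algebra_simps)
qed

lemma step_in_face:
  assumes I: "I \<in> Ver" "J \<subseteq> I" and i: "i \<in> I - J"
  shows "\<exists>\<epsilon>>0. vtx I - \<epsilon> *\<^sub>R \<upsilon> I i \<in> face M P J"
proof -
  have "\<exists>\<epsilon>>0. vtx I + \<epsilon> *\<^sub>R (- \<upsilon> I i) \<in> P"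
  proof (rule small_step_in_P[OF Ver_facts(9)[OF I(1)]])
    fix F assume "F \<in> facets P" "vtx I \<in> F"
    then have "F \<in> I" using Ver_facts(3)[OF I(1)] by blast
    then show "- \<upsilon> I i \<bullet> \<nu> F \<le> 0" using dual_normal[OF I(1), of i F] i by simp
  qed
  then obtain e where e: "e > 0" "vtx I - e *\<^sub>R \<upsilon> I i \<in> P" by auto
  moreover have "(vtx I - e *\<^sub>R \<upsilon> I i) \<bullet> \<nu> j = \<delta> j" if "j \<in> J" for j
  proof -
    have "j \<in> I" "i \<noteq> j" using that I i by auto
    then show ?thesis using Ver_facts(11)[OF I(1)] dual_normal[OF I(1), of i j] i
      by (simp add: inner_diff_left)
  qed
  ultimately show ?thesis unfolding face_def by blast
qed

text \<open>
  The maximum of \<open>\<zeta>\<close> over a face is attained at a vertex, from which no edge of the face ascends.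
  Conversely, at a vertex from which all edges descend, \<open>vertex_expansion\<close> exhibits the vertex as the
  unique maximum.
\<close>

lemma unique_maximal_vertex:
  assumes J: "J \<in> Simp" and g: "generic \<zeta>"
  shows "\<exists>!I. I \<in> Ver \<and> J \<subseteq> I \<and> (\<forall>i\<in>I-J. \<upsilon> I i \<bullet> \<zeta> > 0)"
proof -
  have Jf: "J \<subseteq> facets P" and ne: "face M P J \<noteq> {}" using J by (auto simp: Simp_def)
  have max: "x \<bullet> \<zeta> \<le> vtx I \<bullet> \<zeta> \<and> (x \<bullet> \<zeta> = vtx I \<bullet> \<zeta> \<longrightarrow> x = vtx I)"
    if I: "I \<in> Ver" "J \<subseteq> I" "\<forall>i\<in>I-J. \<upsilon> I i \<bullet> \<zeta> > 0" and x: "x \<in> face M P J" for I x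
  proof -
    have xJ: "x \<bullet> \<nu> j = \<delta> j" if "j \<in> J" for j using x that by (simp add: face_def)
    have c: "\<delta> i - x \<bullet> \<nu> i \<ge> 0" if "i \<in> I" for i
      using x facet_facts(2)[of i x] Ver_facts(8)[OF I(1)] that by (auto simp: face_def)
    let ?s = "\<Sum>i\<in>I-J. (\<delta> i - x \<bullet> \<nu> i) * (\<upsilon> I i \<bullet> \<zeta>)"
    have eq: "x \<bullet> \<zeta> = vtx I \<bullet> \<zeta> - ?s"
      by (subst vertex_expansion[OF I(1,2) xJ]) (auto simp: inner_diff_left inner_sum_left)
    have nn: "\<forall>i\<in>I-J. 0 \<le> (\<delta> i - x \<bullet> \<nu> i) * (\<upsilon> I i \<bullet> \<zeta>)"
      using c I(3) by (simp add: less_imp_le)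
    then have "?s \<ge> 0" by (intro sum_nonneg) auto
    moreover have "x = vtx I" if "?s = 0"
    proof -
      have "\<forall>i\<in>I-J. (\<delta> i - x \<bullet> \<nu> i) * (\<upsilon> I i \<bullet> \<zeta>) = 0"
        using that nn Ver_facts(7)[OF I(1)] by (subst (asm) sum_nonneg_eq_0_iff) auto
      then have "\<forall>i\<in>I-J. \<delta> i - x \<bullet> \<nu> i = 0" using I(3) by force
      then have "(\<Sum>i\<in>I-J. (\<delta> i - x \<bullet> \<nu> i) *\<^sub>R \<upsilon> I i) = 0" by (intro sum.neutral) simp
      then show ?thesis using vertex_expansion[OF I(1,2) xJ] by (simp only: diff_zero)
    qed
    ultimately show ?thesis using eq by auto
  qed
  have V: "face M P J = convex hull {p. p extreme_point_of face M P J}"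
    using Krein_Milman_Minkowski face_compact_convex[OF Jf] by blast
  let ?E = "{p. p extreme_point_of face M P J}"
  have Eim: "?E \<subseteq> vtx ` {I\<in>Ver. J \<subseteq> I}"
    using Simp_face_vertex[OF J] by (metis (no_types, lifting) image_eqI mem_Collect_eq subsetI)
  then have Efin: "finite ?E" by (rule finite_subset) (auto simp: finite_simplices)
  have Ene: "?E \<noteq> {}" using V ne by auto
  obtain p where p: "p \<in> ?E" "\<And>q. q \<in> ?E \<Longrightarrow> q \<bullet> \<zeta> \<le> p \<bullet> \<zeta>"
  proof -
    let ?m = "Max ((\<lambda>p. p \<bullet> \<zeta>) ` ?E)"
    have fin: "finite ((\<lambda>p. p \<bullet> \<zeta>) ` ?E)" and "(\<lambda>p. p \<bullet> \<zeta>) ` ?E \<noteq> {}" using Efin Ene by auto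
    then have "?m \<in> (\<lambda>p. p \<bullet> \<zeta>) ` ?E" by (rule Max_in)
    then obtain p where p: "p \<in> ?E" "?m = p \<bullet> \<zeta>" by (rule imageE) blast
    have "q \<bullet> \<zeta> \<le> p \<bullet> \<zeta>" if "q \<in> ?E" for q
      unfolding p(2)[symmetric] by (rule Max_ge[OF fin imageI[OF that]])
    then show thesis using that p(1) by blast
  qed
  have "convex hull ?E \<subseteq> {x. \<zeta> \<bullet> x \<le> p \<bullet> \<zeta>}"
  proof (rule hull_minimal)
    show "?E \<subseteq> {x. \<zeta> \<bullet> x \<le> p \<bullet> \<zeta>}" using p(2) by (simp add: inner_commute[of \<zeta>] subset_iff)
    show "convex {x. \<zeta> \<bullet> x \<le> p \<bullet> \<zeta>}" by (rule convex_halfspace_le)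
  qed
  then have pmax: "x \<bullet> \<zeta> \<le> p \<bullet> \<zeta>" if "x \<in> face M P J" for x
    using V that by (auto simp: inner_commute)
  obtain I where I: "I \<in> Ver" "J \<subseteq> I" "vtx I = p" using Simp_face_vertex[OF J] p(1) by blast
  have "\<upsilon> I i \<bullet> \<zeta> > 0" if "i \<in> I - J" for i
  proof -
    obtain e where e: "e > 0" "vtx I - e *\<^sub>R \<upsilon> I i \<in> face M P J" using step_in_face[OF I(1,2) \<open>i \<in> I - J\<close>] by blast
    then have "e * (\<upsilon> I i \<bullet> \<zeta>) \<ge> 0" using pmax[OF e(2)] I(3) by (simp add: inner_diff_left)
    then have "\<upsilon> I i \<bullet> \<zeta> \<ge> 0" using e(1) by (simp add: zero_le_mult_iff)
    then show ?thesis using g I(1) that unfolding generic_def by force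
  qed
  then have ex: "I \<in> Ver \<and> J \<subseteq> I \<and> (\<forall>i\<in>I-J. \<upsilon> I i \<bullet> \<zeta> > 0)" using I by blast
  show ?thesis
  proof (rule ex1I[of _ I])
    show "I \<in> Ver \<and> J \<subseteq> I \<and> (\<forall>i\<in>I-J. \<upsilon> I i \<bullet> \<zeta> > 0)" by (rule ex)
    fix I' assume I': "I' \<in> Ver \<and> J \<subseteq> I' \<and> (\<forall>i\<in>I'-J. \<upsilon> I' i \<bullet> \<zeta> > 0)"
    have "vtx I \<in> face M P J" "vtx I' \<in> face M P J" using Ver_subset_Simp(2) I I' by blast+
    then have "vtx I = vtx I'" using max[of I "vtx I'"] max[of I' "vtx I"] ex I' by force
    then show "I' = I" using Ver_facts(3) ex I' by metis
  qed
qed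

text \<open>
  The factor of a flipped cone that belongs to the \<open>i\<close>-th edge: the indicator function of the half-line in
  the direction of the edge if \<open>\<zeta>\<close> descends there, otherwise minus the indicator function of
  the opposite open half-line.  In both cases \<open>\<zeta>\<close> decreases away from the vertex.
\<close>

definition polar_sign where
  "polar_sign \<zeta> x I i = (if \<upsilon> I i \<bullet> \<zeta> > 0 then (if x \<bullet> \<nu> i \<le> \<delta> i then 1 else 0)
     else (if x \<bullet> \<nu> i \<le> \<delta> i then 0 else - 1 :: int))"

text \<open>
  Expanding the product over \<open>I - J\<close> gives a sum over sets \<open>J'\<close> of facets violated by \<open>x\<close>, with sign
  \<open>(- 1) ^ card J'\<close>, under the condition that \<open>I\<close> is the vertex of the face \<open>J \<union> J'\<close> where \<open>\<zeta>\<close> is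
  maximal.  Each face has exactly one such vertex, so after exchanging the sums \<open>\<zeta>\<close> disappears.
\<close>

lemma polar_sum_eq_violated:
  fixes x :: 'a
  assumes J: "J \<in> Simp" and g: "generic \<zeta>"
  defines "B \<equiv> {F \<in> facets P - J. x \<bullet> \<nu> F > \<delta> F}"
  shows "(\<Sum>I | I \<in> Ver \<and> J \<subseteq> I. \<Prod>i\<in>I-J. polar_sign \<zeta> x I i) =
    (\<Sum>J' | J' \<subseteq> B \<and> J \<union> J' \<in> Simp. (- 1) ^ card J')"
proof -
  let ?S = "{J'. J' \<subseteq> B \<and> J \<union> J' \<in> Simp}"
  have finB: "finite B" using finite_facets by (auto simp: B_def)
  have finS: "finite ?S" by (rule finite_subset[of _ "Pow B"]) (auto simp: finB)
  have finV: "finite {I. I \<in> Ver \<and> J \<subseteq> I}" by (rule finite_subset[OF _ finite_simplices]) auto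
  let ?w = "\<lambda>I J'. if J' \<subseteq> I \<and> (\<forall>i\<in>I-(J\<union>J'). \<upsilon> I i \<bullet> \<zeta> > 0) then 1 else 0 :: int"
  have one: "(\<Sum>I | I \<in> Ver \<and> J \<subseteq> I. ?w I J') = 1" if "J' \<in> ?S" for J'
  proof -
    have "J \<union> J' \<in> Simp" using that by blast
    from ex1_implies_ex[OF unique_maximal_vertex[OF this g]] unique_maximal_vertex[OF this g]
    obtain I0 where I0: "I0 \<in> Ver \<and> J \<union> J' \<subseteq> I0 \<and> (\<forall>i\<in>I0-(J\<union>J'). \<upsilon> I0 i \<bullet> \<zeta> > 0)"
      and u: "\<And>I. I \<in> Ver \<and> J \<union> J' \<subseteq> I \<and> (\<forall>i\<in>I-(J\<union>J'). \<upsilon> I i \<bullet> \<zeta> > 0) \<Longrightarrow> I = I0" by (metis (no_types, lifting))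
    have "(\<Sum>I | I \<in> Ver \<and> J \<subseteq> I. ?w I J') = (\<Sum>I | I \<in> Ver \<and> J \<subseteq> I. if I = I0 then 1 else 0)"
    proof (rule sum.cong[OF refl])
      fix I assume I: "I \<in> {I. I \<in> Ver \<and> J \<subseteq> I}"
      have "(J' \<subseteq> I \<and> (\<forall>i\<in>I-(J\<union>J'). \<upsilon> I i \<bullet> \<zeta> > 0)) \<longleftrightarrow> I = I0"
        using u[of I] I I0 by auto
      then show "?w I J' = (if I = I0 then 1 else 0)" by simp
    qed
    also have "\<dots> = 1" using I0 finV by simp
    finally show ?thesis .
  qed
  have inner: "(\<Sum>J'\<in>?S. (- 1) ^ card J' * ?w I J') = (\<Prod>i\<in>I-J. polar_sign \<zeta> x I i)"
    if I: "I \<in> Ver" "J \<subseteq> I" for I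
  proof -
    have finI: "finite (I - J)" using Ver_facts(7)[OF I(1)] by blast
    have "(\<Prod>i\<in>I-J. polar_sign \<zeta> x I i) =
        (\<Prod>i\<in>I-J. (if i \<in> B then - 1 else 0) + (if \<upsilon> I i \<bullet> \<zeta> > 0 then 1 else 0))"
      using Ver_facts(8)[OF I(1)] by (intro prod.cong) (auto simp: polar_sign_def B_def)
    also have "\<dots> = (\<Sum>J'\<in>Pow (I-J). (\<Prod>i\<in>J'. if i \<in> B then - 1 else 0) *
        (\<Prod>i\<in>I-J-J'. if \<upsilon> I i \<bullet> \<zeta> > 0 then 1 else 0))"
      by (rule prod_add[OF finI])
    also have "\<dots> = (\<Sum>J'\<in>{J'. J' \<subseteq> I - J \<and> J' \<subseteq> B}. (- 1) ^ card J' * ?w I J')"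
    proof (rule sum.mono_neutral_cong_right)
      show "finite (Pow (I - J))" using finI by simp
      show "\<forall>J'\<in>Pow (I - J) - {J'. J' \<subseteq> I - J \<and> J' \<subseteq> B}. (\<Prod>i\<in>J'. if i \<in> B then - 1 else 0) *
        (\<Prod>i\<in>I-J-J'. if \<upsilon> I i \<bullet> \<zeta> > 0 then 1 else 0 :: int) = 0"
      proof
        fix J' assume J': "J' \<in> Pow (I - J) - {J'. J' \<subseteq> I - J \<and> J' \<subseteq> B}"
        then obtain i where "i \<in> J'" "i \<notin> B" by blast
        then have "(\<Prod>i\<in>J'. if i \<in> B then - 1 else 0 :: int) = 0"
          using finite_subset[OF _ finI, of J'] J' by (intro prod_zero) auto
        then show "(\<Prod>i\<in>J'. if i \<in> B then - 1 else 0) *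
          (\<Prod>i\<in>I-J-J'. if \<upsilon> I i \<bullet> \<zeta> > 0 then 1 else 0 :: int) = 0" by simp
      qed
      fix J' assume J': "J' \<in> {J'. J' \<subseteq> I - J \<and> J' \<subseteq> B}"
      have 1: "(\<Prod>i\<in>J'. if i \<in> B then - 1 else 0 :: int) = (\<Prod>i\<in>J'. - 1)"
        using J' by (intro prod.cong) auto
      have 2: "(\<Prod>i\<in>I-J-J'. if \<upsilon> I i \<bullet> \<zeta> > 0 then 1 else 0 :: int) = ?w I J'"
      proof (cases "\<forall>i\<in>I-(J\<union>J'). \<upsilon> I i \<bullet> \<zeta> > 0")
        case True then show ?thesis using J' by (auto intro!: prod.neutral)
      next
        case False
        then show ?thesis using finI by (auto intro!: prod_zero)
      qed
      show "(\<Prod>i\<in>J'. if i \<in> B then - 1 else 0) *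
          (\<Prod>i\<in>I-J-J'. if \<upsilon> I i \<bullet> \<zeta> > 0 then 1 else 0 :: int) = (- 1) ^ card J' * ?w I J'"
        unfolding 1 2 by simp
    qed auto
    also have "\<dots> = (\<Sum>J'\<in>?S. (- 1) ^ card J' * ?w I J')"
    proof (rule sum.mono_neutral_left[OF finS])
      show "{J'. J' \<subseteq> I - J \<and> J' \<subseteq> B} \<subseteq> ?S" using Ver_subset_Simp(1)[OF I(1)] I(2) by blast
      show "\<forall>i\<in>?S - {J'. J' \<subseteq> I - J \<and> J' \<subseteq> B}. (- 1) ^ card i * ?w I i = 0"
        by (auto simp: B_def)
    qed
    finally show ?thesis by simp
  qed
  have "(\<Sum>J'\<in>?S. (- 1) ^ card J') = (\<Sum>J'\<in>?S. (- 1) ^ card J' * (\<Sum>I | I \<in> Ver \<and> J \<subseteq> I. ?w I J'))"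
    by (intro sum.cong refl) (use one in simp)
  also have "\<dots> = (\<Sum>I | I \<in> Ver \<and> J \<subseteq> I. \<Sum>J'\<in>?S. (- 1) ^ card J' * ?w I J')"
    unfolding sum_distrib_left by (rule sum.swap)
  also have "\<dots> = (\<Sum>I | I \<in> Ver \<and> J \<subseteq> I. \<Prod>i\<in>I-J. polar_sign \<zeta> x I i)"
    by (intro sum.cong refl inner) auto
  finally show ?thesis by simp
qed

text \<open>
  The sum does not depend on \<open>\<zeta>\<close>, by \<open>polar_sum_eq_violated\<close>.  If \<open>x \<notin> P\<close>, it may be computed with a generic
  \<open>\<zeta>'\<close> close to the normal of a facet violated by \<open>x\<close>.  This \<open>\<zeta>'\<close> is larger at \<open>x\<close> than anywhere on \<open>P\<close>,
  while it is at most the value at the vertex on each of the flipped cones, so \<open>x\<close> lies in none of them.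
\<close>

theorem polar_decomposition:
  assumes J: "J \<in> Simp" and g: "generic \<zeta>" and x: "\<And>j. j \<in> J \<Longrightarrow> x \<bullet> \<nu> j = \<delta> j"
  shows "(\<Sum>I | I \<in> Ver \<and> J \<subseteq> I. \<Prod>i\<in>I-J. polar_sign \<zeta> x I i) = (if x \<in> P then 1 else 0)"
proof (cases "x \<in> P")
  case True
  have "{F \<in> facets P - J. x \<bullet> \<nu> F > \<delta> F} = {}" using facet_facts(2) True by force
  then have "{J'. J' \<subseteq> {F \<in> facets P - J. x \<bullet> \<nu> F > \<delta> F} \<and> J \<union> J' \<in> Simp} = {{}}" using J by auto
  then show ?thesis using polar_sum_eq_violated[OF J g, of x] True by simp
next
  case False
  then obtain F where F: "F \<in> facets P" "x \<bullet> \<nu> F > \<delta> F" using P_eq_halfspaces by force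
  obtain C where C: "\<And>y. y \<in> P \<Longrightarrow> y \<bullet> \<zeta> \<le> C"
  proof -
    obtain R where R: "\<And>y. y \<in> P \<Longrightarrow> norm y \<le> R"
      using compact_imp_bounded[OF compact_P] bounded_iff by blast
    have "y \<bullet> \<zeta> \<le> R * norm \<zeta>" if "y \<in> P" for y
      using norm_cauchy_schwarz[of y \<zeta>] R[OF that] mult_right_mono[of "norm y" R "norm \<zeta>"] by simp
    then show thesis using that by blast
  qed
  define gap where "gap = x \<bullet> \<nu> F - \<delta> F"
  have gap: "gap > 0" using F by (simp add: gap_def)
  \<comment> \<open>For \<open>s < s0\<close> adding \<open>s \<zeta>\<close> to the normal keeps \<open>x\<close> separated from \<open>P\<close>; the finite set \<open>bad\<close> holds the
    slopes for which an edge becomes orthogonal to the sum.\<close>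
  define s0 where "s0 = gap / (\<bar>C - x \<bullet> \<zeta>\<bar> + 1)"
  have s0: "s0 > 0" using gap by (simp add: s0_def)
  define bad where "bad = (\<Union>I\<in>Ver. (\<lambda>i. - (\<upsilon> I i \<bullet> \<nu> F) / (\<upsilon> I i \<bullet> \<zeta>)) ` I)"
  have "finite bad" unfolding bad_def using Ver_facts(7) by (auto simp: finite_simplices)
  then have "infinite ({0<..<s0} - bad)" using s0 by (simp add: Diff_infinite_finite infinite_Ioo)
  then have "{0<..<s0} - bad \<noteq> {}" by (rule infinite_imp_nonempty)
  then obtain s where "s \<in> {0<..<s0} - bad" by (meson ex_in_conv)
  then have s: "0 < s" "s < s0" "s \<notin> bad" by auto
  define \<zeta>' where "\<zeta>' = \<nu> F + s *\<^sub>R \<zeta>"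
  have g': "generic \<zeta>'"
    unfolding generic_def
  proof (intro ballI notI)
    fix I i assume I: "I \<in> Ver" "i \<in> I" "\<upsilon> I i \<bullet> \<zeta>' = 0"
    have "\<upsilon> I i \<bullet> \<zeta> \<noteq> 0" using g I by (auto simp: generic_def)
    then have "s = - (\<upsilon> I i \<bullet> \<nu> F) / (\<upsilon> I i \<bullet> \<zeta>)"
      using I(3) by (simp add: \<zeta>'_def inner_add_right field_simps add_eq_0_iff)
    then show False using s(3) I unfolding bad_def by blast
  qed
  have sep: "y \<bullet> \<zeta>' < x \<bullet> \<zeta>'" if "y \<in> P" for y
  proof -
    have "y \<bullet> \<zeta>' \<le> \<delta> F + s * C"
      unfolding \<zeta>'_def inner_add_right
      using facet_facts(2)[OF F(1) that] C[OF that] s(1) by (simp add: add_mono)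
    moreover have "s * (C - x \<bullet> \<zeta>) \<le> s * \<bar>C - x \<bullet> \<zeta>\<bar>" using s(1) by (intro mult_left_mono) auto
    moreover have "s * \<bar>C - x \<bullet> \<zeta>\<bar> \<le> s * (\<bar>C - x \<bullet> \<zeta>\<bar> + 1)" using s(1) by simp
    moreover have "s * (\<bar>C - x \<bullet> \<zeta>\<bar> + 1) < gap"
    proof -
      have "0 < \<bar>C - x \<bullet> \<zeta>\<bar> + 1" by simp
      from s(2)[unfolded s0_def pos_less_divide_eq[OF this]] show ?thesis .
    qed
    ultimately show ?thesis by (simp add: \<zeta>'_def inner_add_right gap_def algebra_simps)
  qed
  have "(\<Prod>i\<in>I-J. polar_sign \<zeta>' x I i) = 0" if I: "I \<in> Ver" "J \<subseteq> I" for I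
  proof (rule ccontr)
    assume ne: "(\<Prod>i\<in>I-J. polar_sign \<zeta>' x I i) \<noteq> 0"
    have finI: "finite (I - J)" using Ver_facts(7)[OF I(1)] by blast
    have "(\<delta> i - x \<bullet> \<nu> i) * (\<upsilon> I i \<bullet> \<zeta>') \<ge> 0" if "i \<in> I - J" for i
    proof -
      have "polar_sign \<zeta>' x I i \<noteq> 0" using ne prod_zero_iff[OF finI] that by blast
      then show ?thesis unfolding polar_sign_def
        by (auto split: if_splits simp: zero_le_mult_iff)
    qed
    then have "(\<Sum>i\<in>I-J. (\<delta> i - x \<bullet> \<nu> i) * (\<upsilon> I i \<bullet> \<zeta>')) \<ge> 0" by (rule sum_nonneg)
    moreover have "x \<bullet> \<zeta>' = vtx I \<bullet> \<zeta>' - (\<Sum>i\<in>I-J. (\<delta> i - x \<bullet> \<nu> i) * (\<upsilon> I i \<bullet> \<zeta>'))"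
      by (subst vertex_expansion[OF I x]) (auto simp: inner_diff_left inner_sum_left)
    ultimately show False using sep[OF Ver_facts(9)[OF I(1)]] by simp
  qed
  then have "(\<Sum>I | I \<in> Ver \<and> J \<subseteq> I. \<Prod>i\<in>I-J. polar_sign \<zeta>' x I i) = 0" by (intro sum.neutral) auto
  then show ?thesis using polar_sum_eq_violated[OF J g, of x] polar_sum_eq_violated[OF J g', of x] False by simp
qed

end

section \<open>The finite groups at the faces and their characters\<close>

lemma exp_2pi_i_eq_1: "exp (2 * complex_of_real pi * \<i> * complex_of_real r) = 1 \<longleftrightarrow> r \<in> \<int>"
proof -
  have "exp (2 * complex_of_real pi * \<i> * complex_of_real r) = 1 \<longleftrightarrow> (\<exists>n::int. r = of_int n)"
    by (simp add: exp_eq_1)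
  then show ?thesis by (auto simp: Ints_def)
qed

lemma norm_exp_2pi_i [simp]: "norm (exp (2 * complex_of_real pi * \<i> * complex_of_real r)) = 1"
  by (simp add: norm_exp_eq_Re)

context simple_lattice_polytope begin

lemma normal_in_N: "F \<in> facets P \<Longrightarrow> \<nu> F \<in> N"
  using facet_facts(1) by (auto simp: primitive_vector_def)

lemma Simp_independent:
  assumes "J \<in> Simp" shows "independent (\<nu> ` J)" "inj_on \<nu> J" "finite (\<nu> ` J)" "\<nu> ` J \<subseteq> N"
proof -
  obtain I where I: "I \<in> Ver" "J \<subseteq> I" using Simp_extend[OF assms] by blast
  show "independent (\<nu> ` J)" using Ver_facts(6)[OF I(1)] I(2) by (meson image_mono independent_mono)
  show "inj_on \<nu> J" using Ver_facts(12)[OF I(1)] I(2) inj_on_subset by blast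
  show "finite (\<nu> ` J)" using Simp_finite[OF assms] by simp
  show "\<nu> ` J \<subseteq> N" using assms normal_in_N by (auto simp: Simp_def)
qed

lemma Ver_multiple:
  assumes "I \<in> Ver"
  obtains K :: nat where "K > 0" "\<And>w. w \<in> N \<Longrightarrow> real K *\<^sub>R w \<in> N_gen M P I"
proof -
  have "\<nu> ` I \<subseteq> N" using Simp_independent(4)[OF Ver_facts(13)[OF assms]] .
  from sublattice_uniform_multiple[OF M_facts(2,5) Ver_facts(6)[OF assms] this Ver_facts(5)[OF assms]]
  show thesis using that unfolding N_gen_def by blast
qed

lemma dual_basis_subset:
  assumes I: "I \<in> Ver" "J \<subseteq> I" and w: "w \<in> span (\<nu> ` J)"
  shows "representation (\<nu> ` I) w = representation (\<nu> ` J) w"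
  by (rule representation_extend[OF Ver_facts(6)[OF I(1)] w]) (rule image_mono[OF I(2)])

lemma N_gen_iff:
  assumes "J \<in> Simp"
  shows "w \<in> N_gen M P J \<longleftrightarrow> w \<in> span (\<nu> ` J) \<and> (\<forall>j\<in>J. dual_basis M P J j w \<in> \<int>)"
  unfolding N_gen_def dual_basis_def
  by (simp add: int_span_iff_representation[OF Simp_independent(1,3)[OF assms]])

lemma Simp_multiple:
  assumes J: "J \<in> Simp"
  obtains K :: nat where "K > 0" "\<And>w. w \<in> N \<Longrightarrow> w \<in> span (\<nu> ` J) \<Longrightarrow> real K *\<^sub>R w \<in> N_gen M P J"
proof -
  obtain I where I: "I \<in> Ver" "J \<subseteq> I" using Simp_extend[OF J] by blast
  obtain K :: nat where K: "K > 0" "\<And>w. w \<in> N \<Longrightarrow> real K *\<^sub>R w \<in> N_gen M P I"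
    using Ver_multiple[OF I(1)] by blast
  have "real K *\<^sub>R w \<in> N_gen M P J" if w: "w \<in> N" "w \<in> span (\<nu> ` J)" for w
  proof -
    have s: "real K *\<^sub>R w \<in> span (\<nu> ` J)" using w(2) by (rule span_scale)
    have "\<forall>i\<in>I. dual_basis M P I i (real K *\<^sub>R w) \<in> \<int>"
      using K(2)[OF w(1)] N_gen_iff[OF Ver_facts(13)[OF I(1)]] by blast
    then show ?thesis using N_gen_iff[OF J] s dual_basis_subset[OF I s] I(2)
      by (auto simp: dual_basis_def)
  qed
  then show thesis using that K(1) by blast
qed

text \<open>
  A primitive sublattice containing the normals contains every lattice vector in their real
  span, because such a vector has a nonzero multiple in \<open>N_gen\<close>.
\<close>

lemma N_sat_eq:
  assumes J: "J \<in> Simp" shows "N_sat M P J = N \<inter> span (\<nu> ` J)"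
proof
  have sub: "add_subgroup (N \<inter> span (\<nu> ` J))"
    using add_subgroup_closed[OF M_facts(2)] by (auto simp: add_subgroup_def span_zero span_diff)
  show "N_sat M P J \<subseteq> N \<inter> span (\<nu> ` J)"
    unfolding N_sat_def
  proof (rule hull_minimal)
    show "\<nu> ` J \<subseteq> N \<inter> span (\<nu> ` J)" using Simp_independent(4)[OF J] span_superset[of "\<nu> ` J"] by simp
    show "primitive_sublattice N (N \<inter> span (\<nu> ` J))"
      unfolding primitive_sublattice_def int_span_eq_iff
    proof (intro conjI ballI allI impI)
      fix w and m :: int assume w: "w \<in> N" "m \<noteq> 0 \<and> real_of_int m *\<^sub>R w \<in> N \<inter> span (\<nu> ` J)"
      then have "(1 / real_of_int m) *\<^sub>R (real_of_int m *\<^sub>R w) \<in> span (\<nu> ` J)"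
        using span_scale[of "real_of_int m *\<^sub>R w" "\<nu> ` J" "1 / real_of_int m"] by blast
      then show "w \<in> N \<inter> span (\<nu> ` J)" using w by simp
    qed (use sub in auto)
  qed
  show "N \<inter> span (\<nu> ` J) \<subseteq> N_sat M P J"
  proof
    fix w assume w: "w \<in> N \<inter> span (\<nu> ` J)"
    obtain K :: nat where K: "K > 0" "real K *\<^sub>R w \<in> N_gen M P J" using Simp_multiple[OF J] w by blast
    have "w \<in> t" if t: "primitive_sublattice N t" "\<nu> ` J \<subseteq> t" for t
    proof -
      have "N_gen M P J \<subseteq> t" using int_span_mono[OF t(2)] t(1)
        by (simp add: N_gen_def primitive_sublattice_def)
      then have "real_of_int (int K) *\<^sub>R w \<in> t" using K(2) by auto
      then show ?thesis using t(1) w K(1) unfolding primitive_sublattice_def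
        by (metis IntD1 of_nat_eq_0_iff less_irrefl)
    qed
    then show "w \<in> N_sat M P J" unfolding N_sat_def hull_def by blast
  qed
qed

lemma N_gen_subgroup:
  assumes J: "J \<in> Simp" shows "add_subgroup (N_sat M P J)" "add_subgroup (N_gen M P J)" "N_gen M P J \<subseteq> N_sat M P J"
proof -
  show 1: "add_subgroup (N_sat M P J)" unfolding N_sat_eq[OF J]
    using add_subgroup_closed[OF M_facts(2)] by (auto simp: add_subgroup_def span_zero span_diff)
  show "add_subgroup (N_gen M P J)" by (simp add: N_gen_def add_subgroup_int_span)
  have "\<nu> ` J \<subseteq> N_sat M P J" unfolding N_sat_eq[OF J]
    using Simp_independent(4)[OF J] span_superset[of "\<nu> ` J"] by simp
  then show "N_gen M P J \<subseteq> N_sat M P J" unfolding N_gen_def by (rule int_span_subset[OF 1])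
qed

lemma Ver_N_sat: "I \<in> Ver \<Longrightarrow> N_sat M P I = N"
  by (simp add: N_sat_eq[OF Ver_facts(13)] Ver_facts(5))

definition chr where
  "chr J j w = exp (2 * complex_of_real pi * \<i> * complex_of_real (dual_basis M P J j w))"

lemma chi_chr: "chi M P J j h = chr J j (SOME w. w \<in> h)" by (simp add: chi_def chr_def)

lemma dual_basis_linear:
  assumes J: "J \<in> Simp" and w: "w \<in> span (\<nu> ` J)" "w' \<in> span (\<nu> ` J)"
  shows "dual_basis M P J j (w - w') = dual_basis M P J j w - dual_basis M P J j w'"
    "dual_basis M P J j (c *\<^sub>R w) = c * dual_basis M P J j w"
  unfolding dual_basis_def
  using representation_diff[OF Simp_independent(1)[OF J] w(2,1)]
    representation_scale[OF Simp_independent(1)[OF J] w(1)] by simp_all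

lemma chr_eq_iff:
  assumes J: "J \<in> Simp" and w: "w \<in> span (\<nu> ` J)" "w' \<in> span (\<nu> ` J)"
  shows "chr J j w = chr J j w' \<longleftrightarrow> dual_basis M P J j (w - w') \<in> \<int>"
proof -
  have "chr J j w = chr J j (w - w') * chr J j w'"
    unfolding chr_def dual_basis_linear(1)[OF assms] exp_add[symmetric]
    by (simp add: algebra_simps)
  moreover have "chr J j w' \<noteq> 0" by (simp add: chr_def)
  ultimately have "chr J j w = chr J j w' \<longleftrightarrow> chr J j (w - w') = 1" by simp
  then show ?thesis unfolding chr_def exp_2pi_i_eq_1 .
qed

lemma norm_chi [simp]: "norm (chi M P J j h) = 1" by (simp add: chi_def)

lemma chi_nonzero [simp]: "chi M P J j h \<noteq> 0" by (simp add: chi_def)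

lemma H_grp_member:
  assumes J: "J \<in> Simp" and h: "h \<in> H_grp M P J"
  shows "(SOME w. w \<in> h) \<in> h" "h \<subseteq> N \<inter> span (\<nu> ` J)"
  using coset_representative(1,2)[OF N_gen_subgroup(2)[OF J] h[unfolded H_grp_def]]
  unfolding N_sat_eq[OF J] by simp_all

lemma chr_coset:
  assumes J: "J \<in> Simp" and h: "h \<in> H_grp M P J" and w: "w \<in> h" and j: "j \<in> J"
  shows "chi M P J j h = chr J j w"
proof -
  let ?s = "SOME w. w \<in> h"
  have "?s - w \<in> N_gen M P J"
    using coset_representative(3)[OF N_gen_subgroup(2)[OF J] h[unfolded H_grp_def]] H_grp_member(1)[OF J h] w by blast
  then have "dual_basis M P J j (?s - w) \<in> \<int>" using N_gen_iff[OF J] j by blast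
  then show ?thesis unfolding chi_chr using chr_eq_iff[OF J] H_grp_member[OF J h] w by blast
qed

text \<open>The values \<open>\<chi>\<^sub>j(h)\<close>, \<open>j \<in> J\<close>, are \<open>K\<close>-th roots of unity for a uniform \<open>K\<close>, and together they determine \<open>h\<close>.\<close>

lemma finite_H_grp:
  assumes J: "J \<in> Simp" shows "finite (H_grp M P J)" "H_grp M P J \<noteq> {}"
proof -
  obtain K :: nat where K: "K > 0" "\<And>w. w \<in> N \<Longrightarrow> w \<in> span (\<nu> ` J) \<Longrightarrow> real K *\<^sub>R w \<in> N_gen M P J"
    using Simp_multiple[OF J] by blast
  let ?R = "{z::complex. z ^ K = 1}"
  let ?f = "\<lambda>h. restrict (\<lambda>j. chi M P J j h) J"
  have fin: "finite (PiE J (\<lambda>_. ?R))"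
    using K(1) Simp_finite[OF J] by (intro finite_PiE) (auto intro!: finite_roots_unity)
  have "?f ` H_grp M P J \<subseteq> PiE J (\<lambda>_. ?R)"
  proof (intro image_subsetI PiE_I)
    fix h j assume h: "h \<in> H_grp M P J" and j: "j \<in> J"
    let ?w = "SOME w. w \<in> h"
    have w: "?w \<in> N" "?w \<in> span (\<nu> ` J)" using H_grp_member[OF J h] by auto
    have "chi M P J j h ^ K = exp (2 * complex_of_real pi * \<i> * complex_of_real (dual_basis M P J j (real K *\<^sub>R ?w)))"
      unfolding chi_def exp_of_nat_mult[symmetric] dual_basis_linear(2)[OF J w(2) w(2)]
      by (simp add: algebra_simps)
    also have "\<dots> = 1" unfolding exp_2pi_i_eq_1
      using K(2)[OF w] N_gen_iff[OF J] j by blast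
    finally show "?f h j \<in> ?R" using j by simp
  qed auto
  moreover have "inj_on ?f (H_grp M P J)"
  proof (rule inj_onI)
    fix h h' assume h: "h \<in> H_grp M P J" "h' \<in> H_grp M P J" "?f h = ?f h'"
    let ?w = "SOME w. w \<in> h" and ?w' = "SOME w. w \<in> h'"
    have w: "?w \<in> h" "?w \<in> span (\<nu> ` J)" "?w' \<in> h'" "?w' \<in> span (\<nu> ` J)"
      using H_grp_member[OF J h(1)] H_grp_member[OF J h(2)] by auto
    have "dual_basis M P J j (?w - ?w') \<in> \<int>" if j: "j \<in> J" for j
    proof -
      have "chr J j ?w = chr J j ?w'" using fun_cong[OF h(3), of j] j by (simp add: chi_chr)
      then show ?thesis using chr_eq_iff[OF J w(2,4)] by blast
    qed
    then have "?w - ?w' \<in> N_gen M P J" using N_gen_iff[OF J] w by (simp add: span_diff)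
    then show "h = h'"
      using coset_eqI[OF N_gen_subgroup(2)[OF J] h(1,2)[unfolded H_grp_def] w(1,3)] by blast
  qed
  ultimately show "finite (H_grp M P J)" using inj_on_finite[OF _ _ fin] by blast
  show "H_grp M P J \<noteq> {}"
    using coset_of_member(1)[OF N_gen_subgroup(2)[OF J] add_subgroup_closed(1)[OF N_gen_subgroup(1)[OF J]]]
    unfolding H_grp_def by (simp only: ex_in_conv[symmetric]) (rule exI)
qed

lemma card_H_pos: "J \<in> Simp \<Longrightarrow> card (H_grp M P J) > 0"
  using finite_H_grp by (simp add: card_gt_0_iff)

text \<open>
  With \<open>u = \<Sum>\<^sub>i c\<^sub>i u\<^sub>i\<close>, the product is the value at \<open>h\<close> of the character \<open>w \<mapsto> exp (2 \<pi> \<i> \<langle>u, w\<rangle>)\<close>, which is trivial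
  on all of \<open>N\<close> exactly if \<open>u \<in> M\<close>.
\<close>

lemma character_orthogonality:
  assumes I: "I \<in> Ver"
  shows "(\<Sum>h\<in>H_grp M P I. \<Prod>i\<in>I. chi M P I i h powi c i) =
    (if (\<Sum>i\<in>I. real_of_int (c i) *\<^sub>R \<upsilon> I i) \<in> M then of_nat (card (H_grp M P I)) else 0)"
proof -
  note J = Ver_facts(13)[OF I]
  let ?u = "\<Sum>i\<in>I. real_of_int (c i) *\<^sub>R \<upsilon> I i"
  let ?f = "\<lambda>w. exp (2 * complex_of_real pi * \<i> * complex_of_real (?u \<bullet> w))"
  have f: "(\<Prod>i\<in>I. chr I i w powi c i) = ?f w" for w
  proof -
    have "(\<Prod>i\<in>I. chr I i w powi c i) =
        (\<Prod>i\<in>I. exp (2 * complex_of_real pi * \<i> * complex_of_real (of_int (c i) * (\<upsilon> I i \<bullet> w))))"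
      unfolding chr_def exp_power_int dual_inner[OF I, symmetric]
      by (intro prod.cong refl) (simp add: algebra_simps)
    also have "\<dots> = ?f w"
      using Ver_facts(7)[OF I]
      by (simp add: exp_sum[symmetric] inner_sum_left sum_distrib_left)
    finally show ?thesis .
  qed
  have "(\<Sum>h\<in>H_grp M P I. \<Prod>i\<in>I. chi M P I i h powi c i) = (\<Sum>h\<in>H_grp M P I. ?f (SOME w. w \<in> h))"
    unfolding chi_chr f ..
  also have "\<dots> = (if \<forall>w\<in>N_sat M P I. ?f w = 1 then of_nat (card (H_grp M P I)) else 0)"
    unfolding H_grp_def
  proof (rule sum_cosets_character[OF N_gen_subgroup[OF J]])
    show "finite (N_sat M P I // coset_rel (N_sat M P I) (N_gen M P I))"
      using finite_H_grp(1)[OF J] by (simp add: H_grp_def)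
    show "?f (x + y) = ?f x * ?f y" for x y
      by (simp add: inner_add_right exp_add[symmetric] algebra_simps)
    show "?f x = 1" if "x \<in> N_gen M P I" for x
    proof -
      have "chr I i x = 1" if "i \<in> I" for i
        unfolding chr_def exp_2pi_i_eq_1 using N_gen_iff[OF J] \<open>x \<in> N_gen M P I\<close> that by blast
      then show ?thesis unfolding f[symmetric] by (intro prod.neutral) simp
    qed
  qed
  also have "(\<forall>w\<in>N_sat M P I. ?f w = 1) \<longleftrightarrow> ?u \<in> M"
    unfolding exp_2pi_i_eq_1 Ver_N_sat[OF I] using M_facts(3)[of ?u] by blast
  finally show ?thesis .
qed

text \<open>
  The inclusion \<open>N_sat M P J \<subseteq> N\<close> induces an injection of \<open>H\<^sub>J\<close> into \<open>H\<^sub>I\<close> that preserves \<open>\<chi>\<^sub>j\<close> for \<open>j \<in> J\<close>.  Its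
  image consists of the classes with \<open>\<chi>\<^sub>i = 1\<close> for \<open>i \<in> I - J\<close>: the coordinates of a lift
  outside \<open>J\<close> are then integers and can be removed without leaving the class.
\<close>

lemma sum_H_grp_restrict:
  assumes I: "I \<in> Ver" "J \<subseteq> I"
  shows "(\<Sum>h\<in>H_grp M P J. F (restrict (\<lambda>j. chi M P J j h) J)) =
    (\<Sum>h | h \<in> H_grp M P I \<and> (\<forall>i\<in>I-J. chi M P I i h = 1). F (restrict (\<lambda>j. chi M P I j h) J))"
proof -
  note SI = Ver_facts(13)[OF I(1)] and SJ = Ver_subset_Simp(1)[OF I]
  note subI = N_gen_subgroup(2)[OF SI] and subJ = N_gen_subgroup(2)[OF SJ]
  let ?HI = "H_grp M P I" and ?HJ = "H_grp M P J"
  let ?T = "{h. h \<in> ?HI \<and> (\<forall>i\<in>I-J. chi M P I i h = 1)}"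
  define rep where "rep h = (SOME w. w \<in> h)" for h :: "'a set"
  define \<phi> where "\<phi> h = coset_rel (N_sat M P I) (N_gen M P I) `` {rep h}" for h
  have repJ: "rep h \<in> h" "rep h \<in> N" "rep h \<in> span (\<nu> ` J)" if "h \<in> ?HJ" for h
    using H_grp_member[OF SJ that] by (auto simp: rep_def)
  have \<phi>: "\<phi> h \<in> ?HI" "rep h \<in> \<phi> h" if "h \<in> ?HJ" for h
    using coset_of_member[OF subI, of "rep h" "N_sat M P I"] repJ[OF that] Ver_N_sat[OF I(1)]
    by (auto simp: \<phi>_def H_grp_def)
  have chi_phi: "chi M P I i (\<phi> h) = chr I i (rep h)" if "h \<in> ?HJ" "i \<in> I" for h i
    using chr_coset[OF SI \<phi>[OF that(1)] that(2)] .
  have dual0: "dual_basis M P I i w = 0" if "w \<in> span (\<nu> ` J)" "i \<in> I - J" for w i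
  proof -
    have "\<nu> i \<notin> \<nu> ` J" using Ver_facts(12)[OF I(1)] that(2) I(2) by (auto simp: inj_on_def)
    then show ?thesis unfolding dual_basis_def dual_basis_subset[OF I that(1)]
      using representation_ne_zero by metis
  qed
  have chiJ: "chi M P I j (\<phi> h) = chi M P J j h" if "h \<in> ?HJ" "j \<in> J" for h j
    using chi_phi[OF that(1), of j] that I(2) dual_basis_subset[OF I repJ(3)[OF that(1)]]
    by (auto simp: chi_chr chr_def dual_basis_def rep_def[symmetric])
  have bij: "bij_betw \<phi> ?HJ ?T"
    unfolding bij_betw_def
  proof
    show "inj_on \<phi> ?HJ"
    proof (rule inj_onI)
      fix h h' assume h: "h \<in> ?HJ" "h' \<in> ?HJ" "\<phi> h = \<phi> h'"
      have "rep h - rep h' \<in> N_gen M P I"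
        using coset_representative(3)[OF subI \<phi>(1)[OF h(1), unfolded H_grp_def]] \<phi>(2)[OF h(1)] \<phi>(2)[OF h(2)] h(3) by simp
      moreover have s: "rep h - rep h' \<in> span (\<nu> ` J)" using repJ h by (simp add: span_diff)
      ultimately have "rep h - rep h' \<in> N_gen M P J"
        using N_gen_iff[OF SI] N_gen_iff[OF SJ] I(2) dual_basis_subset[OF I s] by (auto simp: dual_basis_def)
      then show "h = h'"
        using coset_eqI[OF subJ h(1,2)[unfolded H_grp_def] repJ(1)[OF h(1)] repJ(1)[OF h(2)]] by blast
    qed
    show "\<phi> ` ?HJ = ?T"
    proof (intro equalityI subsetI)
      fix g assume "g \<in> \<phi> ` ?HJ"
      then obtain h where h: "h \<in> ?HJ" "g = \<phi> h" by blast
      have "chi M P I i g = 1" if "i \<in> I - J" for i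
        using chi_phi[OF h(1), of i] h(2) that dual0[OF repJ(3)[OF h(1)] that] by (simp add: chr_def)
      then show "g \<in> ?T" using \<phi>(1)[OF h(1)] h(2) by simp
    next
      fix g assume g: "g \<in> ?T"
      then have gI: "g \<in> ?HI" by blast
      have w: "rep g \<in> g" "rep g \<in> N" "rep g \<in> span (\<nu> ` I)"
        using H_grp_member[OF SI gI] by (auto simp: rep_def)
      define c where "c i = dual_basis M P I i (rep g)" for i
      have cint: "c i \<in> \<int>" if "i \<in> I - J" for i
      proof -
        have "chr I i (rep g) = 1" using g that by (auto simp: chi_chr rep_def)
        then show ?thesis unfolding chr_def exp_2pi_i_eq_1 c_def .
      qed
      have rg: "rep g = (\<Sum>i\<in>I. c i *\<^sub>R \<nu> i)"
      proof -
        have "rep g = (\<Sum>v\<in>\<nu> ` I. representation (\<nu> ` I) (rep g) v *\<^sub>R v)"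
          using sum_representation_eq[OF Ver_facts(6)[OF I(1)] w(3), of "\<nu> ` I"] Ver_facts(7)[OF I(1)] by simp
        also have "\<dots> = (\<Sum>i\<in>I. c i *\<^sub>R \<nu> i)"
          by (subst sum.reindex[OF Ver_facts(12)[OF I(1)]]) (simp add: c_def dual_basis_def)
        finally show ?thesis .
      qed
      define k where "k = (\<Sum>i\<in>I-J. c i *\<^sub>R \<nu> i)"
      define w' where "w' = (\<Sum>i\<in>J. c i *\<^sub>R \<nu> i)"
      have split: "rep g = w' + k"
        unfolding rg w'_def k_def using sum.subset_diff[OF I(2) Ver_facts(7)[OF I(1)], of "\<lambda>i. c i *\<^sub>R \<nu> i"]
        by (simp add: add.commute)
      have kI: "k \<in> N_gen M P I"
        unfolding k_def
      proof (rule add_subgroup_sum[OF subI])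
        fix i assume i: "i \<in> I - J"
        obtain z where "c i = of_int z" using cint[OF i] by (auto elim: Ints_cases)
        moreover have "\<nu> i \<in> N_gen M P I" 
          unfolding N_gen_def by (rule subsetD[OF int_span_superset imageI]) (use i in blast)
        ultimately show "c i *\<^sub>R \<nu> i \<in> N_gen M P I" using add_subgroup_int_scale[OF subI] by simp
      qed
      then have "k \<in> N" using N_gen_subgroup(3)[OF SI] Ver_N_sat[OF I(1)] by blast
      then have w'N: "w' \<in> N" using add_subgroup_closed(2)[OF M_facts(2) w(2), of k] split by simp
      have w'J: "w' \<in> span (\<nu> ` J)" unfolding w'_def by (intro span_sum span_scale span_base) auto
      let ?h = "coset_rel (N_sat M P J) (N_gen M P J) `` {w'}"
      have h: "?h \<in> ?HJ" "w' \<in> ?h"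
        using coset_of_member[OF subJ, of w' "N_sat M P J"] w'N w'J N_sat_eq[OF SJ] by (auto simp: H_grp_def)
      have "rep ?h - w' \<in> N_gen M P J"
        using coset_representative(3)[OF subJ h(1)[unfolded H_grp_def] repJ(1)[OF h(1)] h(2)] .
      moreover have "N_gen M P J \<subseteq> N_gen M P I" unfolding N_gen_def by (rule int_span_mono[OF image_mono[OF I(2)]])
      ultimately have "(rep ?h - w') - k \<in> N_gen M P I" using add_subgroup_closed(2)[OF subI] kI by blast
      then have "rep ?h - rep g \<in> N_gen M P I" by (simp add: split algebra_simps)
      then have "\<phi> ?h = g"
        using coset_eqI[OF subI \<phi>(1)[OF h(1), unfolded H_grp_def] gI[unfolded H_grp_def] \<phi>(2)[OF h(1)] w(1)] by blast
      then show "g \<in> \<phi> ` ?HJ" using h(1) by blast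
    qed
  qed
  have "(\<Sum>h\<in>?T. F (restrict (\<lambda>j. chi M P I j h) J)) = (\<Sum>h\<in>?HJ. F (restrict (\<lambda>j. chi M P I j (\<phi> h)) J))"
    by (rule sum.reindex_bij_betw[OF bij, symmetric])
  also have "\<dots> = (\<Sum>h\<in>?HJ. F (restrict (\<lambda>j. chi M P J j h) J))"
    by (intro sum.cong refl arg_cong[of _ _ F] restrict_ext chiJ)
  finally show ?thesis by simp
qed

end

section \<open>Brion's formula\<close>

lemma has_sum_geometric_int:
  fixes z :: "'a::{real_normed_field,banach}"
  assumes "z \<noteq> 0" "norm z < 1"
  shows "((\<lambda>c::int. if c \<ge> 0 then z powi c else 0) has_sum 1 / (1 - z)) UNIV"
proof -
  have "((\<lambda>n. z ^ n) has_sum 1 / (1 - z)) UNIV"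
    by (rule norm_summable_imp_has_sum[OF _ geometric_sums[OF assms(2)]])
      (use assms in \<open>simp add: norm_power summable_geometric\<close>)
  then have "((\<lambda>c::int. z powi c) has_sum 1 / (1 - z)) (range int)"
    by (subst has_sum_reindex) (auto simp: o_def)
  moreover have "range int = {c. c \<ge> 0}"
  proof (intro equalityI subsetI)
    fix c :: int assume "c \<in> {c. c \<ge> 0}"
    then have "c = int (nat c)" by simp
    then show "c \<in> range int" by (rule range_eqI)
  qed auto
  ultimately show ?thesis
    by (subst has_sum_cong_neutral[where T = "{c. c \<ge> 0}" and g = "\<lambda>c. z powi c"]) auto
qed

text \<open>
  On either side of the unit circle, \<open>1 / (1 - z)\<close> is the sum of a series over a half-line of exponents; the
  passage to the other side complements the half-line and changes the sign, as the
  flip of an edge does in \<open>polar_sign\<close>.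
\<close>

lemma has_sum_geometric_int_neg:
  fixes z :: "'a::{real_normed_field,banach}"
  assumes "norm z > 1"
  shows "((\<lambda>c::int. if c \<ge> 0 then 0 else - (z powi c)) has_sum 1 / (1 - z)) UNIV"
proof -
  have z: "z \<noteq> 0" "z \<noteq> 1" using assms by auto
  have n: "norm (1 / z) < 1" using assms by (simp add: norm_divide divide_less_eq)
  have "((\<lambda>n. (1 / z) ^ n) has_sum 1 / (1 - 1 / z)) UNIV"
    by (rule norm_summable_imp_has_sum[OF _ geometric_sums[OF n]])
      (use n in \<open>simp add: norm_power summable_geometric\<close>)
  then have "((\<lambda>n. - (1 / z) * (1 / z) ^ n) has_sum - (1 / z) * (1 / (1 - 1 / z))) UNIV"
    by (rule has_sum_cmult_right)
  moreover have "- (1 / z) * (1 / (1 - 1 / z)) = 1 / (1 - z)" using z by (simp add: field_simps)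
  moreover have "- (1 / z) * (1 / z) ^ n = - (z powi (- 1 - int n))" for n
  proof -
    have "z powi (- 1 - int n) = inverse (z ^ Suc n)"
    proof -
      have "- 1 - int n = - int (Suc n)" by simp
      then show ?thesis by (simp only: power_int_minus power_int_of_nat)
    qed
    then show ?thesis by (simp add: field_simps)
  qed
  ultimately have "((\<lambda>n::nat. - (z powi (- 1 - int n))) has_sum 1 / (1 - z)) UNIV" by simp
  moreover have inj: "inj (\<lambda>n::nat. - 1 - int n)" by (auto simp: inj_on_def)
  ultimately have *: "((\<lambda>c::int. - (z powi c)) has_sum 1 / (1 - z)) (range (\<lambda>n. - 1 - int n))"
    by (subst has_sum_reindex[OF inj]) (auto simp: o_def)
  have r: "range (\<lambda>n. - 1 - int n) = {c. c < 0}"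
  proof (intro equalityI subsetI)
    fix c :: int assume "c \<in> {c. c < 0}"
    then have "c = - 1 - int (nat (- 1 - c))" by simp
    then show "c \<in> range (\<lambda>n. - 1 - int n)" by (rule range_eqI)
  qed auto
  show ?thesis
    using * unfolding r
    by (subst has_sum_cong_neutral[where T = "{c. c < 0}" and g = "\<lambda>c. - (z powi c)"]) auto
qed

definition ray_sign :: "bool \<Rightarrow> int \<Rightarrow> int" where
  "ray_sign p c = (if p then (if c \<ge> 0 then 1 else 0) else (if c \<ge> 0 then 0 else - 1))"

lemma has_sum_ray:
  fixes z :: complex
  assumes "z \<noteq> 0" "norm z \<noteq> 1" and p: "p \<longleftrightarrow> norm z < 1"
  shows "((\<lambda>c. of_int (ray_sign p c) * z powi c) has_sum 1 / (1 - z)) UNIV"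
    and "(\<lambda>c. norm (of_int (ray_sign p c) * z powi c)) summable_on UNIV"
proof -
  show "((\<lambda>c. of_int (ray_sign p c) * z powi c) has_sum 1 / (1 - z)) UNIV"
  proof (cases p)
    case True
    have "(\<lambda>c. of_int (ray_sign p c) * z powi c) = (\<lambda>c. if c \<ge> 0 then z powi c else 0)"
      using True by (auto simp: ray_sign_def fun_eq_iff)
    then show ?thesis using has_sum_geometric_int[of z] True assms by simp
  next
    case False
    have "(\<lambda>c. of_int (ray_sign p c) * z powi c) = (\<lambda>c. if c \<ge> 0 then 0 else - (z powi c))"
      using False by (auto simp: ray_sign_def fun_eq_iff)
    then show ?thesis using has_sum_geometric_int_neg[of z] False assms by simp
  qed
  show "(\<lambda>c. norm (of_int (ray_sign p c) * z powi c)) summable_on UNIV"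
  proof (cases p)
    case True
    have "(\<lambda>c. norm (of_int (ray_sign p c) * z powi c)) = (\<lambda>c. if c \<ge> 0 then norm z powi c else 0)"
      using True by (auto simp: ray_sign_def fun_eq_iff norm_power_int)
    then show ?thesis using has_sum_geometric_int[of "norm z"] True assms
      by (auto intro: has_sum_imp_summable)
  next
    case False
    have "(\<lambda>c. norm (of_int (ray_sign p c) * z powi c)) = (\<lambda>c. - (if c \<ge> 0 then 0 else - (norm z powi c)))"
      using False by (auto simp: ray_sign_def fun_eq_iff norm_power_int)
    moreover have "((\<lambda>c. - 1 * (if c \<ge> 0 then 0 else - (norm z powi c))) has_sum - 1 * (1 / (1 - norm z))) UNIV"
      by (rule has_sum_cmult_right[OF has_sum_geometric_int_neg]) (use False assms in simp)
    ultimately show ?thesis by (auto intro: has_sum_imp_summable)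
  qed
qed

lemma has_sum_rays:
  fixes z :: "'i \<Rightarrow> complex"
  assumes A: "finite A" and z: "\<And>i. i \<in> A \<Longrightarrow> z i \<noteq> 0" "\<And>i. i \<in> A \<Longrightarrow> norm (z i) \<noteq> 1"
    and p: "\<And>i. i \<in> A \<Longrightarrow> p i \<longleftrightarrow> norm (z i) < 1"
  shows "((\<lambda>c. \<Prod>i\<in>A. of_int (ray_sign (p i) (c i)) * z i powi c i) has_sum (\<Prod>i\<in>A. 1 / (1 - z i)))
    (PiE A (\<lambda>_. UNIV))"
proof -
  let ?F = "\<lambda>c. \<Prod>i\<in>A. of_int (ray_sign (p i) (c i)) * z i powi c i"
  have "infsum ?F (PiE A (\<lambda>_. UNIV)) = (\<Prod>i\<in>A. infsum (\<lambda>c. of_int (ray_sign (p i) c) * z i powi c) UNIV)"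
    by (rule infsum_prod_PiE_abs[OF A]) (rule has_sum_ray(2)[OF z p])
  also have "\<dots> = (\<Prod>i\<in>A. 1 / (1 - z i))"
    by (intro prod.cong refl infsumI has_sum_ray(1)[OF z p])
  finally have eq: "infsum ?F (PiE A (\<lambda>_. UNIV)) = (\<Prod>i\<in>A. 1 / (1 - z i))" .
  have "z i \<noteq> 1" if "i \<in> A" for i using z(2)[OF that] by auto
  then have "(\<Prod>i\<in>A. 1 / (1 - z i)) \<noteq> 0" using A by auto
  \<comment> \<open>\<open>infsum\<close> is 0 for families that are not summable, so a nonzero value proves summability.\<close>
  then have "?F summable_on (PiE A (\<lambda>_. UNIV))" using eq infsum_not_exists by fastforce
  from has_sum_infsum[OF this] show ?thesis unfolding eq .
qed

lemma has_sum_finite_sum: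
  fixes f :: "'h \<Rightarrow> 'b \<Rightarrow> complex"
  assumes "\<And>h. h \<in> H \<Longrightarrow> (f h has_sum S h) A"
  shows "((\<lambda>x. \<Sum>h\<in>H. f h x) has_sum (\<Sum>h\<in>H. S h)) A"
  using assms by (induction H rule: infinite_finite_induct) (simp_all add: has_sum_add)

context simple_lattice_polytope begin

lemma level_integral:
  assumes "I \<in> Ver" "i \<in> I" shows "\<delta> i \<in> \<int>"
proof -
  have "vtx I \<bullet> \<nu> i \<in> \<int>"
    using M_facts(3)[of "vtx I"] Ver_facts(8,10)[OF assms(1)] normal_in_N assms(2) by blast
  then show ?thesis using Ver_facts(11)[OF assms] by simp
qed

text \<open>
  The integers \<open>c i\<close> are the slacks of the point in the facets through the vertex that do not
  contain the face \<open>J\<close>.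
\<close>

definition cone_point where
  "cone_point l I J c = real l *\<^sub>R vtx I - (\<Sum>i\<in>I-J. real_of_int (c i) *\<^sub>R \<upsilon> I i)"

lemma cone_point_inner:
  assumes I: "I \<in> Ver" and i: "i \<in> I"
  shows "cone_point l I J c \<bullet> \<nu> i = real l * \<delta> i - (if i \<in> J then 0 else real_of_int (c i))"
proof -
  have "(\<Sum>k\<in>I-J. real_of_int (c k) *\<^sub>R \<upsilon> I k) \<bullet> \<nu> i = (\<Sum>k\<in>I-J. if k = i then real_of_int (c k) else 0)"
    unfolding inner_sum_left using dual_normal[OF I _ i] by (intro sum.cong) auto
  also have "\<dots> = (if i \<in> J then 0 else real_of_int (c i))"
    using Ver_facts(7)[OF I] i by (simp add: sum.delta)
  finally show ?thesis using Ver_facts(11)[OF I i] by (simp add: cone_point_def inner_diff_left)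
qed

text \<open>The facet levels are integers, hence so are the slacks of a lattice point.\<close>

lemma bij_betw_cone_point:
  assumes I: "I \<in> Ver" "J \<subseteq> I" and l: "l > 0"
  shows "bij_betw (cone_point l I J)
    {c \<in> PiE (I - J) (\<lambda>_. UNIV). (\<Sum>i\<in>I-J. real_of_int (c i) *\<^sub>R \<upsilon> I i) \<in> M}
    {x \<in> M. \<forall>j\<in>J. x \<bullet> \<nu> j = real l * \<delta> j}"
    (is "bij_betw ?g ?D ?X")
proof (rule bij_betw_byWitness)
  let ?h = "\<lambda>x. restrict (\<lambda>i. \<lfloor>real l * \<delta> i - x \<bullet> \<nu> i\<rfloor>) (I - J)"
  have lv: "real l *\<^sub>R vtx I \<in> M" using add_subgroup_nat_scale[OF M_facts(1) Ver_facts(10)[OF I(1)]] .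
  show "\<forall>c\<in>?D. ?h (?g c) = c"
  proof
    fix c assume c: "c \<in> ?D"
    show "?h (?g c) = c"
    proof
      fix i
      show "?h (?g c) i = c i"
      proof (cases "i \<in> I - J")
        case True then show ?thesis using cone_point_inner[OF I(1), of i l J c] by simp
      next
        case False then show ?thesis using c PiE_arb[of c "I - J" "\<lambda>_. UNIV" i] False by auto
      qed
    qed
  qed
  have rec: "x = real l *\<^sub>R vtx I - (\<Sum>i\<in>I-J. (real l * \<delta> i - x \<bullet> \<nu> i) *\<^sub>R \<upsilon> I i)" if x: "x \<in> ?X" for x
  proof -
    have "(1 / real l) *\<^sub>R x = vtx I - (\<Sum>i\<in>I-J. (\<delta> i - ((1 / real l) *\<^sub>R x) \<bullet> \<nu> i) *\<^sub>R \<upsilon> I i)"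
      using x l by (intro vertex_expansion[OF I]) auto
    from arg_cong[OF this, of "scaleR (real l)"]
    have "real l *\<^sub>R ((1 / real l) *\<^sub>R x) =
        real l *\<^sub>R vtx I - (\<Sum>i\<in>I-J. (real l * (\<delta> i - ((1 / real l) *\<^sub>R x) \<bullet> \<nu> i)) *\<^sub>R \<upsilon> I i)"
      by (simp only: scaleR_diff_right scaleR_sum_right scaleR_scaleR)
    then show ?thesis using l by (simp add: right_diff_distrib)
  qed
  have fl: "real_of_int \<lfloor>real l * \<delta> i - x \<bullet> \<nu> i\<rfloor> = real l * \<delta> i - x \<bullet> \<nu> i" if "x \<in> M" "i \<in> I" for x i
  proof -
    have "x \<bullet> \<nu> i \<in> \<int>" using M_facts(3)[of x] that normal_in_N Ver_facts(8)[OF I(1)] by blast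
    then have "real l * \<delta> i - x \<bullet> \<nu> i \<in> \<int>" using level_integral[OF I(1) that(2)] by auto
    then show ?thesis by simp
  qed
  have hsum: "(\<Sum>i\<in>I-J. real_of_int (?h x i) *\<^sub>R \<upsilon> I i) = (\<Sum>i\<in>I-J. (real l * \<delta> i - x \<bullet> \<nu> i) *\<^sub>R \<upsilon> I i)"
    if "x \<in> M" for x
    using fl[OF that] by (intro sum.cong) auto
  show "\<forall>x\<in>?X. ?g (?h x) = x"
  proof
    fix x assume x: "x \<in> ?X"
    then have "x \<in> M" by simp
    show "?g (?h x) = x" unfolding cone_point_def hsum[OF \<open>x \<in> M\<close>] by (rule rec[OF x, symmetric])
  qed
  show "?g ` ?D \<subseteq> ?X"
  proof (intro image_subsetI CollectI conjI ballI)
    fix c assume c: "c \<in> ?D"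
    then show "cone_point l I J c \<in> M"
      unfolding cone_point_def using add_subgroup_closed(2)[OF M_facts(1) lv] by simp
    show "cone_point l I J c \<bullet> \<nu> j = real l * \<delta> j" if "j \<in> J" for j
      using cone_point_inner[OF I(1), of j l J c] that I(2) by auto
  qed
  show "?h ` ?X \<subseteq> ?D"
  proof (intro image_subsetI CollectI conjI)
    fix x assume x: "x \<in> ?X"
    then have xM: "x \<in> M" by simp
    show "?h x \<in> PiE (I - J) (\<lambda>_. UNIV)" by simp
    have "(\<Sum>i\<in>I-J. (real l * \<delta> i - x \<bullet> \<nu> i) *\<^sub>R \<upsilon> I i) = real l *\<^sub>R vtx I - x"
      using rec[OF x] by (metis (no_types, lifting) diff_diff_eq2 add_diff_cancel_left')
    then show "(\<Sum>i\<in>I-J. real_of_int (?h x i) *\<^sub>R \<upsilon> I i) \<in> M"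
      unfolding hsum[OF xM] using add_subgroup_closed(2)[OF M_facts(1) lv xM] by simp
  qed
qed

lemma character_filter:
  assumes I: "I \<in> Ver" "J \<subseteq> I"
  shows "(\<Sum>h\<in>H_grp M P I. \<Prod>i\<in>I-J. chi M P I i h powi c i) =
    (if (\<Sum>i\<in>I-J. real_of_int (c i) *\<^sub>R \<upsilon> I i) \<in> M then of_nat (card (H_grp M P I)) else 0)"
proof -
  \<comment> \<open>A zero exponent removes the factors with index in \<open>J\<close>.\<close>
  let ?c = "\<lambda>i. if i \<in> J then 0 else c i"
  have 1: "(\<Prod>i\<in>I. chi M P I i h powi ?c i) = (\<Prod>i\<in>I-J. chi M P I i h powi c i)" for h
    using Ver_facts(7)[OF I(1)] by (intro prod.mono_neutral_cong_right) auto
  have 2: "(\<Sum>i\<in>I. real_of_int (?c i) *\<^sub>R \<upsilon> I i) = (\<Sum>i\<in>I-J. real_of_int (c i) *\<^sub>R \<upsilon> I i)"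
    using Ver_facts(7)[OF I(1)] by (intro sum.mono_neutral_cong_right) auto
  show ?thesis using character_orthogonality[OF I(1), of ?c] unfolding 1 2 .
qed

text \<open>
  In the slack coordinates the flipped cone is a product of half-lines, on which the sum is a product of
  geometric series.  The average over \<open>H\<^sub>I\<close> restricts the sum to those integral slacks that come from lattice
  points.
\<close>

lemma has_sum_cone:
  fixes \<phi> :: "'a \<Rightarrow> complex"
  assumes I: "I \<in> Ver" "J \<subseteq> I" and l: "l > 0" and \<phi>: "linear \<phi>" "\<And>x. Re (\<phi> x) = x \<bullet> \<zeta>"
    and g: "generic \<zeta>" and t: "t > 0"
  shows "((\<lambda>x. of_int (\<Prod>i\<in>I-J. polar_sign \<zeta> ((1 / real l) *\<^sub>R x) I i) * exp (of_real t * \<phi> x)) has_sum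
    exp (of_real t * of_nat l * \<phi> (vtx I)) / of_nat (card (H_grp M P I)) *
      (\<Sum>h\<in>H_grp M P I. \<Prod>i\<in>I-J. 1 / (1 - chi M P I i h * exp (- (of_real t * \<phi> (\<upsilon> I i))))))
    {x \<in> M. \<forall>j\<in>J. x \<bullet> \<nu> j = real l * \<delta> j}"
proof -
  let ?H = "H_grp M P I" and ?A = "I - J" and ?C = "PiE (I - J) (\<lambda>_. UNIV :: int set)"
  define e where "e i = exp (- (of_real t * \<phi> (\<upsilon> I i)))" for i
  define z where "z h i = chi M P I i h * e i" for h i
  let ?pos = "\<lambda>i. \<upsilon> I i \<bullet> \<zeta> > 0"
  have finA: "finite ?A" using Ver_facts(7)[OF I(1)] by simp
  have cardH: "of_nat (card ?H) \<noteq> (0::complex)" using card_H_pos[OF Ver_facts(13)[OF I(1)]] by simp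
  have nz: "norm (z h i) = exp (- (t * (\<upsilon> I i \<bullet> \<zeta>)))" for h i
    by (simp add: z_def e_def norm_mult norm_exp_eq_Re \<phi>(2))
  have ne: "\<upsilon> I i \<bullet> \<zeta> \<noteq> 0" if "i \<in> ?A" for i using g I(1) that by (auto simp: generic_def)
  have one: "((\<lambda>c. \<Prod>i\<in>?A. of_int (ray_sign (?pos i) (c i)) * z h i powi c i) has_sum
      (\<Prod>i\<in>?A. 1 / (1 - z h i))) ?C" for h
  proof (rule has_sum_rays[OF finA])
    fix i assume i: "i \<in> ?A"
    show "z h i \<noteq> 0" by (simp add: z_def e_def)
    show "norm (z h i) \<noteq> 1" unfolding nz using ne[OF i] t by simp
    show "?pos i \<longleftrightarrow> norm (z h i) < 1" unfolding nz using t by (simp add: zero_less_mult_iff)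
  qed
  have two: "((\<lambda>c. 1 / of_nat (card ?H) * (\<Sum>h\<in>?H. \<Prod>i\<in>?A. of_int (ray_sign (?pos i) (c i)) * z h i powi c i))
      has_sum 1 / of_nat (card ?H) * (\<Sum>h\<in>?H. \<Prod>i\<in>?A. 1 / (1 - z h i))) ?C"
    by (intro has_sum_cmult_right has_sum_finite_sum one)
  let ?D = "{c \<in> ?C. (\<Sum>i\<in>?A. real_of_int (c i) *\<^sub>R \<upsilon> I i) \<in> M}"
  let ?f = "\<lambda>c. (\<Prod>i\<in>?A. of_int (ray_sign (?pos i) (c i)) * e i powi c i) :: complex"
  have three: "1 / of_nat (card ?H) * (\<Sum>h\<in>?H. \<Prod>i\<in>?A. of_int (ray_sign (?pos i) (c i)) * z h i powi c i)
      = (if (\<Sum>i\<in>?A. real_of_int (c i) *\<^sub>R \<upsilon> I i) \<in> M then ?f c else 0)" for c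
  proof -
    have "(\<Sum>h\<in>?H. \<Prod>i\<in>?A. of_int (ray_sign (?pos i) (c i)) * z h i powi c i) =
        (\<Sum>h\<in>?H. ?f c * (\<Prod>i\<in>?A. chi M P I i h powi c i))"
      unfolding z_def prod.distrib[symmetric] power_int_mult_distrib
      by (intro sum.cong prod.cong refl) (simp add: algebra_simps)
    also have "\<dots> = ?f c * (\<Sum>h\<in>?H. \<Prod>i\<in>?A. chi M P I i h powi c i)"
      by (simp add: sum_distrib_left)
    finally show ?thesis unfolding character_filter[OF I] using cardH by simp
  qed
  have four: "(?f has_sum 1 / of_nat (card ?H) * (\<Sum>h\<in>?H. \<Prod>i\<in>?A. 1 / (1 - z h i))) ?D"
    using two unfolding three
    by (subst (asm) has_sum_cong_neutral[where T = ?D and g = ?f]) auto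
  let ?X = "{x \<in> M. \<forall>j\<in>J. x \<bullet> \<nu> j = real l * \<delta> j}"
  let ?F = "\<lambda>x. of_int (\<Prod>i\<in>?A. polar_sign \<zeta> ((1 / real l) *\<^sub>R x) I i) * exp (of_real t * \<phi> x)"
  have F: "?F (cone_point l I J c) = exp (of_real t * of_nat l * \<phi> (vtx I)) * ?f c" for c
  proof -
    have s: "polar_sign \<zeta> ((1 / real l) *\<^sub>R cone_point l I J c) I i = ray_sign (?pos i) (c i)" if i: "i \<in> ?A" for i
    proof -
      have "((1 / real l) *\<^sub>R cone_point l I J c) \<bullet> \<nu> i \<le> \<delta> i \<longleftrightarrow> c i \<ge> 0"
      proof -
        have "cone_point l I J c \<bullet> \<nu> i = real l * \<delta> i - real_of_int (c i)"
          using cone_point_inner[OF I(1), of i l J c] i by simp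
        then have "((1 / real l) *\<^sub>R cone_point l I J c) \<bullet> \<nu> i = \<delta> i - real_of_int (c i) / real l"
          using l by (simp add: diff_divide_distrib)
        then show ?thesis using l by (simp add: zero_le_divide_iff)
      qed
      then show ?thesis by (simp only: polar_sign_def ray_sign_def)
    qed
    have "\<phi> (cone_point l I J c) = of_nat l * \<phi> (vtx I) - (\<Sum>i\<in>?A. of_int (c i) * \<phi> (\<upsilon> I i))"
      unfolding cone_point_def using \<phi>(1)
      by (simp add: linear_diff linear_sum linear_scale scaleR_conv_of_real)
    have "exp (of_real t * \<phi> (cone_point l I J c)) =
        exp (of_real t * of_nat l * \<phi> (vtx I)) * exp (\<Sum>i\<in>?A. of_int (c i) * (- (of_real t * \<phi> (\<upsilon> I i))))"
      unfolding exp_add[symmetric] \<open>\<phi> (cone_point l I J c) = _\<close>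
      by (simp add: algebra_simps sum_distrib_left sum_negf)
    also have "exp (\<Sum>i\<in>?A. of_int (c i) * (- (of_real t * \<phi> (\<upsilon> I i)))) = (\<Prod>i\<in>?A. e i powi c i)"
      unfolding exp_sum[OF finA] e_def exp_power_int ..
    finally show ?thesis using s by (simp add: prod.distrib)
  qed
  have "((\<lambda>c. ?F (cone_point l I J c)) has_sum
      exp (of_real t * of_nat l * \<phi> (vtx I)) * (1 / of_nat (card ?H) * (\<Sum>h\<in>?H. \<Prod>i\<in>?A. 1 / (1 - z h i)))) ?D"
    unfolding F by (rule has_sum_cmult_right[OF four])
  from has_sum_reindex_bij_betw[OF bij_betw_cone_point[OF I l], of ?F, THEN iffD1, OF this]
  show ?thesis by (simp add: z_def e_def)
qed

definition face_points where
  "face_points J l = {x \<in> M. (1 / real l) *\<^sub>R x \<in> face M P J}"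

lemma finite_face_points:
  assumes "l > 0" shows "finite (face_points J l)"
proof -
  have "face_points J l \<subseteq> M \<inter> (\<lambda>u. real l *\<^sub>R u) ` P"
  proof
    fix x assume x: "x \<in> face_points J l"
    then have "real l *\<^sub>R ((1 / real l) *\<^sub>R x) \<in> (\<lambda>u. real l *\<^sub>R u) ` P"
      by (intro imageI) (auto simp: face_points_def face_def)
    then show "x \<in> M \<inter> (\<lambda>u. real l *\<^sub>R u) ` P" using x assms by (simp add: face_points_def)
  qed
  moreover have "finite (M \<inter> (\<lambda>u. real l *\<^sub>R u) ` P)"
    by (intro M_facts(4) bounded_scaling compact_imp_bounded compact_P)
  ultimately show ?thesis by (rule finite_subset)
qed

text \<open>
  The sums of the flipped cones all converge, and \<open>polar_decomposition\<close> adds them up to the sum over the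
  face.
\<close>

theorem brion:
  fixes \<phi> :: "'a \<Rightarrow> complex"
  assumes J: "J \<in> Simp" and l: "l > 0" and \<phi>: "linear \<phi>" "\<And>x. Re (\<phi> x) = x \<bullet> \<zeta>"
    and g: "generic \<zeta>" and t: "t > 0"
  shows "(\<Sum>x\<in>face_points J l. exp (of_real t * \<phi> x)) =
    (\<Sum>I | I \<in> Ver \<and> J \<subseteq> I. exp (of_real t * of_nat l * \<phi> (vtx I)) / of_nat (card (H_grp M P I)) *
      (\<Sum>h\<in>H_grp M P I. \<Prod>i\<in>I-J. 1 / (1 - chi M P I i h * exp (- (of_real t * \<phi> (\<upsilon> I i))))))"
    (is "_ = ?R")
proof -
  let ?X = "{x \<in> M. \<forall>j\<in>J. x \<bullet> \<nu> j = real l * \<delta> j}"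
  let ?F = "\<lambda>x. \<Sum>I | I \<in> Ver \<and> J \<subseteq> I. of_int (\<Prod>i\<in>I-J. polar_sign \<zeta> ((1 / real l) *\<^sub>R x) I i) * exp (of_real t * \<phi> x)"
  have "(?F has_sum ?R) ?X"
    by (intro has_sum_finite_sum has_sum_cone[OF _ _ l \<phi> g t]) auto
  moreover have "?F x = (if (1 / real l) *\<^sub>R x \<in> P then exp (of_real t * \<phi> x) else 0)" if x: "x \<in> ?X" for x
  proof -
    have "?F x = of_int (\<Sum>I | I \<in> Ver \<and> J \<subseteq> I. \<Prod>i\<in>I-J. polar_sign \<zeta> ((1 / real l) *\<^sub>R x) I i) * exp (of_real t * \<phi> x)"
      by (simp add: sum_distrib_right)
    also have "(\<Sum>I | I \<in> Ver \<and> J \<subseteq> I. \<Prod>i\<in>I-J. polar_sign \<zeta> ((1 / real l) *\<^sub>R x) I i) =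
        (if (1 / real l) *\<^sub>R x \<in> P then 1 else 0)"
      using x l by (intro polar_decomposition[OF J g]) auto
    finally show ?thesis by simp
  qed
  moreover have "x \<in> face_points J l \<longleftrightarrow> x \<in> ?X \<and> (1 / real l) *\<^sub>R x \<in> P" for x
    using l by (auto simp: face_points_def face_def field_simps)
  ultimately have "((\<lambda>x. exp (of_real t * \<phi> x)) has_sum ?R) (face_points J l)"
    by (subst has_sum_cong_neutral[where T = ?X and g = ?F]) auto
  then show ?thesis unfolding has_sum_finite_iff[OF finite_face_points[OF l]] by simp
qed

end

section \<open>Laurent coefficients and lattice points in dilated faces\<close>

definition todd_den :: "complex \<Rightarrow> complex \<Rightarrow> complex fps" where
  "todd_den c x = 1 - fps_const c * fps_exp (- x)"

text \<open>The power series of \<open>t / (1 - c e\<^sup>-\<^sup>t)\<close>.\<close>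

definition todd_num :: "complex \<Rightarrow> complex fps" where
  "todd_num c = (if c = 1 then inverse (fps_shift 1 (todd_den c 1)) else fps_X * inverse (todd_den c 1))"

lemma todd_num_den: "todd_num c * todd_den c 1 = fps_X"
proof (cases "c = 1")
  case True
  have 0: "fps_nth (todd_den c 1) 0 = 0" using True by (simp add: todd_den_def)
  have 1: "fps_nth (fps_shift 1 (todd_den c 1)) 0 \<noteq> 0" using True by (simp add: todd_den_def)
  have "todd_den c 1 = fps_shift 1 (todd_den c 1) * fps_X"
    using 0 by (intro fps_ext) auto
  then have "todd_num c * todd_den c 1 = inverse (fps_shift 1 (todd_den c 1)) * fps_shift 1 (todd_den c 1) * fps_X"
    using True by (simp add: todd_num_def mult.assoc)
  then show ?thesis using inverse_mult_eq_1[OF 1] by simp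
next
  case False
  then have "fps_nth (todd_den c 1) 0 \<noteq> 0" by (simp add: todd_den_def)
  then show ?thesis using False inverse_mult_eq_1 by (simp add: todd_num_def mult.assoc)
qed

lemma todd_num_nth_0: "fps_nth (todd_num c) 0 = (if c = 1 then 1 else 0)"
  by (simp add: todd_num_def todd_den_def)

text \<open>The Laurent series of \<open>1 / (1 - c e\<^sup>-\<^sup>t\<^sup>x)\<close> in \<open>t\<close>.\<close>

definition todd_scaled :: "complex \<Rightarrow> complex \<Rightarrow> complex fls" where
  "todd_scaled c x = 1 / (1 - fls_const c * fps_to_fls (fps_exp (- x)))"

lemma todd_scaled_eq:
  assumes x: "x \<noteq> 0"
  shows "todd_scaled c x = fls_shift 1 (fps_to_fls (fps_const (1 / x) * Abs_fps (\<lambda>n. x ^ n * fps_nth (todd_num c) n)))"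
proof -
  let ?D = "1 - fls_const c * fps_to_fls (fps_exp (- x))"
  have D: "?D = fps_to_fls (todd_den c x)"
    by (simp add: todd_den_def fls_times_fps_to_fls)
  let ?L = "fps_const x * fps_X :: complex fps"
  have d: "todd_den c x = fps_compose (todd_den c 1) ?L"
    unfolding fps_compose_linear
  proof (rule fps_ext)
    fix n
    have pm: "(- x) ^ n = x ^ n * (- 1) ^ n" by (metis mult.commute power_minus)
    show "fps_nth (todd_den c x) n = fps_nth (Abs_fps (\<lambda>n. x ^ n * fps_nth (todd_den c 1) n)) n"
      by (cases "n = 0") (simp_all add: todd_den_def pm)
  qed
  have "fps_compose (todd_num c) ?L * todd_den c x = ?L"
    unfolding d by (subst fps_compose_mult_distrib[symmetric]) (auto simp: todd_num_den)
  then have "fps_const (1 / x) * fps_compose (todd_num c) ?L * todd_den c x = fps_const (1 / x) * ?L"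
    by (simp only: mult.assoc)
  also have "\<dots> = fps_X" using x by (simp add: mult.assoc[symmetric])
  finally have e: "fps_const (1 / x) * Abs_fps (\<lambda>n. x ^ n * fps_nth (todd_num c) n) * todd_den c x = fps_X"
    unfolding fps_compose_linear .
  have Dne: "?D \<noteq> 0"
  proof
    assume "?D = 0"
    then have "todd_den c x = 0" unfolding D by simp
    then show False using e by simp
  qed
  let ?A = "fps_const (1 / x) * Abs_fps (\<lambda>n. x ^ n * fps_nth (todd_num c) n)"
  have "fls_shift 1 (fps_to_fls ?A) * ?D = fls_X_inv * (fps_to_fls ?A * fps_to_fls (todd_den c x))"
    unfolding D fls_X_inv_times_conv_shift(1)[symmetric] by (simp only: mult.assoc)
  also have "\<dots> = fls_X_inv * fls_X"
    unfolding fls_times_fps_to_fls[symmetric] e by simp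
  also have "\<dots> = 1" by (simp add: fls_X_inv_times_conv_shift(1))
  finally show ?thesis unfolding todd_scaled_def 
    using Dne by (subst nonzero_divide_eq_eq) simp_all
qed

lemma todd_series_eq_scaled: "todd_series c = todd_scaled c 1"
  by (simp add: todd_series_def todd_scaled_def)

lemma todd_scaled_nth:
  assumes "x \<noteq> 0"
  shows "fls_nth (todd_scaled c x) m = fls_nth (todd_series c) m * x powi m"
proof (cases "m < -1")
  case True
  then show ?thesis unfolding todd_series_eq_scaled todd_scaled_eq[OF assms] todd_scaled_eq[OF one_neq_zero]
    by simp
next
  case False
  then have "\<exists>n. m + 1 = int n" by (intro zero_le_imp_eq_int) simp
  then obtain n where "m + 1 = int n" by blast
  then have n: "m = int n - 1" by simp
  have "x powi m = x ^ n / x" using assms unfolding n by (simp add: power_int_diff)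
  then show ?thesis unfolding todd_series_eq_scaled todd_scaled_eq[OF assms] todd_scaled_eq[OF one_neq_zero]
    by (simp add: n)
qed

lemma todd_series_nth_below: "m < - 1 \<Longrightarrow> fls_nth (todd_series c) m = 0"
  unfolding todd_series_eq_scaled todd_scaled_eq[OF one_neq_zero] by simp

lemma todd_series_nth_pole: "fls_nth (todd_series c) (- 1) = (if c = 1 then 1 else 0)"
  unfolding todd_series_eq_scaled todd_scaled_eq[OF one_neq_zero] by (simp add: todd_num_nth_0)

lemma has_laurent_expansion_todd_scaled:
  "(\<lambda>t. 1 / (1 - c * exp (- (t * x)))) has_laurent_expansion todd_scaled c x"
proof -
  have "(\<lambda>t. exp (- x * t)) has_laurent_expansion fps_to_fls (fps_exp (- x))"
    by (rule has_laurent_expansion_fps[OF has_fps_expansion_exp])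
  then have "(\<lambda>t. exp (- (t * x))) has_laurent_expansion fps_to_fls (fps_exp (- x))"
    by (simp add: mult.commute)
  then show ?thesis unfolding todd_scaled_def
    by (intro laurent_expansion_intros)
qed

lemma fls_times_nth_bounded:
  fixes F G :: "complex fls"
  assumes F: "\<And>k. k < a \<Longrightarrow> fls_nth F k = 0" and G: "\<And>k. k < b \<Longrightarrow> fls_nth G k = 0"
  shows "fls_nth (F * G) n = (\<Sum>k=a..n-b. fls_nth F k * fls_nth G (n - k))"
proof (cases "F = 0 \<or> G = 0")
  case True then show ?thesis by auto
next
  case False
  have a: "a \<le> fls_subdegree F" using F nth_fls_subdegree_nonzero[of F] False by force
  have b: "b \<le> fls_subdegree G" using G nth_fls_subdegree_nonzero[of G] False by force
  have "fls_nth (F * G) n = (\<Sum>k=fls_subdegree F..n-fls_subdegree G. fls_nth F k * fls_nth G (n - k))"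
    by (rule fls_times_nth(2))
  also have "\<dots> = (\<Sum>k=a..n-b. fls_nth F k * fls_nth G (n - k))"
    using a b by (intro sum.mono_neutral_left) (auto simp: fls_eq0_below_subdegree not_le)
  finally show ?thesis .
qed

definition exponents :: "'i set \<Rightarrow> int \<Rightarrow> ('i \<Rightarrow> int) set" where
  "exponents A s = {m \<in> A \<rightarrow>\<^sub>E {-1..}. (\<Sum>j\<in>A. m j) = s}"

lemma exponents_bound:
  assumes "finite A" "m \<in> exponents A s" "i \<in> A"
  shows "m i \<le> s + int (card A)"
proof -
  have "(\<Sum>j\<in>A - {i}. - 1) \<le> (\<Sum>j\<in>A - {i}. m j)"
    using assms(2) by (intro sum_mono) (auto simp: exponents_def PiE_iff)
  moreover have "(\<Sum>j\<in>A. m j) = m i + (\<Sum>j\<in>A - {i}. m j)" by (rule sum.remove[OF assms(1,3)])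
  ultimately show ?thesis using assms by (auto simp: exponents_def)
qed

lemma finite_exponents:
  assumes "finite A" shows "finite (exponents A s)"
proof (rule finite_subset)
  show "exponents A s \<subseteq> PiE A (\<lambda>_. {-1..s + int (card A)})"
  proof (intro subsetI PiE_I)
    fix m i assume m: "m \<in> exponents A s"
    show "m i \<in> {-1..s + int (card A)}" if "i \<in> A"
      using exponents_bound[OF assms m that] m that by (auto simp: exponents_def PiE_iff)
    show "m i = undefined" if "i \<notin> A"
      using m that by (auto simp: exponents_def PiE_iff extensional_def)
  qed
  show "finite (PiE A (\<lambda>_. {-1..s + int (card A)}))" using assms by (intro finite_PiE) auto
qed

lemma sum_exponents_insert:
  fixes g :: "('i \<Rightarrow> int) \<Rightarrow> complex"
  assumes A: "finite A" and a: "a \<notin> A"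
  shows "(\<Sum>m\<in>exponents (insert a A) s. g m) =
    (\<Sum>k=-1..s + int (card A). \<Sum>m\<in>exponents A (s - k). g (m(a := k)))"
proof -
  have "(\<Sum>k=-1..s + int (card A). \<Sum>m\<in>exponents A (s - k). g (m(a := k))) =
    (\<Sum>(k, m)\<in>(SIGMA k:{-1..s + int (card A)}. exponents A (s - k)). g (m(a := k)))"
    by (rule sum.Sigma) (use A finite_exponents in auto)
  also have "\<dots> = (\<Sum>m\<in>exponents (insert a A) s. g m)"
  proof (rule sum.reindex_bij_witness[where i = "\<lambda>m. (m a, restrict m A)" and j = "\<lambda>(k, m). m(a := k)"])
    fix q assume q: "q \<in> (SIGMA k:{-1..s + int (card A)}. exponents A (s - k))"
    then obtain k m where km: "q = (k, m)" "k \<in> {-1..s + int (card A)}" "m \<in> exponents A (s - k)" by blast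
    have "restrict (m(a := k)) A = m"
      using km(3) a by (auto simp: exponents_def fun_eq_iff PiE_iff extensional_def)
    then show "(\<lambda>m. (m a, restrict m A)) ((\<lambda>(k, m). m(a := k)) q) = q" by (simp add: km(1))
    have "(\<Sum>j\<in>A. (m(a := k)) j) = (\<Sum>j\<in>A. m j)" using a by (intro sum.cong) auto
    then have "(\<Sum>j\<in>insert a A. (m(a := k)) j) = s"
      using A a km(3) by (auto simp: exponents_def simp del: fun_upd_apply) simp
    moreover have "m(a := k) \<in> insert a A \<rightarrow>\<^sub>E {-1..}"
      using km by (auto simp: exponents_def PiE_iff extensional_def)
    ultimately show "(\<lambda>(k, m). m(a := k)) q \<in> exponents (insert a A) s" by (simp add: km(1) exponents_def)
    show "g ((\<lambda>(k, m). m(a := k)) q) = (case q of (k, m) \<Rightarrow> g (m(a := k)))" by (simp add: km(1))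
  next
    fix m assume m: "m \<in> exponents (insert a A) s"
    then have mE: "m \<in> insert a A \<rightarrow>\<^sub>E {-1..}" and ms: "m a + (\<Sum>j\<in>A. m j) = s"
      using A a by (auto simp: exponents_def)
    show "(\<lambda>(k, m). m(a := k)) ((\<lambda>m. (m a, restrict m A)) m) = m"
      using mE a by (auto simp: fun_eq_iff PiE_iff extensional_def)
    have r: "restrict m A \<in> exponents A (s - m a)"
      using mE ms by (auto simp: exponents_def PiE_iff)
    have "(\<Sum>j\<in>A. - 1) \<le> (\<Sum>j\<in>A. m j)" using mE by (intro sum_mono) (auto simp: PiE_iff)
    then have "m a \<le> s + int (card A)" using ms by simp
    then show "(\<lambda>m. (m a, restrict m A)) m \<in> (SIGMA k:{-1..s + int (card A)}. exponents A (s - k))"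
      using r mE by (auto simp: PiE_iff)
  qed
  finally show ?thesis by simp
qed

text \<open>
  Both claims are proved together: the bound on the order of the pole of the product makes the
  Cauchy product with one more factor a finite sum.
\<close>

lemma fls_prod_nth_simple_poles:
  fixes F :: "'i \<Rightarrow> complex fls"
  assumes "finite A" "\<And>i k. i \<in> A \<Longrightarrow> k < - 1 \<Longrightarrow> fls_nth (F i) k = 0"
  shows "fls_nth (\<Prod>i\<in>A. F i) s = (\<Sum>m\<in>exponents A s. \<Prod>i\<in>A. fls_nth (F i) (m i))"
    and "s < - int (card A) \<Longrightarrow> fls_nth (\<Prod>i\<in>A. F i) s = 0"
proof -
  have "(\<forall>s. fls_nth (\<Prod>i\<in>A. F i) s = (\<Sum>m\<in>exponents A s. \<Prod>i\<in>A. fls_nth (F i) (m i))) \<and>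
      (\<forall>s < - int (card A). fls_nth (\<Prod>i\<in>A. F i) s = 0)"
    using assms
  proof (induction A rule: finite_induct)
    case empty
    have "exponents ({} :: 'i set) s = (if s = 0 then {\<lambda>_. undefined} else {})" for s by (auto simp: exponents_def)
    then show ?case by simp
  next
    case (insert a A)
    then have IH1: "\<And>s. fls_nth (\<Prod>i\<in>A. F i) s = (\<Sum>m\<in>exponents A s. \<Prod>i\<in>A. fls_nth (F i) (m i))"
      and IH2: "\<And>s. s < - int (card A) \<Longrightarrow> fls_nth (\<Prod>i\<in>A. F i) s = 0" by auto
    have mult: "fls_nth (F a * (\<Prod>i\<in>A. F i)) s =
        (\<Sum>k=-1..s + int (card A). fls_nth (F a) k * fls_nth (\<Prod>i\<in>A. F i) (s - k))" for s
      using fls_times_nth_bounded[of "-1" "F a" "- int (card A)" "\<Prod>i\<in>A. F i" s] insert.prems IH2 by simp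
    have upd: "(\<Prod>i\<in>insert a A. fls_nth (F i) ((m(a := k)) i)) = fls_nth (F a) k * (\<Prod>i\<in>A. fls_nth (F i) (m i))" for m k
    proof -
      have "(\<Prod>i\<in>A. fls_nth (F i) ((m(a := k)) i)) = (\<Prod>i\<in>A. fls_nth (F i) (m i))"
        using insert.hyps by (intro prod.cong) auto
      then show ?thesis using insert.hyps by simp
    qed
    show ?case
    proof (intro conjI allI impI)
      fix s
      show "fls_nth (\<Prod>i\<in>insert a A. F i) s = (\<Sum>m\<in>exponents (insert a A) s. \<Prod>i\<in>insert a A. fls_nth (F i) (m i))"
        unfolding sum_exponents_insert[OF insert.hyps] upd prod.insert[OF insert.hyps, of F] mult IH1
        by (simp add: sum_distrib_left)
      show "fls_nth (\<Prod>i\<in>insert a A. F i) s = 0" if "s < - int (card (insert a A))"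
        unfolding prod.insert[OF insert.hyps, of F] mult using that insert.hyps by simp
    qed
  qed
  then show "fls_nth (\<Prod>i\<in>A. F i) s = (\<Sum>m\<in>exponents A s. \<Prod>i\<in>A. fls_nth (F i) (m i))"
    and "s < - int (card A) \<Longrightarrow> fls_nth (\<Prod>i\<in>A. F i) s = 0" by auto
qed

lemma fls_nth_exp_times:
  fixes F :: "complex fls"
  assumes "\<And>s. s < - int m \<Longrightarrow> fls_nth F s = 0"
  shows "fls_nth (fps_to_fls (fps_exp c) * F) 0 = (\<Sum>q\<le>m. c ^ q / fact q * fls_nth F (- int q))"
proof -
  have "fls_nth (fps_to_fls (fps_exp c) * F) 0 = (\<Sum>k=0..int m. fls_nth (fps_to_fls (fps_exp c)) k * fls_nth F (0 - k))"
    using fls_times_nth_bounded[of 0 "fps_to_fls (fps_exp c)" "- int m" F 0] assms by simp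
  also have "\<dots> = (\<Sum>q\<le>m. c ^ q / fact q * fls_nth F (- int q))"
    by (rule sum.reindex_bij_witness[where i = int and j = nat]) auto
  finally show ?thesis .
qed

lemma fls_nth_const_mult: "fls_nth (fls_const c * F) n = (c::complex) * fls_nth F n"
  by simp

text \<open>
  A function with a nonzero Laurent expansion has no zeros near 0 apart from 0 itself, in particular
  none on the positive real axis.
\<close>

lemma laurent_expansions_agree:
  assumes F: "f has_laurent_expansion F" and G: "g has_laurent_expansion G"
    and eq: "\<And>t. t > 0 \<Longrightarrow> f (of_real t) = g (of_real t)"
  shows "F = G"
proof (rule ccontr)
  assume "F \<noteq> G"
  have "(\<lambda>t. f t - g t) has_laurent_expansion F - G" using F G by (rule has_laurent_expansion_diff)
  then have "eventually (\<lambda>t. f t - g t \<noteq> 0) (at 0)"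
    using has_laurent_expansion_eventually_nonzero_iff' \<open>F \<noteq> G\<close> by fastforce
  moreover have "filterlim complex_of_real (at 0) (at_right 0)"
    unfolding filterlim_at
    by (auto intro!: tendsto_eq_intros simp: eventually_at_filter)
  ultimately have "eventually (\<lambda>t. f (complex_of_real t) - g (complex_of_real t) \<noteq> 0) (at_right 0)"
    by (rule eventually_compose_filterlim)
  moreover have "eventually (\<lambda>t. t > (0::real)) (at_right 0)" by (rule eventually_at_right_less)
  ultimately have "eventually (\<lambda>t::real. False) (at_right 0)" by eventually_elim (use eq in auto)
  then show False by simp
qed

context simple_lattice_polytope begin

text \<open>
  The coefficient of \<open>l\<^sup>q\<close> in the number of lattice points of \<open>l P\<^sub>J\<close>, as \<open>card_face_points\<close> shows; it is
  therefore the same for all generic \<open>\<phi>\<close>.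
\<close>

definition ehrhart_coeff :: "'a set set \<Rightarrow> ('a \<Rightarrow> complex) \<Rightarrow> nat \<Rightarrow> complex" where
  "ehrhart_coeff J \<phi> q = (\<Sum>I | I \<in> Ver \<and> J \<subseteq> I. \<phi> (vtx I) ^ q / fact q / of_nat (card (H_grp M P I)) *
     (\<Sum>h\<in>H_grp M P I. fls_nth (\<Prod>i\<in>I-J. todd_scaled (chi M P I i h) (\<phi> (\<upsilon> I i))) (- int q)))"

lemma generic_nonzero:
  fixes \<phi> :: "'a \<Rightarrow> complex"
  assumes "\<And>x. Re (\<phi> x) = x \<bullet> \<zeta>" "generic \<zeta>" "I \<in> Ver" "i \<in> I"
  shows "\<phi> (\<upsilon> I i) \<noteq> 0"
proof
  assume "\<phi> (\<upsilon> I i) = 0"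
  then have "\<upsilon> I i \<bullet> \<zeta> = 0" using assms(1)[of "\<upsilon> I i"] by simp
  then show False using assms by (auto simp: generic_def)
qed

lemma todd_prod_nth_below:
  fixes \<phi> :: "'a \<Rightarrow> complex"
  assumes \<phi>: "\<And>x. Re (\<phi> x) = x \<bullet> \<zeta>" "generic \<zeta>" and I: "I \<in> Ver" "J \<subseteq> I"
    and s: "s < - int (DIM('a) - card J)"
  shows "fls_nth (\<Prod>i\<in>I-J. todd_scaled (chi M P I i h) (\<phi> (\<upsilon> I i))) s = 0"
proof (rule fls_prod_nth_simple_poles(2))
  show "finite (I - J)" using Ver_facts(7)[OF I(1)] by simp
  show "fls_nth (todd_scaled (chi M P I i h) (\<phi> (\<upsilon> I i))) k = 0" if "i \<in> I - J" "k < - 1" for i k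
    using todd_scaled_nth[OF generic_nonzero[OF \<phi> I(1)]] todd_series_nth_below that by simp
  have "card (I - J) = DIM('a) - card J"
    using Ver_facts(4,7)[OF I(1)] I(2) by (simp add: card_Diff_subset finite_subset)
  then show "s < - int (card (I - J))" using s by simp
qed

text \<open>
  Compare the constant terms of the Laurent expansions in \<open>t\<close> of the two sides of Brion's formula.  On the left
  each point contributes 1.  On the right \<open>e\<^sup>t\<^sup>l\<^sup>\<phi>\<^sup>(\<^sup>p\<^sup>)\<close> supplies the powers \<open>l\<^sup>q t\<^sup>q\<close>, which meet the
  coefficients of \<open>t\<^sup>-\<^sup>q\<close> in the product over \<open>I - J\<close>.
\<close>

theorem card_face_points:
  fixes \<phi> :: "'a \<Rightarrow> complex"
  assumes J: "J \<in> Simp" and l: "l > 0" and \<phi>: "linear \<phi>" "\<And>x. Re (\<phi> x) = x \<bullet> \<zeta>"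
    and g: "generic \<zeta>"
  shows "of_nat (card (face_points J l)) = (\<Sum>q\<le>DIM('a) - card J. ehrhart_coeff J \<phi> q * of_nat l ^ q)"
proof -
  let ?V = "{I. I \<in> Ver \<and> J \<subseteq> I}" and ?m = "DIM('a) - card J"
  let ?T = "\<lambda>I h. \<Prod>i\<in>I-J. todd_scaled (chi M P I i h) (\<phi> (\<upsilon> I i))"
  let ?c = "\<lambda>I. of_nat l * \<phi> (vtx I)"
  let ?F = "fps_to_fls (\<Sum>x\<in>face_points J l. fps_exp (\<phi> x))"
  let ?G = "\<Sum>I\<in>?V. fls_const (1 / of_nat (card (H_grp M P I))) * (\<Sum>h\<in>H_grp M P I. fps_to_fls (fps_exp (?c I)) * ?T I h)"
  have exp: "(\<lambda>t. exp (t * c)) has_fps_expansion fps_exp c" for c :: complex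
    using has_fps_expansion_exp[of c] by (simp add: mult.commute)
  have f: "(\<lambda>t. \<Sum>x\<in>face_points J l. exp (t * \<phi> x)) has_laurent_expansion ?F"
    by (intro has_laurent_expansion_fps has_fps_expansion_sum exp)
  have g': "(\<lambda>t. \<Sum>I\<in>?V. 1 / of_nat (card (H_grp M P I)) * (\<Sum>h\<in>H_grp M P I. exp (t * ?c I) *
      (\<Prod>i\<in>I-J. 1 / (1 - chi M P I i h * exp (- (t * \<phi> (\<upsilon> I i))))))) has_laurent_expansion ?G"
    by (intro laurent_expansion_intros has_laurent_expansion_fps exp has_laurent_expansion_todd_scaled)
  have "?F = ?G"
  proof (rule laurent_expansions_agree[OF f g'])
    fix t :: real assume t: "t > 0"
    show "(\<Sum>x\<in>face_points J l. exp (of_real t * \<phi> x)) = (\<Sum>I\<in>?V. 1 / of_nat (card (H_grp M P I)) *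
      (\<Sum>h\<in>H_grp M P I. exp (of_real t * ?c I) *
      (\<Prod>i\<in>I-J. 1 / (1 - chi M P I i h * exp (- (of_real t * \<phi> (\<upsilon> I i)))))))"
      unfolding brion[OF J l \<phi> g t]
      by (intro sum.cong refl) (simp add: sum_distrib_left[symmetric] mult.assoc)
  qed
  then have eq: "fls_nth ?F 0 = fls_nth ?G 0" by (rule arg_cong)
  have "of_nat (card (face_points J l)) = fls_nth ?F 0"
    by (simp add: fps_sum_nth)
  also note eq
  also have "fls_nth ?G 0 = (\<Sum>I\<in>?V. 1 / of_nat (card (H_grp M P I)) *
      (\<Sum>h\<in>H_grp M P I. fls_nth (fps_to_fls (fps_exp (?c I)) * ?T I h) 0))"
    by (simp only: fls_nth_sum fls_nth_const_mult)
  also have "\<dots> = (\<Sum>I\<in>?V. 1 / of_nat (card (H_grp M P I)) *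
      (\<Sum>h\<in>H_grp M P I. \<Sum>q\<le>?m. ?c I ^ q / fact q * fls_nth (?T I h) (- int q)))"
    by (intro sum.cong refl arg_cong2[where f = times] fls_nth_exp_times todd_prod_nth_below[OF \<phi>(2) g]) auto
  also have "\<dots> = (\<Sum>q\<le>?m. \<Sum>I\<in>?V. 1 / of_nat (card (H_grp M P I)) *
      (\<Sum>h\<in>H_grp M P I. ?c I ^ q / fact q * fls_nth (?T I h) (- int q)))"
    by (subst sum.swap, subst (2) sum.swap) (simp add: sum_distrib_left)
  also have "\<dots> = (\<Sum>q\<le>?m. ehrhart_coeff J \<phi> q * of_nat l ^ q)"
    unfolding ehrhart_coeff_def sum_distrib_right
    by (intro sum.cong refl) (simp only: sum_distrib_left[symmetric] power_mult_distrib, simp add: mult_ac)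
  finally show ?thesis .
qed

end

section \<open>Counting grid points and volume\<close>

text \<open>By Fubini's theorem in the \<open>j\<close>-th coordinate, since each section is a single point.\<close>

lemma hyperplane_null_PiM:
  fixes a :: "nat \<Rightarrow> real"
  assumes j: "j < m" "a j \<noteq> 0"
  shows "{t \<in> space (PiM {..<m} (\<lambda>_. lborel)). (\<Sum>i<m. t i * a i) = b} \<in> null_sets (PiM {..<m} (\<lambda>_. lborel))"
    (is "?H \<in> _")
proof -
  interpret product_sigma_finite "\<lambda>_::nat. lborel :: real measure" by standard
  let ?I = "{..<m} - {j}"
  have ins: "{..<m} = insert j ?I" using j by auto
  have meas: "?H \<in> sets (PiM {..<m} (\<lambda>_. lborel))" by measurable
  have "emeasure (PiM {..<m} (\<lambda>_. lborel)) ?H = (\<integral>\<^sup>+t. indicator ?H t \<partial>PiM (insert j ?I) (\<lambda>_. lborel))"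
    using meas ins by (simp del: insert_Diff_single)
  also have "\<dots> = (\<integral>\<^sup>+x. (\<integral>\<^sup>+y. indicator ?H (x(j := y)) \<partial>lborel) \<partial>PiM ?I (\<lambda>_. lborel))"
    using meas ins by (intro product_nn_integral_insert) auto
  also have "\<dots> = (\<integral>\<^sup>+x. 0 \<partial>PiM ?I (\<lambda>_. lborel :: real measure))"
  proof (rule nn_integral_cong)
    fix x :: "nat \<Rightarrow> real"
    define c where "c = (b - (\<Sum>i\<in>?I. x i * a i)) / a j"
    have "indicator ?H (x(j := y)) \<le> (indicator {c} y :: ennreal)" for y
    proof (cases "x(j := y) \<in> ?H")
      case True
      have "(\<Sum>i<m. (x(j := y)) i * a i) = y * a j + (\<Sum>i\<in>?I. (x(j := y)) i * a i)"
        using j by (subst sum.remove[of _ j]) auto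
      also have "(\<Sum>i\<in>?I. (x(j := y)) i * a i) = (\<Sum>i\<in>?I. x i * a i)" by (intro sum.cong) auto
      finally have "y = c" using True j by (simp add: c_def field_simps)
      then show ?thesis by (simp add: indicator_def)
    qed simp
    then have "(\<integral>\<^sup>+y. indicator ?H (x(j := y)) \<partial>lborel) \<le> (\<integral>\<^sup>+y. indicator {c} y \<partial>lborel)"
      by (intro nn_integral_mono) blast
    also have "\<dots> = 0" by simp
    finally show "(\<integral>\<^sup>+y. indicator ?H (x(j := y)) \<partial>lborel) = 0" by simp
  qed
  finally show ?thesis using meas by (intro null_setsI) auto
qed

lemma floor_div_tendsto: "(\<lambda>l. of_int \<lfloor>real l * x\<rfloor> / real l) \<longlonglongrightarrow> (x::real)"
proof (rule tendsto_sandwich[of "\<lambda>l. x - 1 / real l" _ _ "\<lambda>l. x"])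
  show "eventually (\<lambda>l. x - 1 / real l \<le> of_int \<lfloor>real l * x\<rfloor> / real l) sequentially"
  proof (rule eventually_sequentiallyI[of 1])
    fix l :: nat assume "1 \<le> l"
    then have "x - 1 / real l = (real l * x - 1) / real l" by (simp add: diff_divide_distrib)
    also have "\<dots> \<le> of_int \<lfloor>real l * x\<rfloor> / real l"
      using real_of_int_floor_gt_diff_one[of "real l * x"] by (intro divide_right_mono) auto
    finally show "x - 1 / real l \<le> of_int \<lfloor>real l * x\<rfloor> / real l" .
  qed
  show "eventually (\<lambda>l. of_int \<lfloor>real l * x\<rfloor> / real l \<le> x) sequentially"
  proof (rule eventually_sequentiallyI[of 1])
    fix l :: nat assume "1 \<le> l"
    then show "of_int \<lfloor>real l * x\<rfloor> / real l \<le> x"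
      using of_int_floor_le[of "real l * x"] by (simp add: field_simps)
  qed
  have "(\<lambda>l. x - 1 / real l) \<longlonglongrightarrow> x - 0" by (intro tendsto_intros lim_1_over_n)
  then show "(\<lambda>l. x - 1 / real l) \<longlonglongrightarrow> x" by simp
qed simp

definition grid_points :: "nat \<Rightarrow> (nat \<Rightarrow> real) set \<Rightarrow> nat \<Rightarrow> (nat \<Rightarrow> int) set" where
  "grid_points m Q l = {k \<in> {..<m} \<rightarrow>\<^sub>E UNIV. (\<lambda>i\<in>{..<m}. of_int (k i) / real l) \<in> Q}"

lemma finite_grid_points:
  assumes bd: "\<forall>t\<in>Q. \<forall>i<m. \<bar>t i\<bar> \<le> R" and l: "l > 0"
  shows "finite (grid_points m Q l)"
proof (rule finite_subset)
  show "grid_points m Q l \<subseteq> {..<m} \<rightarrow>\<^sub>E {- \<lceil>R * l\<rceil> .. \<lceil>R * l\<rceil>}"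
  proof (intro subsetI PiE_I)
    fix k i assume k: "k \<in> grid_points m Q l"
    show "k i = undefined" if "i \<notin> {..<m}" using k that by (auto simp: grid_points_def PiE_iff extensional_def)
    assume i: "i \<in> {..<m}"
    have "\<bar>of_int (k i) / real l\<bar> \<le> R" using bspec[OF bd, of "\<lambda>i\<in>{..<m}. of_int (k i) / real l"] k i by (simp add: grid_points_def)
    then have "\<bar>of_int (k i)\<bar> \<le> R * l" using l by (simp add: field_simps)
    then have "of_int (k i) \<le> R * l" "- of_int (k i) \<le> R * l" by linarith+
    then have "k i \<le> \<lceil>R * l\<rceil>" "- k i \<le> \<lceil>R * l\<rceil>" by linarith+
    then show "k i \<in> {- \<lceil>R * l\<rceil> .. \<lceil>R * l\<rceil>}" by simp
  qed
qed (intro finite_PiE; simp)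

text \<open>
  Rounding down to multiples of \<open>1 / l\<close> is constant on half-open cubes with edge \<open>1 / l\<close>, one
  for each grid point.
\<close>

lemma measure_grid_cells:
  assumes bd: "\<forall>t\<in>Q. \<forall>i<m. \<bar>t i\<bar> \<le> R" and l: "l > 0"
  shows "measure (PiM {..<m} (\<lambda>_. lborel)) {t \<in> space (PiM {..<m} (\<lambda>_. lborel)).
      (\<lambda>i\<in>{..<m}. of_int \<lfloor>real l * t i\<rfloor> / real l) \<in> Q} = real (card (grid_points m Q l)) / real l ^ m"
    and "{t \<in> space (PiM {..<m} (\<lambda>_. lborel)). (\<lambda>i\<in>{..<m}. of_int \<lfloor>real l * t i\<rfloor> / real l) \<in> Q}
      \<in> sets (PiM {..<m} (\<lambda>_. lborel))"
proof -
  interpret product_sigma_finite "\<lambda>_::nat. lborel :: real measure" by standard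
  let ?L = "PiM {..<m} (\<lambda>_. lborel :: real measure)"
  let ?A = "{t \<in> space ?L. (\<lambda>i\<in>{..<m}. of_int \<lfloor>real l * t i\<rfloor> / real l) \<in> Q}"
  define cell where "cell k = PiE {..<m} (\<lambda>i. {of_int (k i) / real l ..< (of_int (k i) + 1) / real l :: real})" for k :: "nat \<Rightarrow> int"
  have cell_iff: "t \<in> cell k \<longleftrightarrow> t \<in> {..<m} \<rightarrow>\<^sub>E UNIV \<and> (\<forall>i<m. \<lfloor>real l * t i\<rfloor> = k i)" for t k
    using l by (auto simp: cell_def PiE_iff floor_eq_iff field_simps)
  have cs: "cell k \<in> sets ?L" for k unfolding cell_def by (intro sets_PiM_I_finite) auto
  have em: "emeasure ?L (cell k) = ennreal ((1 / real l) ^ m)" for k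
  proof -
    have "emeasure ?L (cell k) = (\<Prod>i<m. emeasure lborel {of_int (k i) / real l ..< (of_int (k i) + 1) / real l})"
      unfolding cell_def by (rule emeasure_PiM) auto
    also have "\<dots> = (\<Prod>i<m. ennreal (1 / real l))"
      using l by (intro prod.cong refl) (simp add: divide_right_mono diff_divide_distrib[symmetric])
    also have "\<dots> = ennreal ((1 / real l) ^ m)" by (simp add: ennreal_power)
    finally show ?thesis .
  qed
  have fin: "finite (grid_points m Q l)" using finite_grid_points[OF bd l] .
  have A: "?A = (\<Union>k\<in>grid_points m Q l. cell k)"
  proof (intro equalityI subsetI)
    fix t assume t: "t \<in> ?A"
    let ?k = "\<lambda>i\<in>{..<m}. \<lfloor>real l * t i\<rfloor>"
    have "(\<lambda>i\<in>{..<m}. of_int (?k i) / real l) = (\<lambda>i\<in>{..<m}. of_int \<lfloor>real l * t i\<rfloor> / real l)" by auto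
    then have "?k \<in> grid_points m Q l" using t by (simp add: grid_points_def)
    moreover have "t \<in> cell ?k" using t by (simp add: cell_iff space_PiM)
    ultimately show "t \<in> (\<Union>k\<in>grid_points m Q l. cell k)" by blast
  next
    fix t assume "t \<in> (\<Union>k\<in>grid_points m Q l. cell k)"
    then obtain k where k: "k \<in> grid_points m Q l" "t \<in> cell k" by blast
    then have "(\<lambda>i\<in>{..<m}. of_int \<lfloor>real l * t i\<rfloor> / real l) = (\<lambda>i\<in>{..<m}. of_int (k i) / real l)"
      by (auto simp: cell_iff)
    then show "t \<in> ?A" using k by (simp add: cell_iff grid_points_def space_PiM)
  qed
  show "?A \<in> sets ?L" unfolding A using fin cs by auto
  have dis: "disjoint_family_on cell (grid_points m Q l)"
    unfolding disjoint_family_on_def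
  proof (intro ballI impI)
    fix k k' assume k: "k \<in> grid_points m Q l" "k' \<in> grid_points m Q l" "k \<noteq> k'"
    show "cell k \<inter> cell k' = {}"
    proof (rule ccontr)
      assume "cell k \<inter> cell k' \<noteq> {}"
      then obtain t where "t \<in> cell k" "t \<in> cell k'" by blast
      then have "\<forall>i<m. k i = k' i" by (auto simp: cell_iff)
      then have "k = k'"
        using k(1,2) by (intro PiE_ext[of k "{..<m}" "\<lambda>_. UNIV" k']) (auto simp: grid_points_def)
      then show False using k(3) by blast
    qed
  qed
  have "measure ?L ?A = (\<Sum>k\<in>grid_points m Q l. measure ?L (cell k))"
    unfolding A using fin cs em dis by (intro measure_finite_Union) auto
  also have "\<dots> = real (card (grid_points m Q l)) / real l ^ m"
    using l by (simp add: measure_def em power_divide)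
  finally show "measure ?L ?A = real (card (grid_points m Q l)) / real l ^ m" .
qed

text \<open>
  The quotient is the measure of the set of points whose rounding to the grid lies in \<open>Q\<close>.  The rounding
  converges to the identity, so these sets converge to \<open>Q\<close> off the bounding hyperplanes, which are
  null sets, and dominated convergence applies.
\<close>

theorem grid_count_tendsto_measure:
  fixes a :: "'f \<Rightarrow> nat \<Rightarrow> real" and b :: "'f \<Rightarrow> real" and \<F> :: "'f set" and m :: nat
  defines "Q \<equiv> {t \<in> {..<m} \<rightarrow>\<^sub>E UNIV. \<forall>f\<in>\<F>. (\<Sum>i<m. t i * a f i) \<le> b f}"
  assumes fin: "finite \<F>" and bd: "\<forall>t\<in>Q. \<forall>i<m. \<bar>t i\<bar> \<le> R"
  shows "(\<lambda>l. real (card (grid_points m Q l)) / real l ^ m) \<longlonglongrightarrow> measure (PiM {..<m} (\<lambda>_. lborel)) Q"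
proof -
  interpret product_sigma_finite "\<lambda>_::nat. lborel :: real measure" by standard
  let ?L = "PiM {..<m} (\<lambda>_. lborel :: real measure)"
  define fl where "fl l t = (\<lambda>i\<in>{..<m}. of_int \<lfloor>real l * t i\<rfloor> / real l)" for l t
  define A where "A l = {t \<in> space ?L. fl l t \<in> Q}" for l
  have sp: "space ?L = {..<m} \<rightarrow>\<^sub>E UNIV" by (simp add: space_PiM)
  have Qs: "Q \<in> sets ?L"
  proof -
    have "Q = {t \<in> space ?L. \<forall>f\<in>\<F>. (\<Sum>i<m. t i * a f i) \<le> b f}" by (simp add: Q_def sp)
    also have "\<dots> \<in> sets ?L" using fin by measurable
    finally show ?thesis .
  qed
  have As: "A (Suc l) \<in> sets ?L" "measure ?L (A (Suc l)) = real (card (grid_points m Q (Suc l))) / real (Suc l) ^ m" for l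
    using measure_grid_cells[OF bd, of "Suc l"] by (simp_all add: A_def fl_def)
  \<comment> \<open>Rounding moves each coordinate by at most 1.  Only scales \<open>Suc l\<close> are used, to avoid division by 0.\<close>
  define R' where "R' = \<bar>R\<bar> + 2"
  let ?B = "{..<m} \<rightarrow>\<^sub>E {- R' .. R'}"
  have emB: "emeasure ?L ?B = (\<Prod>i<m. emeasure lborel {- R' .. R'})" by (rule emeasure_PiM) auto
  have Bs: "?B \<in> sets ?L" by (intro sets_PiM_I_finite) auto
  have R'0: "R' \<ge> 0" by (simp add: R'_def)
  then have "emeasure lborel {- R' .. R'} = ennreal (2 * R')" by simp
  then have "emeasure ?L ?B = ennreal ((2 * R') ^ m)"
    unfolding emB using R'0 ennreal_power[of "2 * R'" m] by (simp del: ennreal_mult')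
  then have "emeasure ?L ?B < \<infinity>" by simp
  then have intB: "integrable ?L (indicator ?B :: _ \<Rightarrow> real)" using Bs by (simp add: integrable_real_indicator)
  have AB: "A (Suc l) \<subseteq> ?B" for l
  proof
    fix t assume t: "t \<in> A (Suc l)"
    have "t i \<in> {- R' .. R'}" if i: "i < m" for i
    proof -
      have "\<bar>fl (Suc l) t i\<bar> \<le> R" using bspec[OF bd, of "fl (Suc l) t"] t i by (simp add: A_def)
      moreover have "fl (Suc l) t i = of_int \<lfloor>real (Suc l) * t i\<rfloor> / real (Suc l)" using i by (simp add: fl_def)
      moreover have "of_int \<lfloor>real (Suc l) * t i\<rfloor> / real (Suc l) \<le> t i"
        using of_int_floor_le[of "real (Suc l) * t i"] by (simp add: field_simps del: of_nat_Suc)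
      moreover have "t i \<le> of_int \<lfloor>real (Suc l) * t i\<rfloor> / real (Suc l) + 1"
      proof -
        have "real (Suc l) * t i \<le> of_int \<lfloor>real (Suc l) * t i\<rfloor> + 1" by linarith
        also have "\<dots> \<le> of_int \<lfloor>real (Suc l) * t i\<rfloor> + real (Suc l)" by simp
        finally show ?thesis by (simp add: field_simps del: of_nat_Suc)
      qed
      ultimately show ?thesis unfolding R'_def atLeastAtMost_iff by - (rule conjI; linarith)
    qed
    then show "t \<in> ?B" using t by (auto simp: A_def sp PiE_iff)
  qed
  \<comment> \<open>An inequality whose coefficients are all 0 holds for all points or for none, so it does not bound \<open>Q\<close>.\<close>
  define Z where "Z = (\<Union>f\<in>{f\<in>\<F>. \<exists>j<m. a f j \<noteq> 0}. {t \<in> space ?L. (\<Sum>i<m. t i * a f i) = b f})"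
  have "Z \<in> null_sets ?L" unfolding Z_def
    using fin hyperplane_null_PiM by (intro null_sets_UN') (auto intro: countable_finite)
  then have ae: "AE t in ?L. t \<notin> Z" by (rule AE_not_in)
  have lim: "(\<lambda>l. indicator (A (Suc l)) t :: real) \<longlonglongrightarrow> indicator Q t" if t: "t \<in> space ?L" "t \<notin> Z" for t
  proof -
    have flt: "(\<lambda>l. \<Sum>i<m. fl l t i * a f i) \<longlonglongrightarrow> (\<Sum>i<m. t i * a f i)" for f
    proof (intro tendsto_sum tendsto_mult_right)
      fix i assume "i \<in> {..<m}"
      then show "(\<lambda>l. fl l t i) \<longlonglongrightarrow> t i" using floor_div_tendsto[of "t i"] by (simp add: fl_def)
    qed
    have "eventually (\<lambda>l. \<forall>f\<in>\<F>. (\<Sum>i<m. fl l t i * a f i) \<le> b f \<longleftrightarrow> (\<Sum>i<m. t i * a f i) \<le> b f) sequentially"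
    proof (rule eventually_ball_finite[OF fin], rule ballI)
      fix f assume f: "f \<in> \<F>"
      show "eventually (\<lambda>l. (\<Sum>i<m. fl l t i * a f i) \<le> b f \<longleftrightarrow> (\<Sum>i<m. t i * a f i) \<le> b f) sequentially"
      proof (cases "\<exists>j<m. a f j \<noteq> 0")
        case False
        then have "(\<Sum>i<m. fl l t i * a f i) = (\<Sum>i<m. t i * a f i)" for l by simp
        then show ?thesis by simp
      next
        case True
        then have ne: "(\<Sum>i<m. t i * a f i) \<noteq> b f" using t f by (auto simp: Z_def)
        show ?thesis
        proof (cases "(\<Sum>i<m. t i * a f i) < b f")
          case True
          from order_tendstoD(2)[OF flt True] show ?thesis by eventually_elim (use True in auto)
        next
          case False
          then have "(\<Sum>i<m. t i * a f i) > b f" using ne by simp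
          from order_tendstoD(1)[OF flt this] show ?thesis by eventually_elim (use False ne in auto)
        qed
      qed
    qed
    then have "eventually (\<lambda>l. fl l t \<in> Q \<longleftrightarrow> t \<in> Q) sequentially"
    proof eventually_elim
      case (elim l)
      have "fl l t \<in> {..<m} \<rightarrow>\<^sub>E UNIV" by (simp add: fl_def)
      then show ?case using elim t(1) unfolding Q_def sp by auto
    qed
    then have "eventually (\<lambda>l. fl (Suc l) t \<in> Q \<longleftrightarrow> t \<in> Q) sequentially"
      by (rule eventually_compose_filterlim[OF _ filterlim_Suc])
    then have "eventually (\<lambda>l. indicator (A (Suc l)) t = (indicator Q t :: real)) sequentially"
      by eventually_elim (use t in \<open>auto simp: A_def indicator_def\<close>)
    then show ?thesis by (rule tendsto_eventually)
  qed
  have "(\<lambda>l. \<integral>t. indicator (A (Suc l)) t \<partial>?L) \<longlonglongrightarrow> (\<integral>t. indicator Q t \<partial>?L :: real)"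
  proof (rule integral_dominated_convergence[where w = "indicator ?B"])
    show "AE t in ?L. (\<lambda>l. indicator (A (Suc l)) t :: real) \<longlonglongrightarrow> indicator Q t"
      using ae AE_space by eventually_elim (use lim in blast)
    show "AE t in ?L. norm (indicator (A (Suc l)) t :: real) \<le> indicator ?B t" for l
      using AB[of l] by (auto simp: indicator_def split: if_splits)
  qed (use As Qs intB in auto)
  then have "(\<lambda>l. measure ?L (A (Suc l))) \<longlonglongrightarrow> measure ?L Q"
    using As Qs sets.sets_into_space by (simp add: Int_absorb1 Int_absorb2)
  then have "(\<lambda>l. real (card (grid_points m Q (Suc l))) / real (Suc l) ^ m) \<longlonglongrightarrow> measure ?L Q"
    unfolding As(2) .
  then show ?thesis by (simp only: filterlim_sequentially_Suc[of "\<lambda>l. real (card (grid_points m Q l)) / real l ^ m"])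
qed

section \<open>The volume of a face as a leading coefficient\<close>

lemma dual_vectors:
  fixes us :: "'a::euclidean_space list"
  assumes "distinct us" "independent (set us)"
  obtains w where "\<And>i j. i < length us \<Longrightarrow> j < length us \<Longrightarrow> w i \<bullet> us ! j = (if i = j then 1 else 0)"
proof -
  obtain B where B: "set us \<subseteq> B" "independent B" "UNIV \<subseteq> span B"
    using maximal_independent_subset_extend[OF subset_UNIV assms(2)] by metis
  have spB: "span B = UNIV" using B(3) by (simp add: top.extremum_unique)
  define w where "w i = (THE u. \<forall>x. u \<bullet> x = representation B x (us ! i))" for i
  have w: "w i \<bullet> x = representation B x (us ! i)" for i x
    using theI'[OF linear_form_unique_inner[OF linear_representation[OF B(2) spB, of "us ! i"]]]
    unfolding w_def by blast
  show thesis
  proof (rule that)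
    fix i j assume ij: "i < length us" "j < length us"
    then have "us ! j \<in> B" using B(1) nth_mem by blast
    then show "w i \<bullet> us ! j = (if i = j then 1 else 0)"
      unfolding w by (simp add: representation_basis[OF B(2)] nth_eq_iff_index_eq[OF assms(1) ij])
  qed
qed

lemma sum_list_index:
  assumes "distinct us"
  shows "(\<Sum>b\<in>set us. f b) = (\<Sum>i<length us. f (us ! i))"
  using sum.reindex_bij_betw[OF bij_betw_nth[OF assms refl refl], of f] by simp

context simple_lattice_polytope begin

text \<open>
  The affine hull contains a vertex of the face together with a step along each edge of the face
  from that vertex, hence all points in the expansion \<open>vertex_expansion\<close>.
\<close>

lemma affine_hull_face:
  assumes J: "J \<in> Simp"
  shows "affine hull (face M P J) = {x. \<forall>j\<in>J. x \<bullet> \<nu> j = \<delta> j}"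
proof
  have "affine {x. \<forall>j\<in>J. x \<bullet> \<nu> j = \<delta> j}"
    unfolding affine_def by (auto simp: inner_add_left distrib_right[symmetric])
  then show "affine hull (face M P J) \<subseteq> {x. \<forall>j\<in>J. x \<bullet> \<nu> j = \<delta> j}"
    by (intro hull_minimal) (auto simp: face_def)
next
  let ?A = "affine hull (face M P J)"
  obtain I where I: "I \<in> Ver" "J \<subseteq> I" using Simp_extend[OF J] by blast
  have pA: "vtx I \<in> ?A" using Ver_subset_Simp(2)[OF I] by (rule hull_inc)
  have sub: "subspace ((\<lambda>x. x - vtx I) ` ?A)"
    by (rule affine_diffs_subspace_subtract[OF affine_affine_hull pA])
  have u: "\<upsilon> I i \<in> (\<lambda>x. x - vtx I) ` ?A" if i: "i \<in> I - J" for i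
  proof -
    obtain e where e: "e > 0" "vtx I - e *\<^sub>R \<upsilon> I i \<in> face M P J" using step_in_face[OF I i] by blast
    then have "vtx I - e *\<^sub>R \<upsilon> I i - vtx I \<in> (\<lambda>x. x - vtx I) ` ?A" by (intro imageI hull_inc)
    then have "(- 1 / e) *\<^sub>R (vtx I - e *\<^sub>R \<upsilon> I i - vtx I) \<in> (\<lambda>x. x - vtx I) ` ?A"
      by (rule subspace_scale[OF sub])
    then show ?thesis using e(1) by simp
  qed
  show "{x. \<forall>j\<in>J. x \<bullet> \<nu> j = \<delta> j} \<subseteq> ?A"
  proof
    fix x assume x: "x \<in> {x. \<forall>j\<in>J. x \<bullet> \<nu> j = \<delta> j}"
    have "(\<Sum>i\<in>I-J. (\<delta> i - x \<bullet> \<nu> i) *\<^sub>R \<upsilon> I i) \<in> (\<lambda>x. x - vtx I) ` ?A"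
      using u by (intro subspace_sum[OF sub] subspace_scale[OF sub])
    then have "- (\<Sum>i\<in>I-J. (\<delta> i - x \<bullet> \<nu> i) *\<^sub>R \<upsilon> I i) \<in> (\<lambda>x. x - vtx I) ` ?A"
      by (rule subspace_neg[OF sub])
    moreover have "x - vtx I = - (\<Sum>i\<in>I-J. (\<delta> i - x \<bullet> \<nu> i) *\<^sub>R \<upsilon> I i)"
      using vertex_expansion[OF I, of x] x by (simp add: algebra_simps)
    ultimately have "x - vtx I \<in> (\<lambda>x. x - vtx I) ` ?A" by simp
    then show "x \<in> ?A" by auto
  qed
qed

lemma M_ann_eq:
  assumes J: "J \<in> Simp" shows "M_ann M P J = {u \<in> M. \<forall>j\<in>J. u \<bullet> \<nu> j = 0}"
proof (intro equalityI subsetI)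
  fix u assume u: "u \<in> M_ann M P J"
  have "\<nu> j \<in> N_sat M P J" if "j \<in> J" for j
    unfolding N_sat_eq[OF J] using Simp_independent(4)[OF J] that by (auto intro: span_base)
  then show "u \<in> {u \<in> M. \<forall>j\<in>J. u \<bullet> \<nu> j = 0}" using u by (simp add: M_ann_def)
next
  fix u assume u: "u \<in> {u \<in> M. \<forall>j\<in>J. u \<bullet> \<nu> j = 0}"
  have "u \<bullet> w = 0" if "w \<in> N_sat M P J" for w
    using that unfolding N_sat_eq[OF J] by (intro inner_span_eq_0[of w "\<nu> ` J"]) (use u in auto)
  then show "u \<in> M_ann M P J" using u by (simp add: M_ann_def)
qed

lemma M_ann_subgroup: "J \<in> Simp \<Longrightarrow> add_subgroup (M_ann M P J)"
  using add_subgroup_closed(1,2)[OF M_facts(1)]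
  by (simp add: M_ann_eq add_subgroup_def inner_diff_left)

lemma M_ann_shift:
  assumes J: "J \<in> Simp" and p: "p \<in> M \<inter> affine hull (face M P J)"
  shows "(\<lambda>x. x - p) ` (M \<inter> affine hull (face M P J)) = M_ann M P J"
proof (intro equalityI subsetI)
  fix u assume "u \<in> M_ann M P J"
  then have "u + p \<in> M \<inter> affine hull (face M P J)"
    using p add_subgroup_closed(4)[OF M_facts(1)]
    unfolding M_ann_eq[OF J] affine_hull_face[OF J] by (auto simp: inner_add_left)
  moreover have "u = (u + p) - p" by simp
  ultimately show "u \<in> (\<lambda>x. x - p) ` (M \<inter> affine hull (face M P J))" by (rule rev_image_eqI)
next
  fix u assume "u \<in> (\<lambda>x. x - p) ` (M \<inter> affine hull (face M P J))"
  then show "u \<in> M_ann M P J"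
    using p add_subgroup_closed(2)[OF M_facts(1)]
    unfolding M_ann_eq[OF J] affine_hull_face[OF J] by (auto simp: inner_diff_left)
qed

lemma dual_orthogonal_expansion:
  assumes I: "I \<in> Ver" "J \<subseteq> I" and y: "\<And>j. j \<in> J \<Longrightarrow> y \<bullet> \<nu> j = 0"
  shows "y = (\<Sum>i\<in>I-J. (y \<bullet> \<nu> i) *\<^sub>R \<upsilon> I i)"
proof -
  have "(\<Sum>i\<in>I. (y \<bullet> \<nu> i) *\<^sub>R \<upsilon> I i) = (\<Sum>i\<in>I-J. (y \<bullet> \<nu> i) *\<^sub>R \<upsilon> I i)"
    using y Ver_facts(7)[OF I(1)] by (intro sum.mono_neutral_right) auto
  then show ?thesis using dual_expansion[OF I(1), of y] by simp
qed

text \<open>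
  A common factor brings the \<open>n - |J|\<close> independent vectors \<open>\<upsilon> I i\<close>, \<open>i \<in> I - J\<close>, into \<open>M\<close>, so the annihilator of the
  normals, which they span, is spanned by lattice vectors.
\<close>

lemma M_ann_basis_facts:
  assumes J: "J \<in> Simp" and us: "lattice_basis (M_ann M P J) us"
  shows "span (set us) = {y. \<forall>j\<in>J. y \<bullet> \<nu> j = 0}" "length us = DIM('a) - card J"
proof -
  let ?Y = "{y. \<forall>j\<in>J. y \<bullet> \<nu> j = 0}"
  have us': "distinct us" "independent (set us)" "M_ann M P J = int_span (set us)"
    using us by (auto simp: lattice_basis_def)
  obtain I where I: "I \<in> Ver" "J \<subseteq> I" using Simp_extend[OF J] by blast
  have sY: "subspace ?Y" by (auto simp: subspace_def inner_add_left)
  obtain K :: nat where K: "K > 0" "\<And>w. w \<in> N \<Longrightarrow> real K *\<^sub>R w \<in> N_gen M P I"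
    using Ver_multiple[OF I(1)] by blast
  have Ku: "real K *\<^sub>R \<upsilon> I i \<in> M_ann M P J" if i: "i \<in> I - J" for i
  proof -
    have "(real K *\<^sub>R \<upsilon> I i) \<bullet> w \<in> \<int>" if w: "w \<in> N" for w
    proof -
      have "dual_basis M P I i (real K *\<^sub>R w) \<in> \<int>"
        using K(2)[OF w] N_gen_iff[OF Ver_facts(13)[OF I(1)]] i by blast
      then show ?thesis using dual_inner[OF I(1), of i "real K *\<^sub>R w"] by simp
    qed
    then have "real K *\<^sub>R \<upsilon> I i \<in> M" using M_facts(3) by blast
    moreover have "(real K *\<^sub>R \<upsilon> I i) \<bullet> \<nu> j = 0" if "j \<in> J" for j
    proof -
      have "j \<in> I" "i \<noteq> j" using that i I(2) by auto
      then show ?thesis using dual_normal[OF I(1), of i j] i by simp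
    qed
    ultimately show ?thesis by (simp add: M_ann_eq[OF J])
  qed
  have usp: "\<upsilon> I i \<in> span (set us)" if "i \<in> I - J" for i
  proof -
    have "real K *\<^sub>R \<upsilon> I i \<in> span (set us)"
      using Ku[OF that] us'(3) int_span_subset_span by blast
    then have "(1 / real K) *\<^sub>R (real K *\<^sub>R \<upsilon> I i) \<in> span (set us)" by (rule span_scale)
    then show ?thesis using K(1) by simp
  qed
  show sp: "span (set us) = ?Y"
  proof
    have "set us \<subseteq> M_ann M P J" unfolding us'(3) by (rule int_span_superset)
    then have "set us \<subseteq> ?Y" unfolding M_ann_eq[OF J] by blast
    then show "span (set us) \<subseteq> ?Y" by (rule span_minimal[OF _ sY])
    show "?Y \<subseteq> span (set us)"
    proof
      fix y assume y: "y \<in> ?Y"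
      have "(\<Sum>i\<in>I-J. (y \<bullet> \<nu> i) *\<^sub>R \<upsilon> I i) \<in> span (set us)" using usp by (intro span_sum span_scale)
      moreover have "y = (\<Sum>i\<in>I-J. (y \<bullet> \<nu> i) *\<^sub>R \<upsilon> I i)"
        by (rule dual_orthogonal_expansion[OF I]) (use y in blast)
      ultimately show "y \<in> span (set us)" by argo
    qed
  qed
  let ?U = "\<upsilon> I ` (I - J)"
  have finI: "finite (I - J)" using Ver_facts(7)[OF I(1)] by simp
  have inj: "inj_on (\<upsilon> I) (I - J)"
  proof (rule inj_onI)
    fix i j assume ij: "i \<in> I - J" "j \<in> I - J" "\<upsilon> I i = \<upsilon> I j"
    have "\<upsilon> I i \<bullet> \<nu> i = 1" "\<upsilon> I j \<bullet> \<nu> i = (if j = i then 1 else 0)"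
      using dual_normal[OF I(1), of i i] dual_normal[OF I(1), of j i] ij(1,2) by auto
    then show "i = j" using ij(3) by (metis zero_neq_one)
  qed
  have indU: "independent ?U"
  proof (rule independent_if_scalars_zero)
    show "finite ?U" using finI by simp
    fix f u assume f: "(\<Sum>x\<in>?U. f x *\<^sub>R x) = 0" "u \<in> ?U"
    from f(2) obtain j where j: "j \<in> I - J" "u = \<upsilon> I j" by (rule imageE) blast
    have "(\<Sum>i\<in>I-J. f (\<upsilon> I i) *\<^sub>R \<upsilon> I i) = 0" using f(1) unfolding sum.reindex[OF inj] by (simp only: o_def)
    then have "(\<Sum>i\<in>I-J. f (\<upsilon> I i) *\<^sub>R \<upsilon> I i) \<bullet> \<nu> j = 0" by (simp only: inner_zero_left)
    moreover have "(\<Sum>i\<in>I-J. f (\<upsilon> I i) *\<^sub>R \<upsilon> I i) \<bullet> \<nu> j = (\<Sum>i\<in>I-J. if i = j then f (\<upsilon> I i) else 0)"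
      unfolding inner_sum_left using dual_normal[OF I(1), of _ j] j by (intro sum.cong) simp_all
    ultimately show "f u = 0" using j finI by simp
  qed
  have "?Y = span ?U"
  proof
    show "span ?U \<subseteq> ?Y"
    proof (rule span_minimal[OF _ sY], intro image_subsetI CollectI ballI)
      fix i j assume ij: "i \<in> I - J" "j \<in> J"
      then have "j \<in> I" "i \<noteq> j" using I(2) by auto
      then show "\<upsilon> I i \<bullet> \<nu> j = 0" using dual_normal[OF I(1), of i j] ij by simp
    qed
    show "?Y \<subseteq> span ?U"
    proof
      fix y assume y: "y \<in> ?Y"
      have "(\<Sum>i\<in>I-J. (y \<bullet> \<nu> i) *\<^sub>R \<upsilon> I i) \<in> span ?U" by (intro span_sum span_scale span_base) auto
      moreover have "y = (\<Sum>i\<in>I-J. (y \<bullet> \<nu> i) *\<^sub>R \<upsilon> I i)"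
        by (rule dual_orthogonal_expansion[OF I]) (use y in blast)
      ultimately show "y \<in> span ?U" by argo
    qed
  qed
  then have "dim (span (set us)) = dim (span ?U)" using sp by (simp only:)
  then have "card (set us) = card ?U"
    unfolding dim_span dim_eq_card_independent[OF us'(2)] dim_eq_card_independent[OF indU] .
  also have "\<dots> = card I - card J"
    unfolding card_image[OF inj] by (rule card_Diff_subset[OF Simp_finite[OF J] I(2)])
  finally show "length us = DIM('a) - card J"
    unfolding distinct_card[OF us'(1)] Ver_facts(4)[OF I(1)] .
qed

lemma M_ann_basis_exists:
  assumes "J \<in> Simp" shows "\<exists>us. lattice_basis (M_ann M P J) us"
proof -
  have "M_ann M P J \<subseteq> M" by (auto simp: M_ann_def)
  from full_lattice_subgroup_basis[OF full_M M_ann_subgroup[OF assms] this] show ?thesis by blast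
qed

lemma card_face_points_grid:
  assumes J: "J \<in> Simp" and us: "lattice_basis (M_ann M P J) us"
    and p: "p \<in> M \<inter> affine hull (face M P J)" and l: "l > 0"
  defines "Q \<equiv> {t \<in> {..<length us} \<rightarrow>\<^sub>E UNIV. p + (\<Sum>i<length us. t i *\<^sub>R us ! i) \<in> face M P J}"
  shows "card (grid_points (length us) Q l) = card (face_points J l)"
proof -
  have us': "distinct us" "independent (set us)" "M_ann M P J = int_span (set us)"
    using us by (auto simp: lattice_basis_def)
  let ?m = "length us"
  let ?g = "\<lambda>k. real l *\<^sub>R p + (\<Sum>i<?m. real_of_int (k i) *\<^sub>R us ! i)"
  have pM: "p \<in> M" and pJ: "\<And>j. j \<in> J \<Longrightarrow> p \<bullet> \<nu> j = \<delta> j"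
    using p unfolding affine_hull_face[OF J] by auto
  obtain w where w: "\<And>i j. i < ?m \<Longrightarrow> j < ?m \<Longrightarrow> w i \<bullet> us ! j = (if i = j then 1 else 0)"
    using dual_vectors[OF us'(1,2)] by blast
  have coord: "w j \<bullet> (\<Sum>i<?m. c i *\<^sub>R us ! i) = c j" if "j < ?m" for c j
  proof -
    have "w j \<bullet> (\<Sum>i<?m. c i *\<^sub>R us ! i) = (\<Sum>i<?m. if i = j then c i else 0)"
      unfolding inner_sum_right using w that by (intro sum.cong) auto
    then show ?thesis using that by simp
  qed
  have int_comb: "(\<Sum>i<?m. real_of_int (k i) *\<^sub>R us ! i) \<in> M_ann M P J" for k
    unfolding us'(3) by (intro add_subgroup_sum[OF add_subgroup_int_span]
        add_subgroup_int_scale[OF add_subgroup_int_span] subsetD[OF int_span_superset]) auto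
  have scale: "(1 / real l) *\<^sub>R ?g k = p + (\<Sum>i<?m. (real_of_int (k i) / real l) *\<^sub>R us ! i)" for k
    using l by (simp add: scaleR_add_right scaleR_sum_right)
  have memQ: "(\<lambda>i\<in>{..<?m}. real_of_int (k i) / real l) \<in> Q \<longleftrightarrow> (1 / real l) *\<^sub>R ?g k \<in> face M P J" for k
    unfolding scale Q_def by simp
  have "bij_betw ?g (grid_points ?m Q l) (face_points J l)"
    unfolding bij_betw_def
  proof
    show "inj_on ?g (grid_points ?m Q l)"
    proof (rule inj_onI)
      fix k k' assume k: "k \<in> grid_points ?m Q l" "k' \<in> grid_points ?m Q l" "?g k = ?g k'"
      have "k i = k' i" if "i < ?m" for i
        using arg_cong[OF k(3), of "\<lambda>v. w i \<bullet> (v - real l *\<^sub>R p)"] coord[OF that] by simp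
      then show "k = k'" using k(1,2) by (intro PiE_ext[of k "{..<?m}" "\<lambda>_. UNIV" k']) (auto simp: grid_points_def)
    qed
    show "?g ` grid_points ?m Q l = face_points J l"
    proof (intro equalityI subsetI)
      fix x assume "x \<in> ?g ` grid_points ?m Q l"
      then obtain k where k: "k \<in> grid_points ?m Q l" "x = ?g k" by blast
      have "x \<in> M" unfolding k(2)
        using int_comb[of k] unfolding M_ann_eq[OF J]
        by (intro add_subgroup_closed(4)[OF M_facts(1)] add_subgroup_nat_scale[OF M_facts(1) pM]) auto
      moreover have "(1 / real l) *\<^sub>R x \<in> face M P J"
        using k memQ[of k] by (simp add: grid_points_def)
      ultimately show "x \<in> face_points J l" by (simp add: face_points_def)
    next
      fix x assume x: "x \<in> face_points J l"
      then have xM: "x \<in> M" and xf: "(1 / real l) *\<^sub>R x \<in> face M P J" by (auto simp: face_points_def)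
      have "x \<bullet> \<nu> j = real l * \<delta> j" if "j \<in> J" for j
        using xf that l by (auto simp: face_def field_simps)
      then have "x - real l *\<^sub>R p \<in> M_ann M P J"
        unfolding M_ann_eq[OF J]
        using add_subgroup_closed(2)[OF M_facts(1) xM add_subgroup_nat_scale[OF M_facts(1) pM]] pJ
        by (auto simp: inner_diff_left)
      then obtain c where c: "x - real l *\<^sub>R p = (\<Sum>b\<in>set us. real_of_int (c b) *\<^sub>R b)"
        unfolding us'(3) int_span_finite[OF finite_set] by blast
      define k where "k = (\<lambda>i\<in>{..<?m}. c (us ! i))"
      have "x - real l *\<^sub>R p = (\<Sum>i<?m. real_of_int (k i) *\<^sub>R us ! i)"
        unfolding c sum_list_index[OF us'(1)] k_def by (intro sum.cong) auto
      then have gk: "?g k = x" by (simp add: algebra_simps)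
      then have "k \<in> grid_points ?m Q l"
        using memQ[of k] xf by (simp add: grid_points_def k_def)
      then show "x \<in> ?g ` grid_points ?m Q l" using gk by blast
    qed
  qed
  then show ?thesis by (rule bij_betw_same_card)
qed

text \<open>
  In the coordinates given by \<open>p\<close> and \<open>us\<close> the face is bounded and defined by the inequalities of the
  facets of \<open>P\<close>, and lattice points of \<open>l P\<^sub>J\<close> become points of the grid with mesh \<open>1 / l\<close>.
\<close>

theorem face_points_tendsto_volume:
  assumes J: "J \<in> Simp" and us: "lattice_basis (M_ann M P J) us"
    and p: "p \<in> M \<inter> affine hull (face M P J)"
  defines "Q \<equiv> {t \<in> {..<length us} \<rightarrow>\<^sub>E UNIV. p + (\<Sum>i<length us. t i *\<^sub>R us ! i) \<in> face M P J}"
  shows "(\<lambda>l. real (card (face_points J l)) / real l ^ length us) \<longlonglongrightarrow>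
    measure (PiM {..<length us} (\<lambda>_. lborel)) Q"
proof -
  let ?m = "length us"
  have us': "distinct us" "independent (set us)" "M_ann M P J = int_span (set us)"
    using us by (auto simp: lattice_basis_def)
  have pJ: "\<And>j. j \<in> J \<Longrightarrow> p \<bullet> \<nu> j = \<delta> j"
    using p unfolding affine_hull_face[OF J] by auto
  have usJ: "us ! i \<bullet> \<nu> j = 0" if "i < ?m" "j \<in> J" for i j
    using M_ann_basis_facts(1)[OF J us] span_base[OF nth_mem[OF that(1)]] that(2) by blast
  have Q: "Q = {t \<in> {..<?m} \<rightarrow>\<^sub>E UNIV. \<forall>F\<in>facets P. (\<Sum>i<?m. t i * (us ! i \<bullet> \<nu> F)) \<le> \<delta> F - p \<bullet> \<nu> F}"
  proof -
    have "p + (\<Sum>i<?m. t i *\<^sub>R us ! i) \<in> face M P J \<longleftrightarrow>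
        (\<forall>F\<in>facets P. (\<Sum>i<?m. t i * (us ! i \<bullet> \<nu> F)) \<le> \<delta> F - p \<bullet> \<nu> F)" for t
    proof -
      have "(p + (\<Sum>i<?m. t i *\<^sub>R us ! i)) \<bullet> \<nu> j = \<delta> j" if "j \<in> J" for j
        using usJ that pJ by (simp add: inner_add_left inner_sum_left)
      then have "p + (\<Sum>i<?m. t i *\<^sub>R us ! i) \<in> face M P J \<longleftrightarrow> p + (\<Sum>i<?m. t i *\<^sub>R us ! i) \<in> P"
        by (simp add: face_def)
      also have "\<dots> \<longleftrightarrow> (\<forall>F\<in>facets P. (p + (\<Sum>i<?m. t i *\<^sub>R us ! i)) \<bullet> \<nu> F \<le> \<delta> F)"
        using P_eq_halfspaces by blast
      also have "\<dots> \<longleftrightarrow> (\<forall>F\<in>facets P. (\<Sum>i<?m. t i * (us ! i \<bullet> \<nu> F)) \<le> \<delta> F - p \<bullet> \<nu> F)"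
        by (simp add: inner_add_left inner_sum_left algebra_simps)
      finally show ?thesis .
    qed
    then show ?thesis unfolding Q_def by blast
  qed
  obtain w where w: "\<And>i j. i < ?m \<Longrightarrow> j < ?m \<Longrightarrow> w i \<bullet> us ! j = (if i = j then 1 else 0)"
    using dual_vectors[OF us'(1,2)] by blast
  obtain R where R: "\<And>y. y \<in> P \<Longrightarrow> norm y \<le> R"
    using compact_imp_bounded[OF compact_P] bounded_iff by blast
  let ?R = "(\<bar>R\<bar> + norm p) * (\<Sum>i<?m. norm (w i))"
  have bd: "\<forall>t\<in>Q. \<forall>i<?m. \<bar>t i\<bar> \<le> ?R"
  proof (intro ballI allI impI)
    fix t i assume t: "t \<in> Q" and i: "i < ?m"
    let ?y = "p + (\<Sum>i<?m. t i *\<^sub>R us ! i)"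
    have y: "norm ?y \<le> \<bar>R\<bar>" using R[of ?y] t by (auto simp: Q_def face_def)
    have "w i \<bullet> (?y - p) = (\<Sum>k<?m. w i \<bullet> (t k *\<^sub>R us ! k))" by (simp add: inner_sum_right)
    also have "\<dots> = (\<Sum>k<?m. if k = i then t k else 0)"
      using w i by (intro sum.cong) auto
    finally have "w i \<bullet> (?y - p) = (\<Sum>k<?m. if k = i then t k else 0)" .
    then have "t i = w i \<bullet> (?y - p)" using i by simp
    then have "\<bar>t i\<bar> \<le> norm (w i) * norm (?y - p)" by (simp only: Cauchy_Schwarz_ineq2)
    also have "\<dots> \<le> (\<Sum>i<?m. norm (w i)) * (\<bar>R\<bar> + norm p)"
      using i norm_triangle_ineq4[of ?y p] y by (intro mult_mono member_le_sum sum_nonneg) auto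
    finally show "\<bar>t i\<bar> \<le> ?R" by (simp add: mult.commute)
  qed
  have "(\<lambda>l. real (card (grid_points ?m Q l)) / real l ^ ?m) \<longlonglongrightarrow> measure (PiM {..<?m} (\<lambda>_. lborel)) Q"
    unfolding Q by (rule grid_count_tendsto_measure[OF finite_facets bd[unfolded Q]])
  moreover have "eventually (\<lambda>l. real (card (grid_points ?m Q l)) / real l ^ ?m = real (card (face_points J l)) / real l ^ ?m) sequentially"
    by (rule eventually_sequentiallyI[of 1]) (use card_face_points_grid[OF J us p] in \<open>simp add: Q_def\<close>)
  ultimately show ?thesis by (rule Lim_transform_eventually)
qed

lemma poly_leading_limit:
  fixes b :: "nat \<Rightarrow> complex"
  shows "(\<lambda>l. (\<Sum>q\<le>m. b q * of_nat l ^ q) / of_nat l ^ m) \<longlonglongrightarrow> b m"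
proof -
  have t: "(\<lambda>l. b q * (1 / of_nat l) ^ (m - q)) \<longlonglongrightarrow> (if q = m then b m else 0)" if "q \<in> {..m}" for q
  proof (cases "q = m")
    case False
    have "(\<lambda>l. b q * (1 / of_nat l) ^ (m - q)) \<longlonglongrightarrow> b q * 0 ^ (m - q)"
      by (intro tendsto_intros lim_1_over_n)
    moreover have "(0::complex) ^ (m - q) = 0" using False that by simp
    ultimately show ?thesis using False by simp
  qed simp
  have "(\<lambda>l. \<Sum>q\<le>m. b q * (1 / of_nat l) ^ (m - q)) \<longlonglongrightarrow> (\<Sum>q\<le>m. if q = m then b m else 0)"
    by (rule tendsto_sum) (rule t)
  moreover have "eventually (\<lambda>l. (\<Sum>q\<le>m. b q * (1 / of_nat l) ^ (m - q)) = (\<Sum>q\<le>m. b q * of_nat l ^ q) / of_nat l ^ m) sequentially"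
  proof (rule eventually_sequentiallyI[of 1])
    fix l :: nat assume l: "1 \<le> l"
    have "b q * (1 / of_nat l) ^ (m - q) = b q * of_nat l ^ q / of_nat l ^ m" if "q \<le> m" for q
      using l that by (simp add: power_diff power_divide field_simps)
    then show "(\<Sum>q\<le>m. b q * (1 / of_nat l) ^ (m - q)) = (\<Sum>q\<le>m. b q * of_nat l ^ q) / of_nat l ^ m"
      by (simp add: sum_divide_distrib)
  qed
  ultimately have "(\<lambda>l. (\<Sum>q\<le>m. b q * of_nat l ^ q) / of_nat l ^ m) \<longlonglongrightarrow> (\<Sum>q\<le>m. if q = m then b m else 0)"
    by (rule Lim_transform_eventually)
  then show ?thesis by simp
qed

text \<open>
  The number of lattice points in \<open>l P\<^sub>J\<close>, divided by \<open>l\<close> to the power of the dimension, tends to the leading coefficient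
  of a polynomial.  It also tends to the measure that defines the volume, for every choice of the origin and of the basis
  in \<open>lattice_volume\<close>.
\<close>

theorem lattice_volume_face:
  fixes \<phi> :: "'a \<Rightarrow> complex"
  assumes J: "J \<in> Simp" and \<phi>: "linear \<phi>" "\<And>x. Re (\<phi> x) = x \<bullet> \<zeta>" and g: "generic \<zeta>"
  shows "of_real (lattice_volume M (face M P J)) = ehrhart_coeff J \<phi> (DIM('a) - card J)"
proof -
  let ?A = "M \<inter> affine hull (face M P J)"
  let ?P = "\<lambda>r. \<exists>p us. p \<in> ?A \<and> lattice_basis ((\<lambda>x. x - p) ` ?A) us \<and>
     r = measure (Pi\<^sub>M {..<length us} (\<lambda>_. lborel))
           {t \<in> {..<length us} \<rightarrow>\<^sub>E UNIV. p + (\<Sum>i<length us. t i *\<^sub>R us ! i) \<in> face M P J}"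
  obtain I where I: "I \<in> Ver" "J \<subseteq> I" using Simp_extend[OF J] by blast
  have pA: "vtx I \<in> ?A" using Ver_facts(10)[OF I(1)] hull_inc[OF Ver_subset_Simp(2)[OF I]] by blast
  obtain us where us: "lattice_basis (M_ann M P J) us" using M_ann_basis_exists[OF J] by blast
  have ex: "\<exists>r. ?P r"
    using pA us M_ann_shift[OF J pA] by metis
  have "?P (lattice_volume M (face M P J))"
    unfolding lattice_volume_def by (rule someI_ex[OF ex])
  then obtain p us where p: "p \<in> ?A" and us: "lattice_basis ((\<lambda>x. x - p) ` ?A) us"
    and v: "lattice_volume M (face M P J) = measure (Pi\<^sub>M {..<length us} (\<lambda>_. lborel))
           {t \<in> {..<length us} \<rightarrow>\<^sub>E UNIV. p + (\<Sum>i<length us. t i *\<^sub>R us ! i) \<in> face M P J}" by blast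
  have us': "lattice_basis (M_ann M P J) us" using us M_ann_shift[OF J p] by simp
  let ?m = "DIM('a) - card J"
  have len: "length us = ?m" using M_ann_basis_facts(2)[OF J us'] .
  have "(\<lambda>l. real (card (face_points J l)) / real l ^ ?m) \<longlonglongrightarrow> lattice_volume M (face M P J)"
    using face_points_tendsto_volume[OF J us' p] unfolding v len .
  then have "(\<lambda>l. complex_of_real (real (card (face_points J l)) / real l ^ ?m)) \<longlonglongrightarrow> of_real (lattice_volume M (face M P J))"
    by (rule tendsto_of_real)
  moreover have "eventually (\<lambda>l. complex_of_real (real (card (face_points J l)) / real l ^ ?m) =
      (\<Sum>q\<le>?m. ehrhart_coeff J \<phi> q * of_nat l ^ q) / of_nat l ^ ?m) sequentially"
  proof (rule eventually_sequentiallyI[of 1])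
    fix l :: nat assume "1 \<le> l"
    then have l: "l > 0" by simp
    show "complex_of_real (real (card (face_points J l)) / real l ^ ?m) =
      (\<Sum>q\<le>?m. ehrhart_coeff J \<phi> q * of_nat l ^ q) / of_nat l ^ ?m"
      unfolding card_face_points[OF J l \<phi> g, symmetric] by simp
  qed
  ultimately have "(\<lambda>l. (\<Sum>q\<le>?m. ehrhart_coeff J \<phi> q * of_nat l ^ q) / of_nat l ^ ?m) \<longlonglongrightarrow> of_real (lattice_volume M (face M P J))"
    by (rule Lim_transform_eventually)
  then show ?thesis using poly_leading_limit LIMSEQ_unique by blast
qed

end

section \<open>Wedge products and homogeneous forms\<close>

lemma pairing_add_left: "pairing (u + v) w = pairing u w + pairing v w"
  by (simp add: pairing_def distrib_right sum.distrib)

lemma pairing_scaleR_left: "pairing (c *\<^sub>R u) w = of_real c * pairing u w"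
  by (simp add: pairing_def sum_distrib_left mult.assoc)

lemma pairing_add_right: "pairing u (v + w) = pairing u v + pairing u w"
  by (simp add: pairing_def distrib_left sum.distrib)

lemma pairing_scale_right: "pairing u (c *s w) = c * pairing u w"
  by (simp add: pairing_def sum_distrib_left algebra_simps)

lemma pairing_zero_right: "pairing u 0 = 0"
  by (simp add: pairing_def)

lemma pairing_sum_right: "pairing u (\<Sum>a\<in>A. f a) = (\<Sum>a\<in>A. pairing u (f a))"
  by (induction A rule: infinite_finite_induct) (auto simp: pairing_add_right pairing_zero_right)

lemma linear_pairing: "linear (\<lambda>u. pairing u w)"
proof (rule linearI)
  show "pairing (u + v) w = pairing u w + pairing v w" for u v by (rule pairing_add_left)
  show "pairing (c *\<^sub>R u) w = c *\<^sub>R pairing u w" for c u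
    unfolding pairing_scaleR_left by (simp only: scaleR_conv_of_real)
qed

lemma pairing_zero_left: "pairing 0 w = 0"
  by (simp add: pairing_def)

abbreviation pairing_mat :: "(real ^ 'n) list \<Rightarrow> (complex ^ 'n) list \<Rightarrow> complex Matrix.mat" where
  "pairing_mat as ws \<equiv> Matrix.mat (length as) (length as) (\<lambda>(i, j). pairing (as ! i) (ws ! j))"

text \<open>
  As the determinant of a matrix whose size is a number, the wedge product is open to Laplace
  expansion and to multiplicativity.
\<close>

lemma wedge_det: "wedge as ws = Determinant.det (pairing_mat as ws)"
proof -
  have "(\<Prod>i<length as. pairing (as ! i) (ws ! p i)) = (\<Prod>i = 0..<length as. pairing_mat as ws $$ (i, p i))"
    if "p permutes {..<length as}" for p
  proof (rule prod.cong)
    fix i assume "i \<in> {0..<length as}"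
    then have "i < length as" "p i < length as" using permutes_in_image[OF that, of i] by auto
    then show "pairing (as ! i) (ws ! p i) = pairing_mat as ws $$ (i, p i)" by simp
  qed auto
  then have "wedge as ws = (\<Sum>p | p permutes {..<length as}. of_int (sign p) *
      (\<Prod>i = 0..<length as. pairing_mat as ws $$ (i, p i)))"
    unfolding wedge_def by (intro sum.cong refl arg_cong2[where f = times]) simp
  also have "\<dots> = Determinant.det (pairing_mat as ws)"
    unfolding Determinant.det_def by (simp only: dim_row_mat dim_col_mat simp_thms if_True atLeast0LessThan)
  finally show ?thesis .
qed

text \<open>
  A generalised cross product within the span of \<open>ws\<close>: its coefficients are the cofactors along the first
  row, which do not depend on the entries of that row, here filled with 0.
\<close>

definition kernel_vector :: "(real ^ 'n) list \<Rightarrow> (complex ^ 'n) list \<Rightarrow> complex ^ 'n" where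
  "kernel_vector \<omega> ws = (\<Sum>m<Suc (length \<omega>). cofactor (pairing_mat (0 # \<omega>) ws) 0 m *s ws ! m)"

lemma wedge_Cons: "wedge (u # \<omega>) ws = pairing u (kernel_vector \<omega> ws)"
proof -
  let ?r = "Suc (length \<omega>)" and ?A = "pairing_mat (u # \<omega>) ws" and ?Z = "pairing_mat (0 # \<omega>) ws"
  have cof: "cofactor ?A 0 m = cofactor ?Z 0 m" if "m < ?r" for m
  proof -
    have "mat_delete ?A 0 m = mat_delete ?Z 0 m"
      by (rule eq_matI) (auto simp: mat_delete_def)
    then show ?thesis by (simp add: cofactor_def)
  qed
  have "wedge (u # \<omega>) ws = (\<Sum>m<?r. ?A $$ (0, m) * cofactor ?A 0 m)"
    unfolding wedge_det by (rule laplace_expansion_row) auto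
  also have "\<dots> = (\<Sum>m<?r. pairing u (ws ! m) * cofactor ?Z 0 m)"
  proof (rule sum.cong[OF refl])
    fix m assume "m \<in> {..<?r}"
    then have m: "m < ?r" by simp
    show "?A $$ (0, m) * cofactor ?A 0 m = pairing u (ws ! m) * cofactor ?Z 0 m"
      unfolding cof[OF m] using m by simp
  qed
  also have "\<dots> = pairing u (kernel_vector \<omega> ws)"
    unfolding kernel_vector_def pairing_sum_right pairing_scale_right by (simp add: mult.commute)
  finally show ?thesis .
qed

text \<open>The pairing is a determinant with two equal rows.\<close>

lemma pairing_kernel_vector: "v \<in> set \<omega> \<Longrightarrow> pairing v (kernel_vector \<omega> ws) = 0"
proof -
  assume "v \<in> set \<omega>"
  then obtain i where i: "i < length \<omega>" "\<omega> ! i = v" by (auto simp: in_set_conv_nth)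
  let ?A = "pairing_mat (v # \<omega>) ws"
  have "Determinant.det ?A = 0"
  proof (rule det_identical_rows)
    show "?A \<in> carrier_mat (Suc (length \<omega>)) (Suc (length \<omega>))" by auto
    show "Matrix.row ?A 0 = Matrix.row ?A (Suc i)" using i by (intro eq_vecI) auto
  qed (use i in auto)
  then show ?thesis unfolding wedge_Cons[symmetric] wedge_det .
qed

lemma pairing_span_zero:
  assumes "v \<in> span S" "\<And>s. s \<in> S \<Longrightarrow> pairing s w = 0"
  shows "pairing v w = 0"
  using assms(1)
  by (induction rule: span_induct_alt) (simp_all add: pairing_add_left pairing_scaleR_left assms(2) pairing_zero_left)

lemma wedge_frame_change:
  assumes len: "length as = r" and ws': "\<And>j. j < r \<Longrightarrow> ws' ! j = (\<Sum>m<r. c j m *s ws ! m)"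
  shows "wedge as ws' = Determinant.det (Matrix.mat r r (\<lambda>(m, j). c j m)) * wedge as ws"
proof -
  let ?C = "Matrix.mat r r (\<lambda>(m, j). c j m)"
  have "pairing_mat as ws' = pairing_mat as ws * ?C"
    by (rule eq_matI) (auto simp: len ws' scalar_prod_def pairing_sum_right pairing_scale_right atLeast0LessThan mult.commute)
  then show ?thesis unfolding wedge_det
    using det_mult[of "pairing_mat as ws" r ?C] by (simp add: len mult.commute)
qed

text \<open>Frames of the same plane differ by a square matrix, and its determinant is the factor \<open>D\<close>.\<close>

lemma frame_change:
  assumes f: "frame r ws" "frame r ws'" and sp: "vec.span (set ws) = vec.span (set ws')"
  shows "\<exists>D. \<forall>as. length as = r \<longrightarrow> wedge as ws' = D * wedge as ws"
proof -
  have ws: "length ws = r" "distinct ws" using f(1) by (auto simp: frame_def)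
  have "\<exists>u. ws' ! j = (\<Sum>m<r. u m *s ws ! m)" if "j < r" for j
  proof -
    have "ws' ! j \<in> set ws'" using that f(2) by (auto simp: frame_def)
    then have "ws' ! j \<in> vec.span (set ws)" unfolding sp by (rule vec.span_base)
    then obtain u where "ws' ! j = (\<Sum>v\<in>set ws. u v *s v)"
      unfolding vec.span_finite[OF finite_set] by blast
    then have "ws' ! j = (\<Sum>m<r. u (ws ! m) *s ws ! m)"
      using sum_list_index[OF ws(2), of "\<lambda>v. u v *s v"] ws(1) by simp
    then show ?thesis by (rule exI[of _ "\<lambda>m. u (ws ! m)"])
  qed
  then obtain c where "\<And>j. j < r \<Longrightarrow> ws' ! j = (\<Sum>m<r. c j m *s ws ! m)" by metis
  from wedge_frame_change[OF _ this] show ?thesis by metis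
qed

lemma homogeneous_form_scale:
  assumes "homogeneous_form r d g" and D: "\<And>as. length as = r \<Longrightarrow> wedge as ws' = D * wedge as ws"
  shows "g ws' = D ^ d * g ws"
  using assms(1)
  by induction (auto simp: D power_add algebra_simps)

lemma homogeneous_form_zero: "homogeneous_form r d (\<lambda>_. 0)"
proof (induction d)
  case 0 show ?case by (rule homogeneous_form.const)
next
  case (Suc d)
  show ?case
    using homogeneous_form.mult[OF Suc homogeneous_form.wedge[of "replicate r 0" r]] by simp
qed

lemma homogeneous_form_cmult:
  assumes "homogeneous_form r d g" shows "homogeneous_form r d (\<lambda>ws. c * g ws)"
  using homogeneous_form.mult[OF homogeneous_form.const[of r c] assms] by simp

lemma homogeneous_form_sum:
  "(\<And>a. a \<in> A \<Longrightarrow> homogeneous_form r d (g a)) \<Longrightarrow> homogeneous_form r d (\<lambda>ws. \<Sum>a\<in>A. g a ws)"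
  by (induction A rule: infinite_finite_induct) (auto intro: homogeneous_form.add homogeneous_form_zero)

lemma homogeneous_form_prod:
  assumes "finite A" "\<And>a. a \<in> A \<Longrightarrow> homogeneous_form r (d a) (g a)"
  shows "homogeneous_form r (\<Sum>a\<in>A. d a) (\<lambda>ws. \<Prod>a\<in>A. g a ws)"
  using assms
  by (induction A rule: finite_induct) (auto intro: homogeneous_form.mult homogeneous_form.const)

lemma homogeneous_form_power:
  assumes "homogeneous_form r d g" shows "homogeneous_form r (k * d) (\<lambda>ws. g ws ^ k)"
proof (induction k)
  case 0
  show ?case using homogeneous_form.const[of r 1] by simp
next
  case (Suc k)
  show ?case using homogeneous_form.mult[OF assms Suc] by simp
qed

definition line_of :: "(complex ^ 'n) list \<Rightarrow> (complex ^ 'n) list \<Rightarrow> complex \<Rightarrow> (complex ^ 'n) list" where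
  "line_of ws ws' s = map2 (\<lambda>x y. (1 - s) *s x + s *s y) ws ws'"

lemma line_of_ends:
  assumes "length ws = length ws'"
  shows "line_of ws ws' 0 = ws" "line_of ws ws' 1 = ws'" "length (line_of ws ws' s) = length ws"
  using assms by (auto simp: line_of_def intro!: nth_equalityI)

lemma homogeneous_form_line:
  assumes "homogeneous_form r d g" and len: "length ws = r" "length ws' = r"
  shows "\<exists>p. \<forall>s. g (line_of ws ws' s) = poly p s"
  using assms(1)
proof induction
  case (const c)
  show ?case by (rule exI[of _ "[:c:]"]) simp
next
  case (wedge as)
  define q where "q i j = [:pairing (as ! i) (ws ! j), pairing (as ! i) (ws' ! j) - pairing (as ! i) (ws ! j):]" for i j
  have q: "pairing (as ! i) (line_of ws ws' s ! j) = poly (q i j) s" if "j < r" for i j s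
  proof -
    have "line_of ws ws' s ! j = (1 - s) *s ws ! j + s *s ws' ! j"
      using that len by (simp add: line_of_def)
    then show ?thesis
      by (simp only: pairing_add_right pairing_scale_right) (simp add: q_def algebra_simps)
  qed
  have "wedge as (line_of ws ws' s) =
      poly (\<Sum>p | p permutes {..<length as}. of_int (sign p) * (\<Prod>i<length as. q i (p i))) s" for s
    unfolding wedge_def poly_sum
  proof (rule sum.cong[OF refl])
    fix p assume p: "p \<in> {p. p permutes {..<length as}}"
    have "(\<Prod>i<length as. pairing (as ! i) (line_of ws ws' s ! p i)) = (\<Prod>i<length as. poly (q i (p i)) s)"
    proof (intro prod.cong refl q)
      fix i assume "i \<in> {..<length as}"
      then have "p i \<in> {..<length as}" using permutes_in_image[of p "{..<length as}" i] p by simp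
      then show "p i < r" using wedge by simp
    qed
    then show "of_int (sign p) * (\<Prod>i<length as. pairing (as ! i) (line_of ws ws' s ! p i)) =
        poly (of_int (sign p) * (\<Prod>i<length as. q i (p i))) s"
      by (simp add: poly_prod sign_def)
  qed
  then show ?case by blast
next
  case (add d g h)
  then obtain p q where "\<forall>s. g (line_of ws ws' s) = poly p s" "\<forall>s. h (line_of ws ws' s) = poly q s" by blast
  then show ?case by (intro exI[of _ "p + q"]) simp
next
  case (mult d g e h)
  then obtain p q where "\<forall>s. g (line_of ws ws' s) = poly p s" "\<forall>s. h (line_of ws ws' s) = poly q s" by blast
  then show ?case by (intro exI[of _ "p * q"]) simp
qed

text \<open>
  Join a point where the forms in \<open>A\<close> do not vanish and a point where \<open>g a\<close> does not vanish by a
  line.  Along it every form is a polynomial with finitely many zeros.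
\<close>

lemma common_nonzero:
  assumes "finite A" "\<And>a. a \<in> A \<Longrightarrow> homogeneous_form r (d a) (g a)"
    and "\<And>a. a \<in> A \<Longrightarrow> \<exists>ws. length ws = r \<and> g a ws \<noteq> 0"
  shows "\<exists>ws. length ws = r \<and> (\<forall>a\<in>A. g a ws \<noteq> 0)"
  using assms
proof (induction A rule: finite_induct)
  case empty
  show ?case by (rule exI[of _ "replicate r 0"]) simp
next
  case (insert a A)
  then obtain ws where ws: "length ws = r" "\<forall>a\<in>A. g a ws \<noteq> 0" by auto
  obtain ws' where ws': "length ws' = r" "g a ws' \<noteq> 0" using insert.prems(2) by blast
  have hA: "homogeneous_form r (\<Sum>a\<in>A. d a) (\<lambda>ws. \<Prod>a\<in>A. g a ws)"
    using insert by (intro homogeneous_form_prod) auto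
  obtain p where p: "\<And>s. (\<Prod>a\<in>A. g a (line_of ws ws' s)) = poly p s"
    using homogeneous_form_line[OF hA ws(1) ws'(1)] by blast
  obtain q where q: "\<And>s. g a (line_of ws ws' s) = poly q s"
    using homogeneous_form_line[OF insert.prems(1)[OF insertI1] ws(1) ws'(1)] by blast
  have len: "length ws = length ws'" using ws ws' by simp
  have "(\<Prod>a\<in>A. g a ws) \<noteq> 0" using ws(2) insert.hyps by simp
  then have "poly p 0 \<noteq> 0" using p[of 0] line_of_ends(1)[OF len] by metis
  moreover have "poly q 1 \<noteq> 0" using q[of 1] ws'(2) line_of_ends(2)[OF len] by metis
  ultimately have "p * q \<noteq> 0" by auto
  then have "finite {s. poly (p * q) s = 0}" by (rule poly_roots_finite)
  then have "{s. poly (p * q) s = 0} \<noteq> UNIV" using infinite_UNIV_char_0[where 'a = complex] by metis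
  then obtain s where s: "poly (p * q) s \<noteq> 0" by auto
  then have "(\<Prod>a\<in>A. g a (line_of ws ws' s)) \<noteq> 0" "g a (line_of ws ws' s) \<noteq> 0"
    using p q by auto
  then have "\<forall>b\<in>insert a A. g b (line_of ws ws' s) \<noteq> 0" using insert.hyps by auto
  then show ?case using line_of_ends(3)[OF len] ws(1) by metis
qed

text \<open>A linear relation among \<open>ws\<close> would be a vector in the kernel of the matrix of pairings.\<close>

lemma wedge_nonzero_frame:
  assumes "wedge as ws \<noteq> 0" "length as = r" "length ws = r"
  shows "frame r ws"
proof -
  have zero: "\<forall>j<r. c j = 0" if c: "(\<Sum>j<r. c j *s ws ! j) = 0" for c
  proof (rule ccontr)
    assume ne: "\<not> (\<forall>j<r. c j = 0)"
    let ?A = "pairing_mat as ws" and ?v = "Matrix.vec r c"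
    have A: "?A \<in> carrier_mat r r" using assms by auto
    have "?v \<noteq> 0\<^sub>v r"
    proof
      assume "?v = 0\<^sub>v r"
      then have "\<forall>j<r. vec_index ?v j = vec_index (0\<^sub>v r) j" by simp
      then show False using ne by simp
    qed
    moreover have "?A *\<^sub>v ?v = 0\<^sub>v r"
    proof (rule eq_vecI)
      fix i assume "i < dim_vec (0\<^sub>v r)"
      then have i: "i < r" by simp
      have "(\<Sum>j<r. pairing (as ! i) (ws ! j) * c j) = pairing (as ! i) (\<Sum>j<r. c j *s ws ! j)"
        by (simp add: pairing_sum_right pairing_scale_right mult.commute)
      then show "vec_index (?A *\<^sub>v ?v) i = vec_index (0\<^sub>v r) i"
        using i assms c by (simp add: scalar_prod_def atLeast0LessThan pairing_zero_right)
    qed (use assms in auto)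
    ultimately have "Determinant.det ?A = 0"
      using det_0_iff_vec_prod_zero[OF A] by (metis vec_carrier)
    then show False using assms(1) wedge_det by metis
  qed
  have dist: "distinct ws"
    unfolding distinct_conv_nth
  proof (intro allI impI notI)
    fix i j assume ij: "i < length ws" "j < length ws" "i \<noteq> j" "ws ! i = ws ! j"
    let ?c = "\<lambda>k. if k = i then 1 else if k = j then - 1 else 0 :: complex"
    have "(\<Sum>k<r. ?c k *s ws ! k) = (\<Sum>k\<in>{i, j}. ?c k *s ws ! k)"
      using ij assms(3) by (intro sum.mono_neutral_right) auto
    also have "\<dots> = 0" using ij by simp
    finally have "?c i = 0" using zero[of ?c] ij assms(3) by blast
    then show False by simp
  qed
  have "vec.independent (set ws)"
    unfolding vec.dependent_finite[OF finite_set]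
  proof
    assume "\<exists>u. (\<exists>v\<in>set ws. u v \<noteq> 0) \<and> (\<Sum>v\<in>set ws. u v *s v) = 0"
    then obtain u v where u: "v \<in> set ws" "u v \<noteq> 0" "(\<Sum>v\<in>set ws. u v *s v) = 0" by blast
    obtain i where i: "i < r" "ws ! i = v" using u(1) assms(3) by (auto simp: in_set_conv_nth)
    have "(\<Sum>j<r. u (ws ! j) *s ws ! j) = 0"
      using u(3) sum_list_index[OF dist, of "\<lambda>v. u v *s v"] assms(3) by simp
    then show False using zero[of "\<lambda>j. u (ws ! j)"] i u(2) by blast
  qed
  then show ?thesis using dist assms(3) by (simp add: frame_def)
qed

definition complexify :: "real ^ 'n \<Rightarrow> complex ^ 'n" where
  "complexify v = (\<chi> i. complex_of_real (v $ i))"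

lemma pairing_complexify: "pairing u (complexify v) = of_real (u \<bullet> v)"
  by (simp add: pairing_def complexify_def inner_vec_def)

lemma wedge_not_identically_zero:
  assumes "distinct as" "independent (set as)"
  shows "\<exists>ws. length ws = length as \<and> wedge as ws \<noteq> 0"
proof -
  let ?r = "length as"
  obtain w where w: "\<And>i j. i < ?r \<Longrightarrow> j < ?r \<Longrightarrow> w i \<bullet> as ! j = (if i = j then 1 else 0)"
    using dual_vectors[OF assms] by blast
  define ws where "ws = map (\<lambda>j. complexify (w j)) [0..<?r]"
  have "pairing_mat as ws = 1\<^sub>m ?r"
    using w by (intro eq_matI) (auto simp: ws_def pairing_complexify inner_commute)
  then have "wedge as ws = 1" by (simp add: wedge_det)
  then show ?thesis by (intro exI[of _ ws]) (simp add: ws_def)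
qed

section \<open>Interpolation for linear forms in general position\<close>

text \<open>
  These are the properties of linear forms in general position on an \<open>r\<close>-dimensional space \<open>E\<close>: any
  \<open>r - 1\<close> of them, with index set \<open>T\<close>, vanish together on the line of a vector \<open>e T\<close>, where no other form
  vanishes, and with any further form \<open>x s\<close> they span the dual space of \<open>E\<close>.
\<close>

locale generic_forms =
  fixes I :: "'i set" and r :: nat and E :: "'e set" and x :: "'i \<Rightarrow> 'e \<Rightarrow> complex" and e :: "'i set \<Rightarrow> 'e"
  assumes finite_I: "finite I" and r_pos: "r > 0"
    and e_in: "\<And>T. T \<subseteq> I \<Longrightarrow> card T = r - 1 \<Longrightarrow> e T \<in> E"
    and e_zero: "\<And>T i. T \<subseteq> I \<Longrightarrow> card T = r - 1 \<Longrightarrow> i \<in> T \<Longrightarrow> x i (e T) = 0"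
    and e_nonzero: "\<And>T i. T \<subseteq> I \<Longrightarrow> card T = r - 1 \<Longrightarrow> i \<in> I - T \<Longrightarrow> x i (e T) \<noteq> 0"
    and relation: "\<And>T s l. T \<subseteq> I \<Longrightarrow> card T = r - 1 \<Longrightarrow> s \<in> I - T \<Longrightarrow> l \<in> I \<Longrightarrow>
      \<exists>a c. \<forall>y\<in>E. x l y = a * x s y + (\<Sum>i\<in>T. c i * x i y)"
begin

definition corners where "corners S = {T. T \<subseteq> S \<and> card T = r - 1}"

definition spanned where
  "spanned S f \<longleftrightarrow> (\<exists>c. \<forall>y\<in>E. f y = (\<Sum>T\<in>corners S. c T * (\<Prod>j\<in>S-T. x j y)))"

lemma finite_corners: "S \<subseteq> I \<Longrightarrow> finite (corners S)"
  by (rule finite_subset[of _ "Pow S"]) (use finite_I finite_subset in \<open>auto simp: corners_def\<close>)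

lemma spanned_basis: "S \<subseteq> I \<Longrightarrow> T \<in> corners S \<Longrightarrow> spanned S (\<lambda>y. \<Prod>j\<in>S-T. x j y)"
  unfolding spanned_def
  by (rule exI[of _ "\<lambda>T'. if T' = T then 1 else 0"])
    (simp add: finite_corners if_distrib[of "\<lambda>c. c * _"] cong: if_cong)

lemma spanned_add: "spanned S f \<Longrightarrow> spanned S g \<Longrightarrow> spanned S (\<lambda>y. f y + g y)"
proof -
  assume "spanned S f" "spanned S g"
  then obtain c d where "\<forall>y\<in>E. f y = (\<Sum>T\<in>corners S. c T * (\<Prod>j\<in>S-T. x j y))"
    "\<forall>y\<in>E. g y = (\<Sum>T\<in>corners S. d T * (\<Prod>j\<in>S-T. x j y))" unfolding spanned_def by blast
  then show ?thesis unfolding spanned_def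
    by (intro exI[of _ "\<lambda>T. c T + d T"]) (simp add: distrib_right sum.distrib)
qed

lemma spanned_cmult: "spanned S f \<Longrightarrow> spanned S (\<lambda>y. a * f y)"
proof -
  assume "spanned S f"
  then obtain c where "\<forall>y\<in>E. f y = (\<Sum>T\<in>corners S. c T * (\<Prod>j\<in>S-T. x j y))" unfolding spanned_def by blast
  then show ?thesis unfolding spanned_def
    by (intro exI[of _ "\<lambda>T. a * c T"]) (simp add: sum_distrib_left mult.assoc)
qed

lemma spanned_zero: "spanned S (\<lambda>y. 0)"
  unfolding spanned_def by (intro exI[of _ "\<lambda>_. 0"]) simp

lemma spanned_sum: "(\<And>a. a \<in> A \<Longrightarrow> spanned S (f a)) \<Longrightarrow> spanned S (\<lambda>y. \<Sum>a\<in>A. f a y)"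
  by (induction A rule: infinite_finite_induct) (auto intro: spanned_add spanned_zero)

lemma spanned_cong: "spanned S f \<Longrightarrow> (\<And>y. y \<in> E \<Longrightarrow> g y = f y) \<Longrightarrow> spanned S g"
  unfolding spanned_def by auto

text \<open>
  Induction on the degree.  For \<open>s \<in> S\<close>, the induction hypothesis with \<open>S - {s}\<close> writes the remaining factors
  as a combination of products over \<open>S - {s} - T\<close>.  Replacing \<open>x l\<close> by a combination of \<open>x s\<close> and
  the \<open>x i\<close> with \<open>i \<in> T\<close> turns each term into products over \<open>S - T'\<close> with \<open>|T'| = r - 1\<close>.
\<close>

lemma spanned_monomials:
  assumes "S \<subseteq> I" "card S = length ls + (r - 1)" "set ls \<subseteq> I"
  shows "spanned S (\<lambda>y. \<Prod>l\<leftarrow>ls. x l y)"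
  using assms
proof (induction ls arbitrary: S)
  case Nil
  then have "S \<in> corners S" by (simp add: corners_def)
  from spanned_basis[OF Nil(1) this] show ?case by simp
next
  case (Cons l ls)
  have finS: "finite S" using Cons.prems(1) finite_I finite_subset by blast
  have "S \<noteq> {}" using Cons.prems(2) by auto
  then obtain s where s: "s \<in> S" by blast
  let ?S' = "S - {s}"
  have S': "?S' \<subseteq> I" "card ?S' = length ls + (r - 1)" using Cons.prems s finS by auto
  have "spanned ?S' (\<lambda>y. \<Prod>l\<leftarrow>ls. x l y)" using Cons.IH[OF S'] Cons.prems(3) by simp
  then obtain c where c: "\<forall>y\<in>E. (\<Prod>l\<leftarrow>ls. x l y) = (\<Sum>T\<in>corners ?S'. c T * (\<Prod>j\<in>?S'-T. x j y))"
    unfolding spanned_def by blast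
  have main: "spanned S (\<lambda>y. x l y * (\<Prod>j\<in>?S'-T. x j y))" if T: "T \<in> corners ?S'" for T
  proof -
    have T': "T \<subseteq> ?S'" "card T = r - 1" using T by (auto simp: corners_def)
    have finT: "finite T" using T'(1) finS finite_subset by blast
    have TI: "T \<subseteq> I" "s \<in> I - T" using T'(1) S'(1) s Cons.prems(1) by auto
    have "l \<in> I" using Cons.prems(3) by simp
    from relation[OF TI(1) T'(2) TI(2) this] obtain a d where
      ad: "\<forall>y\<in>E. x l y = a * x s y + (\<Sum>i\<in>T. d i * x i y)" by blast
    have 1: "x s y * (\<Prod>j\<in>?S'-T. x j y) = (\<Prod>j\<in>S-T. x j y)" for y
    proof -
      have "S - T = insert s (?S' - T)" using s TI(2) by auto
      then show ?thesis using finS by simp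
    qed
    have 2: "x i y * (\<Prod>j\<in>?S'-T. x j y) = (\<Prod>j\<in>S-insert s (T-{i}). x j y)" if "i \<in> T" for i y
    proof -
      have "S - insert s (T - {i}) = insert i (?S' - T)" using that T'(1) by auto
      then show ?thesis using finS that by simp
    qed
    have c1: "T \<in> corners S" using T' by (auto simp: corners_def)
    have c2: "insert s (T - {i}) \<in> corners S" if "i \<in> T" for i
    proof -
      have "insert s (T - {i}) \<subseteq> S" using T'(1) s by auto
      moreover have "card (insert s (T - {i})) = card T"
        using TI(2) finT that by (metis DiffD1 DiffD2 card_Suc_Diff1 card_insert_disjoint finite_Diff)
      ultimately show ?thesis using T'(2) by (simp add: corners_def)
    qed
    have "spanned S (\<lambda>y. a * (\<Prod>j\<in>S-T. x j y) + (\<Sum>i\<in>T. d i * (\<Prod>j\<in>S-insert s (T-{i}). x j y)))"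
      by (intro spanned_add spanned_cmult spanned_sum spanned_basis[OF Cons.prems(1)] c1 c2)
    then show ?thesis
    proof (rule spanned_cong)
      fix y assume y: "y \<in> E"
      have "x l y * (\<Prod>j\<in>?S'-T. x j y) = a * (x s y * (\<Prod>j\<in>?S'-T. x j y)) + (\<Sum>i\<in>T. d i * (x i y * (\<Prod>j\<in>?S'-T. x j y)))"
        using ad y by (simp add: distrib_right sum_distrib_right mult.assoc)
      also have "\<dots> = a * (\<Prod>j\<in>S-T. x j y) + (\<Sum>i\<in>T. d i * (\<Prod>j\<in>S-insert s (T-{i}). x j y))"
        unfolding 1 using 2 by simp
      finally show "x l y * (\<Prod>j\<in>?S'-T. x j y) = \<dots>" .
    qed
  qed
  have "spanned S (\<lambda>y. \<Sum>T\<in>corners ?S'. c T * (x l y * (\<Prod>j\<in>?S'-T. x j y)))"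
    by (intro spanned_sum spanned_cmult main)
  then show ?case
    by (rule spanned_cong) (use c in \<open>simp add: sum_distrib_left algebra_simps\<close>)
qed

lemma corner_product_eval:
  assumes S: "S \<subseteq> I" and T: "T \<in> corners S" "T' \<in> corners S"
  shows "(\<Prod>j\<in>S-T. x j (e T')) \<noteq> 0 \<longleftrightarrow> T = T'"
proof -
  have finS: "finite S" using S finite_I finite_subset by blast
  have T': "T \<subseteq> S" "card T = r - 1" "T' \<subseteq> S" "card T' = r - 1" using T by (auto simp: corners_def)
  show ?thesis
  proof
    assume "T = T'"
    then show "(\<Prod>j\<in>S-T. x j (e T')) \<noteq> 0" using e_nonzero[of T'] T' S finS by auto
  next
    assume ne: "(\<Prod>j\<in>S-T. x j (e T')) \<noteq> 0"
    have "T' \<subseteq> T"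
    proof
      fix j assume j: "j \<in> T'"
      show "j \<in> T"
      proof (rule ccontr)
        assume "j \<notin> T"
        then have "j \<in> S - T" using j T' by blast
        moreover have "x j (e T') = 0" using e_zero[of T' j] T' S j by auto
        ultimately show False using ne finS by auto
      qed
    qed
    then show "T = T'" using T' finS by (metis card_subset_eq finite_subset)
  qed
qed

text \<open>
  The product over \<open>S - T\<close> vanishes at all points \<open>e T'\<close> with \<open>T' \<noteq> T\<close> and not at \<open>e T\<close>, so evaluation at
  these points determines the coefficients in \<open>spanned_monomials\<close>.
\<close>

theorem lagrange_interpolation:
  assumes S: "S \<subseteq> I" "card S = length ls + (r - 1)" and ls: "set ls \<subseteq> I" and y: "y \<in> E"
  shows "(\<Prod>l\<leftarrow>ls. x l y) =
    (\<Sum>T\<in>corners S. (\<Prod>l\<leftarrow>ls. x l (e T)) / (\<Prod>j\<in>S-T. x j (e T)) * (\<Prod>j\<in>S-T. x j y))"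
proof -
  obtain c where c: "\<forall>y\<in>E. (\<Prod>l\<leftarrow>ls. x l y) = (\<Sum>T\<in>corners S. c T * (\<Prod>j\<in>S-T. x j y))"
    using spanned_monomials[OF S ls] unfolding spanned_def by blast
  have "c T = (\<Prod>l\<leftarrow>ls. x l (e T)) / (\<Prod>j\<in>S-T. x j (e T))" if T: "T \<in> corners S" for T
  proof -
    have "e T \<in> E" using T S(1) by (intro e_in) (auto simp: corners_def)
    then have "(\<Prod>l\<leftarrow>ls. x l (e T)) = (\<Sum>T'\<in>corners S. c T' * (\<Prod>j\<in>S-T'. x j (e T)))" using c by blast
    also have "\<dots> = (\<Sum>T'\<in>corners S. if T' = T then c T * (\<Prod>j\<in>S-T. x j (e T)) else 0)"
      using corner_product_eval[OF S(1) _ T] by (intro sum.cong) auto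
    also have "\<dots> = c T * (\<Prod>j\<in>S-T. x j (e T))" using finite_corners[OF S(1)] T by simp
    finally show ?thesis using corner_product_eval[OF S(1) T T] by simp
  qed
  then show ?thesis using c y by simp
qed

lemma lagrange_interpolation_powers:
  assumes S: "S \<subseteq> I" "card S = (\<Sum>i\<in>I. m i) + (r - 1)" and y: "y \<in> E"
  shows "(\<Prod>i\<in>I. x i y ^ m i) =
    (\<Sum>T\<in>corners S. (\<Prod>i\<in>I. x i (e T) ^ m i) / (\<Prod>j\<in>S-T. x j (e T)) * (\<Prod>j\<in>S-T. x j y))"
proof -
  obtain xs where xs: "set xs = I" "distinct xs" using finite_distinct_list[OF finite_I] by blast
  \<comment> \<open>The monomial as a list of indices, each repeated according to its exponent.\<close>
  define ls where "ls = concat (map (\<lambda>i. replicate (m i) i) xs)"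
  have prod: "(\<Prod>l\<leftarrow>ls. f l) = (\<Prod>i\<in>I. f i ^ m i)" for f :: "'i \<Rightarrow> complex"
  proof -
    have "(\<Prod>l\<leftarrow>ls. f l) = (\<Prod>i\<leftarrow>xs. f i ^ m i)"
      unfolding ls_def by (induction xs) (auto simp: prod_list_replicate)
    then show ?thesis using prod.distinct_set_conv_list[OF xs(2), of "\<lambda>i. f i ^ m i"] xs(1) by simp
  qed
  have "length ls = (\<Sum>i\<leftarrow>xs. m i)" unfolding ls_def by (induction xs) auto
  then have len: "length ls = (\<Sum>i\<in>I. m i)" using sum.distinct_set_conv_list[OF xs(2), of m] xs(1) by simp
  have "set ls \<subseteq> I" using xs(1) by (auto simp: ls_def)
  from lagrange_interpolation[OF S(1) S(2)[folded len] this y] show ?thesis unfolding prod .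
qed

text \<open>
  Only \<open>x i\<close> with \<open>i \<in> S\<close> can occur with exponent \<open>- 1\<close> and a nonzero coefficient, so multiplication by \<open>\<Prod>i\<in>S. x i\<close> makes each
  Laurent monomial an honest one, of degree \<open>|S| - (r - 1)\<close>, to which interpolation applies.  At \<open>e T\<close> only those
  monomials survive that have exponent \<open>- 1\<close> in every \<open>x i\<close>, \<open>i \<in> T\<close>; removing these factors leaves a monomial
  of degree 0 in the remaining forms.
\<close>

theorem interpolation_laurent:
  fixes \<phi> :: "'i \<Rightarrow> int \<Rightarrow> complex"
  assumes S: "S \<subseteq> I" and pole: "\<And>i. i \<in> I \<Longrightarrow> \<phi> i (- 1) = (if i \<in> S then 1 else 0)"
    and y: "y \<in> E" "\<And>i. i \<in> I \<Longrightarrow> x i y \<noteq> 0"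
  shows "(\<Sum>m\<in>exponents I (- int (r - 1)). \<Prod>i\<in>I. \<phi> i (m i) * x i y powi m i) =
    (\<Sum>T\<in>corners S. (\<Sum>m\<in>exponents (I-T) 0. \<Prod>j\<in>I-T. \<phi> j (m j) * x j (e T) powi m j) * (\<Prod>i\<in>T. 1 / x i y))"
proof -
  let ?X = "exponents I (- int (r - 1))"
  have finS: "finite S" using S finite_I finite_subset by blast
  \<comment> \<open>The value of the Laurent monomial at \<open>e T\<close> once the factors \<open>x i\<close>, \<open>i \<in> T\<close>, are split off.\<close>
  define contrib where "contrib m T = (if \<forall>i\<in>T. m i = - 1 then \<Prod>j\<in>I-T. \<phi> j (m j) * x j (e T) powi m j else 0)" for m T
  have each: "(\<Prod>i\<in>I. \<phi> i (m i) * x i y powi m i) = (\<Sum>T\<in>corners S. contrib m T * (\<Prod>i\<in>T. 1 / x i y))"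
    if m: "m \<in> ?X" for m
  proof (cases "\<exists>i\<in>I. \<phi> i (m i) = 0")
    case True
    then obtain i where i: "i \<in> I" "\<phi> i (m i) = 0" by blast
    have "contrib m T = 0" if T: "T \<in> corners S" for T
    proof (cases "\<forall>i\<in>T. m i = - 1")
      case True
      have "i \<notin> T" using True i pole[of i] T by (auto simp: corners_def)
      then have "(\<Prod>j\<in>I-T. \<phi> j (m j) * x j (e T) powi m j) = 0" using i finite_I by auto
      then show ?thesis by (simp add: contrib_def)
    qed (auto simp: contrib_def)
    then show ?thesis using True finite_I by (auto simp: prod_zero_iff)
  next
    case False
    have mI: "m i \<ge> - 1" if "i \<in> I" for i using m that by (auto simp: exponents_def PiE_iff)
    have mS: "m i \<ge> 0" if "i \<in> I - S" for i
      using mI[of i] False pole[of i] that by (cases "m i = - 1") auto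
    \<comment> \<open>The exponents of the monomial after multiplication by \<open>\<Prod>i\<in>S. x i\<close>.\<close>
    define m' where "m' i = nat (m i + (if i \<in> S then 1 else 0))" for i
    have m': "int (m' i) = m i + (if i \<in> S then 1 else 0)" if "i \<in> I" for i
      using mI[OF that] mS[of i] that by (auto simp: m'_def)
    have "int (\<Sum>i\<in>I. m' i) = (\<Sum>i\<in>I. m i) + (\<Sum>i\<in>I. if i \<in> S then 1 else 0)"
      using m' by (simp add: sum.distrib)
    also have "(\<Sum>i\<in>I. if i \<in> S then 1 else 0 :: int) = int (card S)"
      using S finite_I by (simp add: sum.inter_restrict[symmetric] Int_absorb1)
    also have "(\<Sum>i\<in>I. m i) = - int (r - 1)" using m by (simp add: exponents_def)
    finally have card: "card S = (\<Sum>i\<in>I. m' i) + (r - 1)" by linarith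
    have powi: "(\<Prod>i\<in>J. z i powi m i) * (\<Prod>i\<in>S\<inter>J. z i) = (\<Prod>i\<in>J. z i ^ m' i)"
      if J: "J \<subseteq> I" and z: "\<And>i. i \<in> J \<Longrightarrow> z i \<noteq> 0" for J and z :: "'i \<Rightarrow> complex"
    proof -
      have finJ: "finite J" using J finite_I finite_subset by blast
      have "z i ^ m' i = z i powi m i * (if i \<in> S then z i else 1)" if i: "i \<in> J" for i
      proof -
        have "z i ^ m' i = z i powi int (m' i)" by simp
        also have "\<dots> = z i powi m i * (if i \<in> S then z i else 1)"
          unfolding m'[OF subsetD[OF J i]] using z[OF i] by (simp add: power_int_add)
        finally show ?thesis .
      qed
      then have "(\<Prod>i\<in>J. z i ^ m' i) = (\<Prod>i\<in>J. z i powi m i) * (\<Prod>i\<in>J. if i \<in> S then z i else 1)"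
        by (simp add: prod.distrib)
      also have "(\<Prod>i\<in>J. if i \<in> S then z i else 1) = (\<Prod>i\<in>S\<inter>J. z i)"
        using finJ by (simp add: prod.inter_restrict Int_commute)
      finally show ?thesis by simp
    qed
    have SI: "S \<inter> I = S" using S by blast
    have Sy: "(\<Prod>i\<in>S. x i y) \<noteq> 0" using y(2) S finS by auto
    have "(\<Prod>i\<in>I. x i y powi m i) * (\<Prod>i\<in>S. x i y) = (\<Prod>i\<in>I. x i y ^ m' i)"
      using powi[of I "\<lambda>i. x i y"] y(2) SI by simp
    also have "\<dots> = (\<Sum>T\<in>corners S. (\<Prod>i\<in>I. x i (e T) ^ m' i) / (\<Prod>j\<in>S-T. x j (e T)) * (\<Prod>j\<in>S-T. x j y))"
      by (rule lagrange_interpolation_powers[OF S card y(1)])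
    finally have "(\<Prod>i\<in>I. x i y powi m i) = (\<Sum>T\<in>corners S. (\<Prod>i\<in>I. x i (e T) ^ m' i) / (\<Prod>j\<in>S-T. x j (e T)) * (\<Prod>j\<in>S-T. x j y)) / (\<Prod>i\<in>S. x i y)"
      using Sy by (simp add: eq_divide_eq)
    then have "(\<Prod>i\<in>I. \<phi> i (m i) * x i y powi m i) = (\<Sum>T\<in>corners S. (\<Prod>i\<in>I. \<phi> i (m i)) *
        ((\<Prod>i\<in>I. x i (e T) ^ m' i) / (\<Prod>j\<in>S-T. x j (e T)) * ((\<Prod>j\<in>S-T. x j y) / (\<Prod>i\<in>S. x i y))))"
      by (simp add: prod.distrib sum_divide_distrib sum_distrib_left)
    also have "\<dots> = (\<Sum>T\<in>corners S. contrib m T * (\<Prod>i\<in>T. 1 / x i y))"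
    proof (rule sum.cong[OF refl])
      fix T assume T: "T \<in> corners S"
      then have T': "T \<subseteq> S" "card T = r - 1" by (auto simp: corners_def)
      have TI: "T \<subseteq> I" using T' S by blast
      have finT: "finite T" using TI finite_I finite_subset by blast
      have ynz: "(\<Prod>i\<in>T. x i y) \<noteq> 0" "(\<Prod>i\<in>S-T. x i y) \<noteq> 0" using y(2) TI S finS finT by auto
      have "(\<Prod>i\<in>S. x i y) = (\<Prod>i\<in>S-T. x i y) * (\<Prod>i\<in>T. x i y)"
        by (rule prod.subset_diff[OF T'(1) finS])
      then have q: "(\<Prod>j\<in>S-T. x j y) / (\<Prod>i\<in>S. x i y) = (\<Prod>i\<in>T. 1 / x i y)"
        using ynz by (simp add: prod_dividef)
      have split: "(\<Prod>i\<in>I. f i) = (\<Prod>i\<in>I-T. f i) * (\<Prod>i\<in>T. f i)" for f :: "'i \<Rightarrow> complex"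
        by (rule prod.subset_diff[OF TI finite_I])
      have enz: "\<And>j. j \<in> I - T \<Longrightarrow> x j (e T) \<noteq> 0" using e_nonzero[OF TI T'(2)] .
      have "(\<Prod>i\<in>I. \<phi> i (m i)) * ((\<Prod>i\<in>I. x i (e T) ^ m' i) / (\<Prod>j\<in>S-T. x j (e T))) = contrib m T"
      proof (cases "\<forall>i\<in>T. m i = - 1")
        case True
        then have "m' i = 0" if "i \<in> T" for i using that T'(1) by (auto simp: m'_def)
        then have 1: "(\<Prod>i\<in>T. x i (e T) ^ m' i) = 1" by (intro prod.neutral) auto
        have 2: "(\<Prod>i\<in>T. \<phi> i (m i)) = 1"
        proof (intro prod.neutral ballI)
          fix i assume i: "i \<in> T"
          then have "i \<in> I" "i \<in> S" using TI T'(1) by auto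
          then show "\<phi> i (m i) = 1" using pole[of i] True i by simp
        qed
        have "S \<inter> (I - T) = S - T" using S by blast
        then have 3: "(\<Prod>i\<in>I-T. x i (e T) ^ m' i) = (\<Prod>i\<in>I-T. x i (e T) powi m i) * (\<Prod>j\<in>S-T. x j (e T))"
          using powi[of "I - T" "\<lambda>i. x i (e T)"] enz by simp
        have "(\<Prod>j\<in>S-T. x j (e T)) \<noteq> 0" using enz S finS by auto
        then show ?thesis using True unfolding contrib_def split 1 2 3 by (simp add: prod.distrib)
      next
        case False
        then obtain i where i: "i \<in> T" "m i \<noteq> - 1" by blast
        have "m' i \<noteq> 0" using mI[of i] i T'(1) TI by (auto simp: m'_def)
        then have "x i (e T) ^ m' i = 0" using e_zero[OF TI T'(2) i(1)] by simp
        then have "(\<Prod>i\<in>I. x i (e T) ^ m' i) = 0" using finite_I i(1) TI by auto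
        moreover have "contrib m T = 0" using False by (simp only: contrib_def if_False)
        ultimately show ?thesis by simp
      qed
      then show "(\<Prod>i\<in>I. \<phi> i (m i)) *
        ((\<Prod>i\<in>I. x i (e T) ^ m' i) / (\<Prod>j\<in>S-T. x j (e T)) * ((\<Prod>j\<in>S-T. x j y) / (\<Prod>i\<in>S. x i y))) =
        contrib m T * (\<Prod>i\<in>T. 1 / x i y)"
        unfolding q by (simp only: mult.assoc[symmetric])
    qed
    finally show ?thesis .
  qed
  have restr: "(\<Sum>m\<in>?X. contrib m T) = (\<Sum>m\<in>exponents (I-T) 0. \<Prod>j\<in>I-T. \<phi> j (m j) * x j (e T) powi m j)"
    if T: "T \<in> corners S" for T
  proof -
    have T': "T \<subseteq> I" "card T = r - 1" using T S by (auto simp: corners_def)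
    have split: "(\<Sum>i\<in>I. m i) = (\<Sum>i\<in>I-T. m i) + (\<Sum>i\<in>T. m i)" for m :: "'i \<Rightarrow> int"
      by (rule sum.subset_diff[OF T'(1) finite_I])
    let ?Y = "{m \<in> ?X. \<forall>i\<in>T. m i = - 1}"
    have "(\<Sum>m\<in>?X. contrib m T) = (\<Sum>m\<in>?Y. \<Prod>j\<in>I-T. \<phi> j (m j) * x j (e T) powi m j)"
      using finite_exponents[OF finite_I] by (intro sum.mono_neutral_cong_right) (auto simp: contrib_def)
    also have "\<dots> = (\<Sum>m\<in>exponents (I-T) 0. \<Prod>j\<in>I-T. \<phi> j (m j) * x j (e T) powi m j)"
    proof (rule sum.reindex_bij_witness[where j = "\<lambda>m. restrict m (I-T)" and i = "\<lambda>m i. if i \<in> T then - 1 else m i"])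
      fix m assume m: "m \<in> ?Y"
      then have mE: "m \<in> I \<rightarrow>\<^sub>E {-1..}" and ms: "(\<Sum>i\<in>I. m i) = - int (r - 1)" and mT: "\<forall>i\<in>T. m i = - 1"
        by (auto simp: exponents_def)
      show "(\<lambda>i. if i \<in> T then - 1 else restrict m (I-T) i) = m"
        using mE mT by (auto simp: fun_eq_iff PiE_iff extensional_def)
      have "(\<Sum>i\<in>T. m i) = - int (card T)" using mT by simp
      then have "(\<Sum>i\<in>I-T. m i) = 0" using split[of m] ms T'(2) by simp
      then show "restrict m (I-T) \<in> exponents (I-T) 0"
        using mE by (auto simp: exponents_def PiE_iff)
      show "(\<Prod>j\<in>I-T. \<phi> j (restrict m (I-T) j) * x j (e T) powi restrict m (I-T) j) = (\<Prod>j\<in>I-T. \<phi> j (m j) * x j (e T) powi m j)"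
        by (intro prod.cong) auto
    next
      fix m assume m: "m \<in> exponents (I-T) 0"
      then have mE: "m \<in> (I-T) \<rightarrow>\<^sub>E {-1..}" and ms: "(\<Sum>i\<in>I-T. m i) = 0" by (auto simp: exponents_def)
      let ?m = "\<lambda>i. if i \<in> T then - 1 else m i"
      show "restrict ?m (I-T) = m" using mE by (auto simp: fun_eq_iff PiE_iff extensional_def)
      have "(\<Sum>i\<in>I-T. ?m i) = (\<Sum>i\<in>I-T. m i)" by (intro sum.cong) auto
      moreover have "(\<Sum>i\<in>T. ?m i) = - int (card T)" by simp
      ultimately have "(\<Sum>i\<in>I. ?m i) = - int (r - 1)" using split[of ?m] ms T'(2) by simp
      moreover have "?m \<in> I \<rightarrow>\<^sub>E {-1..}" using mE T'(1) by (auto simp: PiE_iff extensional_def)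
      ultimately show "?m \<in> ?Y" by (simp add: exponents_def)
    qed
    finally show ?thesis .
  qed
  have "(\<Sum>m\<in>?X. \<Prod>i\<in>I. \<phi> i (m i) * x i y powi m i) = (\<Sum>m\<in>?X. \<Sum>T\<in>corners S. contrib m T * (\<Prod>i\<in>T. 1 / x i y))"
    by (intro sum.cong refl each)
  also have "\<dots> = (\<Sum>T\<in>corners S. (\<Sum>m\<in>?X. contrib m T) * (\<Prod>i\<in>T. 1 / x i y))"
    by (subst sum.swap) (simp add: sum_distrib_right)
  also have "\<dots> = (\<Sum>T\<in>corners S. (\<Sum>m\<in>exponents (I-T) 0. \<Prod>j\<in>I-T. \<phi> j (m j) * x j (e T) powi m j) * (\<Prod>i\<in>T. 1 / x i y))"
    by (intro sum.cong refl) (simp only: restr)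
  finally show ?thesis .
qed

end

section \<open>The coefficients as rational functions\<close>

lemma degree_zero_part_exponents:
  "degree_zero_part J \<phi> z = (\<Sum>m\<in>exponents J 0. \<Prod>j\<in>J. fls_nth (\<phi> j) (m j) * z j powi m j)"
  unfolding degree_zero_part_def exponents_def ..

lemma degree_zero_part_scale:
  assumes "finite J" "D \<noteq> 0"
  shows "degree_zero_part J \<phi> (\<lambda>j. D * z j) = degree_zero_part J \<phi> z"
  unfolding degree_zero_part_exponents
proof (rule sum.cong[OF refl])
  fix m assume m: "m \<in> exponents J 0"
  have "(\<Prod>j\<in>J. D powi m j) = D powi (\<Sum>j\<in>J. m j)"
    using assms by (induction J rule: finite_induct) (auto simp: power_int_add)
  then have "(\<Prod>j\<in>J. D powi m j) = 1" using m by (simp add: exponents_def)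
  then show "(\<Prod>j\<in>J. fls_nth (\<phi> j) (m j) * (D * z j) powi m j) = (\<Prod>j\<in>J. fls_nth (\<phi> j) (m j) * z j powi m j)"
    by (simp add: power_int_mult_distrib prod.distrib)
qed

lemma degree_zero_part_cong:
  assumes "\<And>j. j \<in> J \<Longrightarrow> \<phi> j = \<psi> j" "\<And>j. j \<in> J \<Longrightarrow> z j = w j"
  shows "degree_zero_part J \<phi> z = degree_zero_part J \<psi> w"
  unfolding degree_zero_part_exponents using assms by (intro sum.cong prod.cong) auto

lemma exponents_leading:
  assumes "finite A" shows "exponents A (- int (card A)) = {\<lambda>i\<in>A. - 1}"
proof (intro equalityI subsetI)
  fix m assume m: "m \<in> exponents A (- int (card A))"
  have ge: "m i + 1 \<ge> 0" if "i \<in> A" for i using m that by (force simp: exponents_def PiE_iff)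
  have "(\<Sum>i\<in>A. m i + 1) = 0" using m by (simp add: exponents_def sum.distrib)
  then have "\<forall>i\<in>A. m i + 1 = 0" using sum_nonneg_eq_0_iff[OF assms, of "\<lambda>i. m i + 1"] ge by blast
  then have "m = (\<lambda>i\<in>A. - 1)" using m by (auto simp: exponents_def fun_eq_iff PiE_iff extensional_def)
  then show "m \<in> {\<lambda>i\<in>A. - 1}" by simp
qed (simp add: exponents_def)

lemma polynomial_coeff_eq:
  fixes b c :: "nat \<Rightarrow> complex"
  assumes eq: "\<And>l::nat. l > 0 \<Longrightarrow> (\<Sum>q\<le>n. b q * of_nat l ^ q) = (\<Sum>q\<le>n. c q * of_nat l ^ q)" and q: "q \<le> n"
  shows "b q = c q"
proof -
  define p where "p = (\<Sum>q\<le>n. monom (b q - c q) q)"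
  have p: "poly p x = (\<Sum>q\<le>n. b q * x ^ q) - (\<Sum>q\<le>n. c q * x ^ q)" for x
    by (simp add: p_def poly_sum poly_monom left_diff_distrib sum_subtractf)
  have "p = 0"
  proof (rule ccontr)
    assume "p \<noteq> 0"
    then have fin: "finite {x. poly p x = 0}" by (rule poly_roots_finite)
    have "of_nat ` {0<..} \<subseteq> {x. poly p x = 0}" using eq p by auto
    then have "finite ((of_nat :: nat \<Rightarrow> complex) ` {0<..})" using fin by (rule finite_subset)
    then have "finite {0::nat<..}" by (rule finite_imageD) (simp add: inj_on_def)
    then show False using infinite_Ioi by blast
  qed
  moreover have "coeff p q = b q - c q" using q by (simp add: p_def coeff_sum)
  ultimately show ?thesis by simp
qed

text \<open>
  Along a real line \<open>y + s z\<close> each real part is a polynomial in \<open>s\<close> of degree at most 1, and finitely many such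
  polynomials that are not zero have finitely many roots.
\<close>

lemma generic_point_in_span:
  fixes f :: "'b \<Rightarrow> complex ^ 'n \<Rightarrow> complex"
  assumes "finite A" and add: "\<And>a y z. f a (y + z) = f a y + f a z" and scale: "\<And>a c y. f a (c *s y) = c * f a y"
    and ex: "\<And>a. a \<in> A \<Longrightarrow> \<exists>y\<in>vec.span W. f a y \<noteq> 0"
  shows "\<exists>y\<in>vec.span W. \<forall>a\<in>A. Re (f a y) \<noteq> 0"
  using assms(1) ex
proof (induction A rule: finite_induct)
  case empty
  show ?case using vec.span_zero by blast
next
  case (insert a A)
  then obtain y where y: "y \<in> vec.span W" "\<forall>b\<in>A. Re (f b y) \<noteq> 0" by auto
  obtain w where w: "w \<in> vec.span W" "f a w \<noteq> 0" using insert.prems by blast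
  \<comment> \<open>The conjugate makes \<open>f a z\<close> a positive real number.\<close>
  define z where "z = cnj (f a w) *s w"
  have z: "z \<in> vec.span W" "Re (f a z) \<noteq> 0"
    using w vec.span_scale by (auto simp: z_def scale mult.commute complex_mult_cnj complex_eq_iff)
  let ?p = "\<lambda>b. [:Re (f b y), Re (f b z):]"
  have "?p b \<noteq> 0" if "b \<in> insert a A" for b using y z that by auto
  then have "finite (\<Union>b\<in>insert a A. {s. poly (?p b) s = 0})"
    using insert.hyps(1) by (intro finite_UN_I poly_roots_finite) auto
  then have "(\<Union>b\<in>insert a A. {s. poly (?p b) s = 0}) \<noteq> UNIV"
    using infinite_UNIV_char_0[where 'a = real] by metis
  then obtain s where s: "\<forall>b\<in>insert a A. poly (?p b) s \<noteq> 0" by blast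
  have "\<forall>b\<in>insert a A. Re (f b (y + of_real s *s z)) \<noteq> 0"
    using s by (simp add: add scale)
  moreover have "y + of_real s *s z \<in> vec.span W" by (intro vec.span_add vec.span_scale y z)
  ultimately show ?case by blast
qed

text \<open>The exterior powers are defined for coordinate vectors, so from here on the ambient space is \<open>real ^ 'n\<close>.\<close>

locale coordinate_polytope = simple_lattice_polytope M P for M P :: "(real ^ 'n) set"
begin

lemma Ver_eq: "simplices M P CARD('n) = Ver" by simp

lemma omega_basis: "J \<in> Simp \<Longrightarrow> lattice_basis (M_ann M P J) (omega M P J)"
  unfolding omega_def using someI_ex[OF M_ann_basis_exists[of J]] .

lemma omega_facts:
  assumes "J \<in> Simp"
  shows "distinct (omega M P J)" "independent (set (omega M P J))"
    "span (set (omega M P J)) = {y. \<forall>j\<in>J. y \<bullet> \<nu> j = 0}" "length (omega M P J) = CARD('n) - card J"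
  using omega_basis[OF assms] M_ann_basis_facts[OF assms omega_basis[OF assms]]
  by (auto simp: lattice_basis_def)

text \<open>The vector \<open>e\<^sub>J\<close> in the plane spanned by \<open>ws\<close> on which the \<open>u\<^sub>i\<^sup>I\<close> with \<open>i \<in> I - J\<close> vanish.\<close>

abbreviation apex where "apex J ws \<equiv> kernel_vector (omega M P J) ws"

lemma apex_zero:
  assumes I: "I \<in> Ver" "J \<subseteq> I" and i: "i \<in> I - J"
  shows "pairing (\<upsilon> I i) (apex J ws) = 0"
proof (rule pairing_span_zero)
  have "\<upsilon> I i \<bullet> \<nu> j = 0" if "j \<in> J" for j
  proof -
    have "j \<in> I" "i \<noteq> j" using that i I(2) by auto
    then show ?thesis using dual_normal[OF I(1), of i j] i by simp
  qed
  then show "\<upsilon> I i \<in> span (set (omega M P J))"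
    using omega_facts(3)[OF Ver_subset_Simp(1)[OF I]] by blast
qed (rule pairing_kernel_vector)

lemma f_form_wedge:
  assumes J: "J \<in> Simp"
  obtains I where "I \<in> Ver" "J \<subseteq> I" "\<And>j. f_form M P J j = wedge (\<upsilon> I j # omega M P J)"
proof -
  define I where "I = (SOME I. I \<in> simplices M P CARD('n) \<and> J \<subseteq> I)"
  obtain I' where "I' \<in> Ver" "J \<subseteq> I'" using Simp_extend[OF J] by blast
  then have "\<exists>I. I \<in> simplices M P CARD('n) \<and> J \<subseteq> I" unfolding Ver_eq by blast
  then have "I \<in> simplices M P CARD('n) \<and> J \<subseteq> I" unfolding I_def by (rule someI_ex)
  then have "I \<in> Ver" "J \<subseteq> I" unfolding Ver_eq by blast+
  moreover have "f_form M P J j = wedge (\<upsilon> I j # omega M P J)" for j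
    by (rule ext) (simp only: f_form_def Let_def I_def)
  ultimately show thesis by (rule that)
qed

text \<open>
  Expand the determinant \<open>u\<^sub>j \<and> \<omega>\<^sub>J\<close> along its first row.  Another choice of \<open>I\<close> changes \<open>u\<^sub>j\<close> by an element of the
  span of \<open>\<omega>\<^sub>J\<close>, on which the pairing with the apex is 0.
\<close>

lemma f_form_apex:
  assumes I: "I \<in> Ver" "J \<subseteq> I" and j: "j \<in> J"
  shows "f_form M P J j ws = pairing (\<upsilon> I j) (apex J ws)"
proof -
  note J = Ver_subset_Simp(1)[OF I]
  obtain I0 where I0: "I0 \<in> Ver" "J \<subseteq> I0" "\<And>j. f_form M P J j = wedge (\<upsilon> I0 j # omega M P J)"
    using f_form_wedge[OF J] by blast
  have "(\<upsilon> I0 j - \<upsilon> I j) \<bullet> \<nu> i = 0" if i: "i \<in> J" for i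
    using dual_normal[OF I(1), of j i] dual_normal[OF I0(1), of j i] i j I(2) I0(2)
    by (simp add: inner_diff_left subset_iff)
  then have "\<upsilon> I0 j - \<upsilon> I j \<in> span (set (omega M P J))" using omega_facts(3)[OF J] by blast
  then have "pairing (\<upsilon> I0 j - \<upsilon> I j) (apex J ws) = 0"
    by (rule pairing_span_zero) (rule pairing_kernel_vector)
  moreover have "pairing (\<upsilon> I0 j) (apex J ws) = pairing (\<upsilon> I0 j - \<upsilon> I j) (apex J ws) + pairing (\<upsilon> I j) (apex J ws)"
    unfolding pairing_add_left[symmetric] by simp
  ultimately show ?thesis unfolding I0(3) wedge_Cons by simp
qed

lemma f_form_homogeneous:
  assumes J: "J \<in> Simp"
  shows "homogeneous_form (CARD('n) - card J + 1) 1 (f_form M P J j)"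
proof -
  obtain I where "f_form M P J j = wedge (\<upsilon> I j # omega M P J)" using f_form_wedge[OF J] by metis
  then show ?thesis by (simp only:) (rule homogeneous_form.wedge, simp add: omega_facts(4)[OF J])
qed

lemma f_form_nonzero:
  assumes J: "J \<in> Simp" and j: "j \<in> J"
  shows "\<exists>ws. length ws = CARD('n) - card J + 1 \<and> f_form M P J j ws \<noteq> 0"
proof -
  obtain I where I: "I \<in> Ver" "J \<subseteq> I" "\<And>j. f_form M P J j = wedge (\<upsilon> I j # omega M P J)"
    using f_form_wedge[OF J] by blast
  have "\<upsilon> I j \<bullet> \<nu> j = 1" using dual_normal[OF I(1), of j j] j I(2) by auto
  then have "\<upsilon> I j \<notin> span (set (omega M P J))"
    unfolding omega_facts(3)[OF J] using j by (auto intro!: bexI[of _ j])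
  then have "distinct (\<upsilon> I j # omega M P J)" "independent (set (\<upsilon> I j # omega M P J))"
    using omega_facts(1,2)[OF J] independent_insertI[of "\<upsilon> I j" "set (omega M P J)"]
      span_base[of "\<upsilon> I j" "set (omega M P J)"] by auto
  from wedge_not_identically_zero[OF this] show ?thesis
    unfolding I(3) using omega_facts(4)[OF J] by simp
qed

lemma f_form_frame:
  assumes J: "J \<in> Simp" and ws: "length ws = CARD('n) - card J + 1" "f_form M P J j ws \<noteq> 0"
  shows "frame (CARD('n) - card J + 1) ws"
proof -
  obtain I where I: "f_form M P J j = wedge (\<upsilon> I j # omega M P J)"
    using f_form_wedge[OF J] by metis
  show ?thesis
    by (rule wedge_nonzero_frame[of "\<upsilon> I j # omega M P J"]) (use ws I omega_facts(4)[OF J] in auto)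
qed

lemma apex_in_span:
  assumes J: "J \<in> Simp" and ws: "length ws = CARD('n) - card J + 1"
  shows "apex J ws \<in> vec.span (set ws)"
  unfolding kernel_vector_def
proof (intro vec.span_sum vec.span_scale)
  fix m assume "m \<in> {..<Suc (length (omega M P J))}"
  then have "m < length ws" using ws omega_facts(4)[OF J] by simp
  then show "ws ! m \<in> vec.span (set ws)" by (intro vec.span_base nth_mem)
qed

text \<open>The value of \<open>\<mu>(J)\<close> computed from a given frame instead of the one selected by \<open>plucker_pullback\<close>.\<close>

definition mu_frame where
  "mu_frame J ws = 1 / of_nat (card (H_grp M P J)) * (\<Sum>h\<in>H_grp M P J.
     degree_zero_part J (\<lambda>j. todd_series (chi M P J j h)) (\<lambda>j. f_form M P J j ws))"

text \<open>Passing to another frame multiplies all \<open>f\<^sup>J(x\<^sub>j)\<close> by the same factor, which cancels in degree 0.\<close>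

lemma mu_eq_mu_frame:
  assumes J: "J \<in> Simp" "J \<noteq> {}" and f: "frame (CARD('n) - card J + 1) ws"
    and nz: "\<And>j. j \<in> J \<Longrightarrow> f_form M P J j ws \<noteq> 0"
  shows "mu M P J (vec.span (set ws)) = mu_frame J ws"
proof -
  let ?r = "CARD('n) - card J + 1"
  let ?ws = "SOME ws'. frame ?r ws' \<and> vec.span (set ws') = vec.span (set ws)"
  have "frame ?r ?ws \<and> vec.span (set ?ws) = vec.span (set ws)"
    by (rule someI[of "\<lambda>ws'. frame ?r ws' \<and> vec.span (set ws') = vec.span (set ws)" ws]) (use f in simp)
  then obtain D where D: "\<And>as. length as = ?r \<Longrightarrow> wedge as ws = D * wedge as ?ws"
    using frame_change[of ?r ?ws ws] f by blast
  have fD: "f_form M P J j ws = D * f_form M P J j ?ws" for j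
    using homogeneous_form_scale[OF f_form_homogeneous[OF J(1)] D] by simp
  obtain j where "j \<in> J" using J(2) by blast
  then have "D \<noteq> 0" using nz[of j] fD[of j] by auto
  then have "degree_zero_part J \<phi> (\<lambda>j. f_form M P J j ws) = degree_zero_part J \<phi> (\<lambda>j. f_form M P J j ?ws)" for \<phi>
    unfolding fD by (rule degree_zero_part_scale[OF Simp_finite[OF J(1)]])
  then show ?thesis unfolding mu_def mu_frame_def plucker_pullback_def by simp
qed

text \<open>All exponents are at least \<open>- 1\<close>, so the product of the \<open>f\<^sup>J(x\<^sub>j)\<close> is a common denominator.\<close>

lemma mu_rational:
  assumes J: "J \<in> Simp" "J \<noteq> {}"
  shows "rational_function (CARD('n) - card J + 1) (mu M P J)"
proof -
  let ?r = "CARD('n) - card J + 1" and ?z = "\<lambda>j. f_form M P J j"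
  have finJ: "finite J" using Simp_finite[OF J(1)] .
  define h where "h ws = (\<Prod>j\<in>J. ?z j ws)" for ws
  define g where "g ws = 1 / of_nat (card (H_grp M P J)) * (\<Sum>x\<in>H_grp M P J. \<Sum>m\<in>exponents J 0.
    (\<Prod>j\<in>J. fls_nth (todd_series (chi M P J j x)) (m j)) * (\<Prod>j\<in>J. ?z j ws ^ nat (m j + 1)))" for ws
  have h: "homogeneous_form ?r (card J) h"
    using homogeneous_form_prod[OF finJ f_form_homogeneous[OF J(1)], of "\<lambda>j. j"] by (simp add: h_def[abs_def])
  have g: "homogeneous_form ?r (card J) g"
    unfolding g_def[abs_def]
  proof (intro homogeneous_form_cmult homogeneous_form_sum)
    fix m assume m: "m \<in> exponents J 0"
    have "(\<Sum>j\<in>J. nat (m j + 1) * 1) = card J"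
    proof -
      have "int (\<Sum>j\<in>J. nat (m j + 1)) = (\<Sum>j\<in>J. m j + 1)"
        unfolding of_nat_sum using m by (intro sum.cong) (force simp: exponents_def PiE_iff)+
      also have "\<dots> = int (card J)" using m by (simp add: sum.distrib exponents_def)
      finally show ?thesis by (simp only: of_nat_eq_iff mult_1_right)
    qed
    moreover have "homogeneous_form ?r (\<Sum>j\<in>J. nat (m j + 1) * 1) (\<lambda>ws. \<Prod>j\<in>J. ?z j ws ^ nat (m j + 1))"
      by (intro homogeneous_form_prod[OF finJ] homogeneous_form_power f_form_homogeneous[OF J(1)])
    ultimately show "homogeneous_form ?r (card J) (\<lambda>ws. \<Prod>j\<in>J. ?z j ws ^ nat (m j + 1))" by simp
  qed
  obtain ws0 where ws0: "length ws0 = ?r" "\<forall>j\<in>J. ?z j ws0 \<noteq> 0"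
    using common_nonzero[OF finJ f_form_homogeneous[OF J(1)] f_form_nonzero[OF J(1)], of "\<lambda>j. j"] by blast
  obtain j0 where j0: "j0 \<in> J" using J(2) by blast
  have "frame ?r ws0" using f_form_frame[OF J(1) ws0(1)] ws0(2) j0 by blast
  moreover have "h ws0 \<noteq> 0" using ws0(2) finJ by (simp add: h_def)
  ultimately have nz: "nonzero_form ?r (card J) h" using h by (auto simp: nonzero_form_def)
  have "mu M P J (vec.span (set ws)) = g ws / h ws" if ws: "frame ?r ws" "h ws \<noteq> 0" for ws
  proof -
    have z: "?z j ws \<noteq> 0" if "j \<in> J" for j using ws(2) that finJ by (auto simp: h_def)
    have "(\<Prod>j\<in>J. fls_nth (todd_series (chi M P J j x)) (m j) * ?z j ws powi m j) =
       (\<Prod>j\<in>J. fls_nth (todd_series (chi M P J j x)) (m j)) * (\<Prod>j\<in>J. ?z j ws ^ nat (m j + 1)) / h ws"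
      if m: "m \<in> exponents J 0" for m x
    proof -
      have "?z j ws powi m j = ?z j ws ^ nat (m j + 1) / ?z j ws" if "j \<in> J" for j
      proof -
        have "m j + 1 \<ge> 0" using m that by (force simp: exponents_def PiE_iff)
        then have "?z j ws ^ nat (m j + 1) = ?z j ws powi (m j + 1)" by (simp add: power_int_def)
        also have "\<dots> = ?z j ws powi m j * ?z j ws" using z[OF that] by (simp add: power_int_add)
        finally show ?thesis using z[OF that] by simp
      qed
      then show ?thesis by (simp add: prod.distrib prod_dividef h_def)
    qed
    then have "mu_frame J ws = g ws / h ws"
      unfolding mu_frame_def g_def degree_zero_part_exponents by (simp add: sum_divide_distrib mult.commute)
    then show ?thesis using mu_eq_mu_frame[OF J ws(1) z] by simp
  qed
  then show ?thesis unfolding rational_function_def using g nz by blast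
qed

text \<open>
  For the relation, let \<open>R = insert s T\<close>.  The \<open>r\<close> apices that belong to the sets \<open>R - {i}\<close>, \<open>i \<in> R\<close>, are dual to the
  forms with index in \<open>R\<close> up to nonzero factors, hence they form a basis of the plane.
\<close>

lemma vertex_generic_forms:
  assumes I: "I \<in> Ver" and k: "1 \<le> k" "k \<le> CARD('n)" and ws: "frame (CARD('n) - k + 1) ws"
    and nz: "\<And>J j. J \<in> simplices M P k \<Longrightarrow> j \<in> J \<Longrightarrow> f_form M P J j ws \<noteq> 0"
  shows "generic_forms I (CARD('n) - k + 1) (vec.span (set ws)) (\<lambda>i. pairing (\<upsilon> I i)) (\<lambda>T. apex (I - T) ws)"
proof -
  let ?r = "CARD('n) - k + 1" and ?E = "vec.span (set ws)"
  have len: "length ws = ?r" and dist: "distinct ws" and ind: "vec.independent (set ws)"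
    using ws by (auto simp: frame_def)
  have finI: "finite I" and cI: "card I = CARD('n)" using Ver_facts(4,7)[OF I] by auto
  have J: "I - T \<in> simplices M P k" "I - T \<in> Simp" "card (I - T) = k" if T: "T \<subseteq> I" "card T = ?r - 1" for T
  proof -
    show "card (I - T) = k" using T cI k finI by (simp add: card_Diff_subset finite_subset)
    then show "I - T \<in> simplices M P k" "I - T \<in> Simp"
      using Ver_subset_Simp(1)[OF I, of "I - T"] by (auto simp: simplices_Simp)
  qed
  have zero: "pairing (\<upsilon> I i) (apex (I - T) ws) = 0" if "T \<subseteq> I" "i \<in> T" for T i
    by (rule apex_zero[OF I]) (use that in auto)
  have nonzero: "pairing (\<upsilon> I i) (apex (I - T) ws) \<noteq> 0" if T: "T \<subseteq> I" "card T = ?r - 1" "i \<in> I - T" for T i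
    using nz[OF J(1)[OF T(1,2)] T(3)] f_form_apex[OF I _ T(3), of ws] by simp
  have inE: "apex (I - T) ws \<in> ?E" if T: "T \<subseteq> I" "card T = ?r - 1" for T
    using apex_in_span[OF J(2)[OF T]] J(3)[OF T] len by simp
  show ?thesis
  proof
    fix T s l assume T: "T \<subseteq> I" "card T = ?r - 1" and s: "s \<in> I - T" and l: "l \<in> I"
    have finT: "finite T" using T(1) finI finite_subset by blast
    let ?R = "insert s T"
    have R: "?R \<subseteq> I" "finite ?R" "card ?R = ?r" using T s finT by auto
    define e where "e i = apex (I - (?R - {i})) ws" for i
    have Ri: "?R - {i} \<subseteq> I" "card (?R - {i}) = ?r - 1" if "i \<in> ?R" for i using R that by auto
    have e0: "pairing (\<upsilon> I i) (e j) = 0" if "i \<in> ?R" "j \<in> ?R" "i \<noteq> j" for i j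
      unfolding e_def using zero[OF Ri(1)[OF that(2)], of i] that by simp
    have e1: "pairing (\<upsilon> I i) (e i) \<noteq> 0" if "i \<in> ?R" for i
      unfolding e_def by (rule nonzero[OF Ri[OF that]]) (use R that in auto)
    have inj: "inj_on e ?R" using e0 e1 by (metis inj_onI)
    have comb: "pairing (\<upsilon> I i) (\<Sum>j\<in>?R. c j *s e j) = c i * pairing (\<upsilon> I i) (e i)" if "i \<in> ?R" for c i
    proof -
      have "pairing (\<upsilon> I i) (\<Sum>j\<in>?R. c j *s e j) = (\<Sum>j\<in>?R. if j = i then c i * pairing (\<upsilon> I i) (e i) else 0)"
        unfolding pairing_sum_right pairing_scale_right using e0[OF that] by (intro sum.cong) auto
      then show ?thesis using that R(2) by simp
    qed
    have indep: "vec.independent (e ` ?R)"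
      unfolding vec.dependent_finite[OF finite_imageI[OF R(2)]]
    proof
      assume "\<exists>u. (\<exists>v\<in>e ` ?R. u v \<noteq> 0) \<and> (\<Sum>v\<in>e ` ?R. u v *s v) = 0"
      then obtain u i where u: "i \<in> ?R" "u (e i) \<noteq> 0" "(\<Sum>v\<in>e ` ?R. u v *s v) = 0" by blast
      have "(\<Sum>j\<in>?R. u (e j) *s e j) = 0" using u(3) unfolding sum.reindex[OF inj] by (simp only: o_def)
      then have "u (e i) * pairing (\<upsilon> I i) (e i) = 0" using comb[OF u(1), of "\<lambda>j. u (e j)"] pairing_zero_right by metis
      then show False using u(2) e1[OF u(1)] by simp
    qed
    have "?E \<subseteq> vec.span (e ` ?R)"
    proof (rule vec.card_ge_dim_independent)
      show "e ` ?R \<subseteq> ?E" unfolding e_def using inE[OF Ri] by blast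
      show "vec.independent (e ` ?R)" by (rule indep)
      have "vec.dim ?E = card (set ws)" using vec.dim_span_eq_card_independent[OF ind] .
      also have "\<dots> = card (e ` ?R)" using distinct_card[OF dist] len card_image[OF inj] R(3) by simp
      finally show "vec.dim ?E \<le> card (e ` ?R)" by simp
    qed
    define c where "c i = pairing (\<upsilon> I l) (e i) / pairing (\<upsilon> I i) (e i)" for i
    have "pairing (\<upsilon> I l) y = c s * pairing (\<upsilon> I s) y + (\<Sum>i\<in>T. c i * pairing (\<upsilon> I i) y)" if y: "y \<in> ?E" for y
    proof -
      have "y \<in> vec.span (e ` ?R)" using y \<open>?E \<subseteq> vec.span (e ` ?R)\<close> by blast
      then obtain u where "y = (\<Sum>v\<in>e ` ?R. u v *s v)"
        unfolding vec.span_finite[OF finite_imageI[OF R(2)]] by blast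
      then have yu: "y = (\<Sum>j\<in>?R. u (e j) *s e j)" unfolding sum.reindex[OF inj] by (simp only: o_def)
      have "pairing (\<upsilon> I l) y = (\<Sum>i\<in>?R. u (e i) * pairing (\<upsilon> I l) (e i))"
        unfolding yu pairing_sum_right pairing_scale_right ..
      also have "\<dots> = (\<Sum>i\<in>?R. c i * pairing (\<upsilon> I i) y)"
      proof (rule sum.cong[OF refl])
        fix i assume i: "i \<in> ?R"
        have "pairing (\<upsilon> I i) y = u (e i) * pairing (\<upsilon> I i) (e i)" unfolding yu by (rule comb[OF i])
        then show "u (e i) * pairing (\<upsilon> I l) (e i) = c i * pairing (\<upsilon> I i) y" using e1[OF i] by (simp add: c_def)
      qed
      also have "\<dots> = c s * pairing (\<upsilon> I s) y + (\<Sum>i\<in>T. c i * pairing (\<upsilon> I i) y)"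
        using s finT by simp
      finally show ?thesis .
    qed
    then show "\<exists>a c. \<forall>y\<in>?E. pairing (\<upsilon> I l) y = a * pairing (\<upsilon> I s) y + (\<Sum>i\<in>T. c i * pairing (\<upsilon> I i) y)" by blast
  qed (use finI inE zero nonzero in auto)
qed

end

section \<open>The Ehrhart coefficients as sums over faces\<close>

context coordinate_polytope begin

text \<open>
  In degree \<open>- |I - J|\<close> only the poles of all the factors contribute, and a factor has a pole only if
  \<open>\<chi>\<^sub>i(h) = 1\<close>.  The \<open>h\<close> for which all factors have poles form \<open>H\<^sub>J\<close>.
\<close>

lemma ehrhart_coeff_leading:
  fixes \<phi> :: "real ^ 'n \<Rightarrow> complex"
  assumes J: "J \<in> Simp" and \<phi>: "\<And>x. Re (\<phi> x) = x \<bullet> \<zeta>" and g: "generic \<zeta>"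
  shows "ehrhart_coeff J \<phi> (CARD('n) - card J) = (\<Sum>I | I \<in> Ver \<and> J \<subseteq> I.
    \<phi> (vtx I) ^ (CARD('n) - card J) / fact (CARD('n) - card J) / of_nat (card (H_grp M P I)) *
      (of_nat (card (H_grp M P J)) * (\<Prod>i\<in>I-J. 1 / \<phi> (\<upsilon> I i))))"
  unfolding ehrhart_coeff_def
proof (rule sum.cong[OF refl])
  fix I assume "I \<in> {I. I \<in> Ver \<and> J \<subseteq> I}"
  then have I: "I \<in> Ver" "J \<subseteq> I" by auto
  let ?q = "CARD('n) - card J"
  have finA: "finite (I - J)" using Ver_facts(7)[OF I(1)] by simp
  have q: "?q = card (I - J)"
    using Ver_facts(4)[OF I(1)] card_Diff_subset[OF Simp_finite[OF J] I(2)] by simp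
  have x: "\<phi> (\<upsilon> I i) \<noteq> 0" if "i \<in> I - J" for i
    using generic_nonzero[OF \<phi> g I(1)] that by blast
  have "fls_nth (\<Prod>i\<in>I-J. todd_scaled (chi M P I i h) (\<phi> (\<upsilon> I i))) (- int ?q) =
      (if \<forall>i\<in>I-J. chi M P I i h = 1 then \<Prod>i\<in>I-J. 1 / \<phi> (\<upsilon> I i) else 0)" for h
  proof -
    have "fls_nth (\<Prod>i\<in>I-J. todd_scaled (chi M P I i h) (\<phi> (\<upsilon> I i))) (- int ?q) =
        (\<Sum>m\<in>exponents (I-J) (- int ?q). \<Prod>i\<in>I-J. fls_nth (todd_scaled (chi M P I i h) (\<phi> (\<upsilon> I i))) (m i))"
      by (rule fls_prod_nth_simple_poles(1)[OF finA]) (simp add: todd_scaled_nth x todd_series_nth_below)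
    also have "\<dots> = (\<Prod>i\<in>I-J. if chi M P I i h = 1 then 1 / \<phi> (\<upsilon> I i) else 0)"
    proof -
      have "fls_nth (todd_scaled (chi M P I i h) (\<phi> (\<upsilon> I i))) (- 1) = (if chi M P I i h = 1 then 1 / \<phi> (\<upsilon> I i) else 0)"
        if "i \<in> I - J" for i
        unfolding todd_scaled_nth[OF x[OF that]] todd_series_nth_pole by (simp add: power_int_minus inverse_eq_divide)
      then have "(\<Prod>i\<in>I-J. fls_nth (todd_scaled (chi M P I i h) (\<phi> (\<upsilon> I i))) ((\<lambda>i\<in>I-J. - 1) i)) =
          (\<Prod>i\<in>I-J. if chi M P I i h = 1 then 1 / \<phi> (\<upsilon> I i) else 0)"
        by (intro prod.cong refl) (simp only: restrict_apply if_True)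
      then show ?thesis unfolding q exponents_leading[OF finA] by simp
    qed
    also have "\<dots> = (if \<forall>i\<in>I-J. chi M P I i h = 1 then \<Prod>i\<in>I-J. 1 / \<phi> (\<upsilon> I i) else 0)"
    proof (cases "\<forall>i\<in>I-J. chi M P I i h = 1")
      case True
      then have "(\<Prod>i\<in>I-J. if chi M P I i h = 1 then 1 / \<phi> (\<upsilon> I i) else 0) = (\<Prod>i\<in>I-J. 1 / \<phi> (\<upsilon> I i))"
        by (intro prod.cong) auto
      then show ?thesis unfolding if_P[OF True] .
    next
      case False
      then obtain i where "i \<in> I - J" "chi M P I i h \<noteq> 1" by blast
      then have "(\<Prod>i\<in>I-J. if chi M P I i h = 1 then 1 / \<phi> (\<upsilon> I i) else 0) = 0"
        using finA by (intro prod_zero bexI[of _ i]) auto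
      then show ?thesis unfolding if_not_P[OF False] .
    qed
    finally show ?thesis .
  qed
  then have "(\<Sum>h\<in>H_grp M P I. fls_nth (\<Prod>i\<in>I-J. todd_scaled (chi M P I i h) (\<phi> (\<upsilon> I i))) (- int ?q)) =
      (\<Sum>h\<in>H_grp M P I. if \<forall>i\<in>I-J. chi M P I i h = 1 then \<Prod>i\<in>I-J. 1 / \<phi> (\<upsilon> I i) else 0)"
    by (simp only:)
  also have "\<dots> = (\<Sum>h | h \<in> H_grp M P I \<and> (\<forall>i\<in>I-J. chi M P I i h = 1). \<Prod>i\<in>I-J. 1 / \<phi> (\<upsilon> I i))"
    by (rule sum.inter_filter[symmetric, OF finite_H_grp(1)[OF Ver_facts(13)[OF I(1)]]])
  also have "\<dots> = of_nat (card (H_grp M P J)) * (\<Prod>i\<in>I-J. 1 / \<phi> (\<upsilon> I i))"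
    unfolding sum_H_grp_restrict[OF I, of "\<lambda>_. \<Prod>i\<in>I-J. 1 / \<phi> (\<upsilon> I i)", symmetric] by simp
  finally have *: "(\<Sum>h\<in>H_grp M P I. fls_nth (\<Prod>i\<in>I-J. todd_scaled (chi M P I i h) (\<phi> (\<upsilon> I i))) (- int ?q)) =
    of_nat (card (H_grp M P J)) * (\<Prod>i\<in>I-J. 1 / \<phi> (\<upsilon> I i))" .
  show "\<phi> (vtx I) ^ ?q / fact ?q / of_nat (card (H_grp M P I)) *
      (\<Sum>h\<in>H_grp M P I. fls_nth (\<Prod>i\<in>I-J. todd_scaled (chi M P I i h) (\<phi> (\<upsilon> I i))) (- int ?q)) =
    \<phi> (vtx I) ^ ?q / fact ?q / of_nat (card (H_grp M P I)) *
      (of_nat (card (H_grp M P J)) * (\<Prod>i\<in>I-J. 1 / \<phi> (\<upsilon> I i)))"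
    unfolding * ..
qed

text \<open>
  This is \<open>interpolation_laurent\<close> for the forms \<open>\<langle>u\<^sub>i, _\<rangle>\<close>, with \<open>S\<close> the set of \<open>i\<close> where the factor has a
  pole and the sets \<open>T\<close> replaced by their complements \<open>J\<close>.
\<close>

lemma vertex_local_formula:
  assumes I: "I \<in> Ver" and k: "1 \<le> k" "k \<le> CARD('n)" and ws: "frame (CARD('n) - k + 1) ws"
    and nz: "\<And>J j. J \<in> simplices M P k \<Longrightarrow> j \<in> J \<Longrightarrow> f_form M P J j ws \<noteq> 0"
    and \<xi>: "\<xi> \<in> vec.span (set ws)" "\<And>i. i \<in> I \<Longrightarrow> pairing (\<upsilon> I i) \<xi> \<noteq> 0"
  shows "fls_nth (\<Prod>i\<in>I. todd_scaled (chi M P I i h) (pairing (\<upsilon> I i) \<xi>)) (- int (CARD('n) - k)) =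
    (\<Sum>J | J \<subseteq> I \<and> card J = k \<and> (\<forall>i\<in>I-J. chi M P I i h = 1).
      degree_zero_part J (\<lambda>j. todd_series (chi M P I j h)) (\<lambda>j. f_form M P J j ws) *
      (\<Prod>i\<in>I-J. 1 / pairing (\<upsilon> I i) \<xi>))"
proof -
  let ?r = "CARD('n) - k + 1" and ?x = "\<lambda>i. pairing (\<upsilon> I i)" and ?e = "\<lambda>T. apex (I - T) ws"
  interpret generic_forms I ?r "vec.span (set ws)" ?x ?e
    by (rule vertex_generic_forms[OF I k ws nz])
  have finI: "finite I" and cI: "card I = CARD('n)" using Ver_facts(4,7)[OF I] by auto
  let ?S = "{i \<in> I. chi M P I i h = 1}"
  have corners_iff: "T \<in> corners S \<longleftrightarrow> T \<subseteq> S \<and> card T = CARD('n) - k" for T S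
    unfolding corners_def by simp
  have "fls_nth (\<Prod>i\<in>I. todd_scaled (chi M P I i h) (?x i \<xi>)) (- int (CARD('n) - k)) =
      (\<Sum>m\<in>exponents I (- int (?r - 1)). \<Prod>i\<in>I. fls_nth (todd_scaled (chi M P I i h) (?x i \<xi>)) (m i))"
    using fls_prod_nth_simple_poles(1)[OF finI, of "\<lambda>i. todd_scaled (chi M P I i h) (?x i \<xi>)" "- int (CARD('n) - k)"]
    by (simp add: todd_scaled_nth \<xi>(2) todd_series_nth_below)
  also have "\<dots> = (\<Sum>m\<in>exponents I (- int (?r - 1)). \<Prod>i\<in>I. fls_nth (todd_series (chi M P I i h)) (m i) * ?x i \<xi> powi m i)"
    by (intro sum.cong prod.cong refl todd_scaled_nth \<xi>(2))
  also have "\<dots> = (\<Sum>T\<in>corners ?S. (\<Sum>m\<in>exponents (I-T) 0. \<Prod>j\<in>I-T.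
      fls_nth (todd_series (chi M P I j h)) (m j) * ?x j (?e T) powi m j) * (\<Prod>i\<in>T. 1 / ?x i \<xi>))"
    by (rule interpolation_laurent[OF _ _ \<xi>]) (auto simp: todd_series_nth_pole)
  also have "\<dots> = (\<Sum>T\<in>corners ?S. degree_zero_part (I-T) (\<lambda>j. todd_series (chi M P I j h)) (\<lambda>j. f_form M P (I-T) j ws) *
      (\<Prod>i\<in>T. 1 / ?x i \<xi>))"
  proof (intro sum.cong refl arg_cong2[where f = times])
    fix T assume "T \<in> corners ?S"
    show "(\<Sum>m\<in>exponents (I-T) 0. \<Prod>j\<in>I-T. fls_nth (todd_series (chi M P I j h)) (m j) * ?x j (?e T) powi m j) =
        degree_zero_part (I-T) (\<lambda>j. todd_series (chi M P I j h)) (\<lambda>j. f_form M P (I-T) j ws)"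
      unfolding degree_zero_part_exponents
      by (intro sum.cong prod.cong refl arg_cong2[where f = times] arg_cong2[where f = power_int]
          f_form_apex[OF I, symmetric]) auto
  qed
  also have "\<dots> = (\<Sum>J | J \<subseteq> I \<and> card J = k \<and> (\<forall>i\<in>I-J. chi M P I i h = 1).
      degree_zero_part J (\<lambda>j. todd_series (chi M P I j h)) (\<lambda>j. f_form M P J j ws) * (\<Prod>i\<in>I-J. 1 / ?x i \<xi>))"
  proof (rule sum.reindex_bij_witness[where i = "\<lambda>J. I - J" and j = "\<lambda>T. I - T"])
    fix T assume "T \<in> corners ?S"
    then have T: "T \<subseteq> ?S" "card T = CARD('n) - k" unfolding corners_iff by blast+
    then have TI: "T \<subseteq> I" "card T = CARD('n) - k" by blast+
    show d: "I - (I - T) = T" using TI by blast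
    have "card (I - T) = k" using TI cI k finI by (simp add: card_Diff_subset finite_subset)
    then show "I - T \<in> {J. J \<subseteq> I \<and> card J = k \<and> (\<forall>i\<in>I-J. chi M P I i h = 1)}"
      unfolding mem_Collect_eq d using T by blast
    show "degree_zero_part (I-T) (\<lambda>j. todd_series (chi M P I j h)) (\<lambda>j. f_form M P (I-T) j ws) *
        (\<Prod>i\<in>I-(I-T). 1 / ?x i \<xi>) = degree_zero_part (I-T) (\<lambda>j. todd_series (chi M P I j h)) (\<lambda>j. f_form M P (I-T) j ws) *
      (\<Prod>i\<in>T. 1 / ?x i \<xi>)" unfolding d ..
  next
    fix J assume J: "J \<in> {J. J \<subseteq> I \<and> card J = k \<and> (\<forall>i\<in>I-J. chi M P I i h = 1)}"
    show "I - (I - J) = J" using J by blast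
    have "card (I - J) = CARD('n) - k" using J cI finI by (auto simp: card_Diff_subset finite_subset)
    then show "I - J \<in> corners ?S" unfolding corners_iff using J by blast
  qed
  finally show ?thesis .
qed

text \<open>
  Sum \<open>vertex_local_formula\<close> over \<open>h\<close> and over the vertices and collect the terms of each \<open>J\<close>.  Those \<open>h\<close> for
  which \<open>J\<close> occurs form \<open>H\<^sub>J\<close> and produce \<open>\<mu>(J)\<close>; the other factors, summed over the vertices of the
  face, are the leading Ehrhart coefficient of \<open>P\<^sub>J\<close>, which is its volume.
\<close>

lemma ehrhart_coeff_face_sum:
  fixes ws :: "(complex ^ 'n) list" and \<zeta> :: "real ^ 'n"
  assumes k: "1 \<le> k" "k \<le> CARD('n)" and ws: "frame (CARD('n) - k + 1) ws"
    and nz: "\<And>J j. J \<in> simplices M P k \<Longrightarrow> j \<in> J \<Longrightarrow> f_form M P J j ws \<noteq> 0"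
    and \<xi>: "\<xi> \<in> vec.span (set ws)" "\<And>x. Re (pairing x \<xi>) = x \<bullet> \<zeta>" "generic \<zeta>"
  shows "ehrhart_coeff {} (\<lambda>u. pairing u \<xi>) (CARD('n) - k) =
    (\<Sum>J\<in>simplices M P k. mu_frame J ws * of_real (lattice_volume M (face M P J)))"
proof -
  let ?q = "CARD('n) - k" and ?\<phi> = "\<lambda>u. pairing u \<xi>"
  define W where "W I = ?\<phi> (vtx I) ^ ?q / fact ?q / of_nat (card (H_grp M P I))" for I
  define R where "R I J = (\<Prod>i\<in>I-J. 1 / ?\<phi> (\<upsilon> I i))" for I J
  define dz where "dz J c = degree_zero_part J (\<lambda>j. todd_series (c j)) (\<lambda>j. f_form M P J j ws)" for J and c :: "(real ^ 'n) set \<Rightarrow> complex"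
  have x: "?\<phi> (\<upsilon> I i) \<noteq> 0" if "I \<in> Ver" "i \<in> I" for I i
    using generic_nonzero[OF \<xi>(2,3) that] .
  \<comment> \<open>Outside \<open>J\<close> the characters of \<open>H\<^sub>I\<close> and \<open>H\<^sub>J\<close> need not agree, so they are compared as functions on \<open>J\<close>.\<close>
  have dz_restrict: "dz J (restrict c J) = dz J c" for J c
    unfolding dz_def by (rule degree_zero_part_cong) auto
  have vert: "(\<Sum>h\<in>H_grp M P I. fls_nth (\<Prod>i\<in>I-{}. todd_scaled (chi M P I i h) (?\<phi> (\<upsilon> I i))) (- int ?q)) =
      (\<Sum>J | J \<subseteq> I \<and> card J = k. of_nat (card (H_grp M P J)) * mu_frame J ws * R I J)" if I: "I \<in> Ver" for I
  proof -
    have finP: "finite {J. J \<subseteq> I \<and> card J = k}"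
      by (rule finite_subset[of _ "Pow I"]) (use Ver_facts(7)[OF I] in auto)
    have "(\<Sum>h\<in>H_grp M P I. fls_nth (\<Prod>i\<in>I-{}. todd_scaled (chi M P I i h) (?\<phi> (\<upsilon> I i))) (- int ?q)) =
        (\<Sum>h\<in>H_grp M P I. \<Sum>J | J \<subseteq> I \<and> card J = k \<and> (\<forall>i\<in>I-J. chi M P I i h = 1). dz J (\<lambda>j. chi M P I j h) * R I J)"
      unfolding dz_def R_def Diff_empty
      by (intro sum.cong refl vertex_local_formula[OF I k ws nz \<xi>(1)] x[OF I])
    also have "\<dots> = (\<Sum>h\<in>H_grp M P I. \<Sum>J | J \<subseteq> I \<and> card J = k.
        if \<forall>i\<in>I-J. chi M P I i h = 1 then dz J (\<lambda>j. chi M P I j h) * R I J else 0)"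
    proof (rule sum.cong[OF refl])
      fix h
      have "{J. J \<subseteq> I \<and> card J = k \<and> (\<forall>i\<in>I-J. chi M P I i h = 1)} =
          {J \<in> {J. J \<subseteq> I \<and> card J = k}. \<forall>i\<in>I-J. chi M P I i h = 1}" by blast
      then show "(\<Sum>J | J \<subseteq> I \<and> card J = k \<and> (\<forall>i\<in>I-J. chi M P I i h = 1). dz J (\<lambda>j. chi M P I j h) * R I J) =
          (\<Sum>J | J \<subseteq> I \<and> card J = k. if \<forall>i\<in>I-J. chi M P I i h = 1 then dz J (\<lambda>j. chi M P I j h) * R I J else 0)"
        by (simp only: sum.inter_filter[OF finP])
    qed
    also have "\<dots> = (\<Sum>J | J \<subseteq> I \<and> card J = k. \<Sum>h\<in>H_grp M P I.
        if \<forall>i\<in>I-J. chi M P I i h = 1 then dz J (\<lambda>j. chi M P I j h) * R I J else 0)"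
      by (rule sum.swap)
    also have "\<dots> = (\<Sum>J | J \<subseteq> I \<and> card J = k. of_nat (card (H_grp M P J)) * mu_frame J ws * R I J)"
    proof (rule sum.cong[OF refl])
      fix J assume "J \<in> {J. J \<subseteq> I \<and> card J = k}"
      then have J: "J \<subseteq> I" "card J = k" by auto
      have JS: "J \<in> Simp" using Ver_subset_Simp(1)[OF I J(1)] .
      have "(\<Sum>h\<in>H_grp M P I. if \<forall>i\<in>I-J. chi M P I i h = 1 then dz J (\<lambda>j. chi M P I j h) * R I J else 0) =
          (\<Sum>h | h \<in> H_grp M P I \<and> (\<forall>i\<in>I-J. chi M P I i h = 1). dz J (restrict (\<lambda>j. chi M P I j h) J) * R I J)"
        unfolding dz_restrict
        by (rule sum.inter_filter[symmetric, OF finite_H_grp(1)[OF Ver_facts(13)[OF I]]])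
      also have "\<dots> = (\<Sum>h\<in>H_grp M P J. dz J (restrict (\<lambda>j. chi M P J j h) J) * R I J)"
        by (rule sum_H_grp_restrict[OF I J(1), symmetric, of "\<lambda>c. dz J c * R I J"])
      also have "\<dots> = of_nat (card (H_grp M P J)) * mu_frame J ws * R I J"
        unfolding dz_restrict mu_frame_def dz_def[symmetric] sum_distrib_right[symmetric]
        using card_H_pos[OF JS] by simp
      finally show "(\<Sum>h\<in>H_grp M P I. if \<forall>i\<in>I-J. chi M P I i h = 1 then dz J (\<lambda>j. chi M P I j h) * R I J else 0) =
        of_nat (card (H_grp M P J)) * mu_frame J ws * R I J" .
    qed
    finally show ?thesis .
  qed
  have "ehrhart_coeff {} ?\<phi> ?q = (\<Sum>I\<in>Ver. \<Sum>J | J \<subseteq> I \<and> card J = k.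
      W I * (of_nat (card (H_grp M P J)) * mu_frame J ws * R I J))"
    unfolding ehrhart_coeff_def using vert by (simp add: W_def sum_distrib_left)
  also have "\<dots> = (\<Sum>I\<in>Ver. \<Sum>J\<in>{J \<in> simplices M P k. J \<subseteq> I}.
      W I * (of_nat (card (H_grp M P J)) * mu_frame J ws * R I J))"
    using Ver_subset_Simp(1) by (intro sum.cong refl) (auto simp: simplices_Simp)
  also have "\<dots> = (\<Sum>J\<in>simplices M P k. \<Sum>I\<in>{I \<in> Ver. J \<subseteq> I}.
      W I * (of_nat (card (H_grp M P J)) * mu_frame J ws * R I J))"
    by (rule sum.swap_restrict[OF finite_simplices finite_simplices])
  also have "\<dots> = (\<Sum>J\<in>simplices M P k. mu_frame J ws * of_real (lattice_volume M (face M P J)))"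
  proof (rule sum.cong[OF refl])
    fix J assume "J \<in> simplices M P k"
    then have J: "J \<in> Simp" "card J = k" by (auto simp: simplices_Simp)
    have "of_real (lattice_volume M (face M P J)) = ehrhart_coeff J ?\<phi> ?q"
      using lattice_volume_face[OF J(1) linear_pairing \<xi>(2,3)] J(2) by simp
    also have "\<dots> = (\<Sum>I\<in>{I \<in> Ver. J \<subseteq> I}. W I * (of_nat (card (H_grp M P J)) * R I J))"
      using ehrhart_coeff_leading[OF J(1) \<xi>(2,3)] J(2) by (simp add: W_def R_def)
    finally have v: "of_real (lattice_volume M (face M P J)) = (\<Sum>I\<in>{I \<in> Ver. J \<subseteq> I}. W I * (of_nat (card (H_grp M P J)) * R I J))" .
    show "(\<Sum>I\<in>{I \<in> Ver. J \<subseteq> I}. W I * (of_nat (card (H_grp M P J)) * mu_frame J ws * R I J)) =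
      mu_frame J ws * of_real (lattice_volume M (face M P J))"
      unfolding v sum_distrib_left by (intro sum.cong refl) (simp add: algebra_simps)
  qed
  finally show ?thesis .
qed

lemma Ver_nonempty: "Ver \<noteq> {}"
proof -
  have "{} \<in> Simp" using P_ne by (auto simp: Simp_def face_def)
  then show ?thesis using Simp_extend by blast
qed

lemma simplex_through:
  assumes I: "I \<in> Ver" "i \<in> I" and k: "1 \<le> k" "k \<le> CARD('n)"
  obtains J where "J \<in> simplices M P k" "J \<subseteq> I" "i \<in> J"
proof -
  have "k - 1 \<le> card (I - {i})" using Ver_facts(4,7)[OF I(1)] I(2) k by simp
  then obtain K where K: "K \<subseteq> I - {i}" "card K = k - 1" "finite K"
    using obtain_subset_with_card_n by metis
  have "card (insert i K) = k" using K k by (subst card_insert_disjoint) auto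
  moreover have "insert i K \<subseteq> I" using K I(2) by blast
  ultimately show thesis
    using that[of "insert i K"] Ver_subset_Simp(1)[OF I(1), of "insert i K"] by (auto simp: simplices_Simp)
qed

text \<open>
  Apply \<open>ehrhart_coeff_face_sum\<close> with a generic point \<open>\<xi>\<close> of the plane.  There is one, since every \<open>u\<^sub>i\<^sup>I\<close> is
  nonzero at the apex of some \<open>J\<close> containing \<open>i\<close>.
\<close>

theorem ehrhart_formula:
  fixes a :: "nat \<Rightarrow> real"
  assumes ehrhart: "\<And>l::nat. l > 0 \<Longrightarrow>
      real (card (M \<inter> (\<lambda>u. real l *\<^sub>R u) ` P)) = (\<Sum>i\<le>CARD('n). a i * real l ^ (CARD('n) - i))"
    and k: "1 \<le> k" "k \<le> CARD('n)" and ws: "frame (CARD('n) - k + 1) ws"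
    and nz: "\<And>J j. J \<in> simplices M P k \<Longrightarrow> j \<in> J \<Longrightarrow> f_form M P J j ws \<noteq> 0"
  shows "of_real (a k) = (\<Sum>J\<in>simplices M P k. mu_frame J ws * of_real (lattice_volume M (face M P J)))"
proof -
  let ?n = "CARD('n)" and ?A = "SIGMA I:Ver. I"
  have finA: "finite ?A" using Ver_facts(7) by (intro finite_SigmaI) auto
  have "\<exists>\<xi>\<in>vec.span (set ws). \<forall>p\<in>?A. Re (pairing (\<upsilon> (fst p) (snd p)) \<xi>) \<noteq> 0"
  proof (rule generic_point_in_span[OF finA])
    fix p assume p: "p \<in> ?A"
    obtain I i where Ii: "p = (I, i)" "I \<in> Ver" "i \<in> I" using p by blast
    obtain J where J: "J \<in> simplices M P k" "J \<subseteq> I" "i \<in> J" using simplex_through[OF Ii(2,3) k] by blast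
    have "apex J ws \<in> vec.span (set ws)"
      using apex_in_span[of J ws] J(1) ws by (auto simp: simplices_Simp frame_def)
    moreover have "pairing (\<upsilon> I i) (apex J ws) \<noteq> 0"
      using nz[OF J(1,3)] f_form_apex[OF Ii(2) J(2,3)] by simp
    ultimately show "\<exists>y\<in>vec.span (set ws). pairing (\<upsilon> (fst p) (snd p)) y \<noteq> 0" using Ii(1) by auto
  qed (auto simp: pairing_add_right pairing_scale_right)
  then obtain \<xi> where \<xi>: "\<xi> \<in> vec.span (set ws)" "\<And>I i. I \<in> Ver \<Longrightarrow> i \<in> I \<Longrightarrow> Re (pairing (\<upsilon> I i) \<xi>) \<noteq> 0"
    by force
  \<comment> \<open>The real functional that decides the direction in which the cones are flipped.\<close>
  define \<zeta> where "\<zeta> = (\<chi> i. Re (\<xi> $ i))"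
  have Re: "Re (pairing x \<xi>) = x \<bullet> \<zeta>" for x
    by (simp add: pairing_def \<zeta>_def inner_vec_def)
  have gen: "generic \<zeta>" using \<xi>(2) by (simp add: generic_def Re)
  let ?c = "ehrhart_coeff {} (\<lambda>u. pairing u \<xi>)"
  have empty: "{} \<in> Simp" using P_ne by (auto simp: Simp_def face_def)
  have "of_real (a (?n - q)) = ?c q" if q: "q \<le> ?n" for q
  proof (rule polynomial_coeff_eq[OF _ q])
    fix l :: nat assume l: "l > 0"
    have "face_points {} l = M \<inter> (\<lambda>u. real l *\<^sub>R u) ` P"
    proof (intro equalityI subsetI)
      fix x assume x: "x \<in> face_points {} l"
      then have "(1 / real l) *\<^sub>R x \<in> P" "x \<in> M" by (auto simp: face_points_def face_def)
      moreover have "real l *\<^sub>R ((1 / real l) *\<^sub>R x) = x" using l by simp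
      ultimately show "x \<in> M \<inter> (\<lambda>u. real l *\<^sub>R u) ` P" by (metis IntI imageI)
    next
      fix x assume "x \<in> M \<inter> (\<lambda>u. real l *\<^sub>R u) ` P"
      then show "x \<in> face_points {} l" using l by (auto simp: face_points_def face_def)
    qed
    then have "(\<Sum>q\<le>?n. ?c q * of_nat l ^ q) = of_nat (card (M \<inter> (\<lambda>u. real l *\<^sub>R u) ` P))"
      using card_face_points[OF empty l linear_pairing Re gen] by simp
    also have "\<dots> = of_real (\<Sum>i\<le>?n. a i * real l ^ (?n - i))"
      using ehrhart[OF l] by (metis of_real_of_nat_eq)
    also have "(\<Sum>i\<le>?n. a i * real l ^ (?n - i)) = (\<Sum>q\<le>?n. a (?n - q) * real l ^ q)"
      by (rule sum.reindex_bij_witness[where i = "\<lambda>q. ?n - q" and j = "\<lambda>q. ?n - q"]) auto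
    finally show "(\<Sum>q\<le>?n. of_real (a (?n - q)) * of_nat l ^ q) = (\<Sum>q\<le>?n. ?c q * of_nat l ^ q)"
      by simp
  qed
  from this[of "?n - k"] have "of_real (a k) = ?c (?n - k)" using k by simp
  also have "\<dots> = (\<Sum>J\<in>simplices M P k. mu_frame J ws * of_real (lattice_volume M (face M P J)))"
    by (rule ehrhart_coeff_face_sum[OF k ws nz \<xi>(1) Re gen])
  finally show ?thesis .
qed

lemma nonzero_form_prod_f_form:
  assumes k: "1 \<le> k" "k \<le> CARD('n)"
  shows "nonzero_form (CARD('n) - k + 1) (\<Sum>p\<in>(SIGMA J:simplices M P k. J). 1)
    (\<lambda>ws. \<Prod>p\<in>(SIGMA J:simplices M P k. J). f_form M P (fst p) (snd p) ws)"
proof -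
  let ?A = "SIGMA J:simplices M P k. J" and ?r = "CARD('n) - k + 1"
  have S: "J \<in> Simp" "card J = k" "finite J" if "J \<in> simplices M P k" for J
    using that Simp_finite by (auto simp: simplices_Simp)
  have finA: "finite ?A" using S by (intro finite_SigmaI) auto
  have hf: "homogeneous_form ?r 1 (f_form M P (fst p) (snd p))" if "p \<in> ?A" for p
  proof -
    have "fst p \<in> simplices M P k" using that by auto
    then show ?thesis using f_form_homogeneous[OF S(1), of "fst p" "snd p"] S(2)[of "fst p"] by simp
  qed
  have ex: "\<exists>ws. length ws = ?r \<and> f_form M P (fst p) (snd p) ws \<noteq> 0" if "p \<in> ?A" for p
  proof -
    have p: "fst p \<in> simplices M P k" "snd p \<in> fst p" using that by auto
    show ?thesis using f_form_nonzero[OF S(1)[OF p(1)] p(2)] S(2)[OF p(1)] by simp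
  qed
  obtain ws where ws: "length ws = ?r" "\<forall>p\<in>?A. f_form M P (fst p) (snd p) ws \<noteq> 0"
    using common_nonzero[OF finA, where d = "\<lambda>_. 1" and g = "\<lambda>p. f_form M P (fst p) (snd p)" and r = ?r, OF hf ex] by blast
  obtain I where I: "I \<in> Ver" using Ver_nonempty by blast
  have "I \<noteq> {}" using Ver_facts(4)[OF I] by auto
  then obtain i where i: "i \<in> I" by blast
  obtain J where J: "J \<in> simplices M P k" "i \<in> J" using simplex_through[OF I i k] by blast
  have "frame ?r ws"
    using f_form_frame[OF S(1)[OF J(1)], of ws i] ws S(2)[OF J(1)] J by auto
  moreover have "homogeneous_form ?r (\<Sum>p\<in>?A. 1) (\<lambda>ws. \<Prod>p\<in>?A. f_form M P (fst p) (snd p) ws)"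
    by (rule homogeneous_form_prod[OF finA hf])
  moreover have "(\<Prod>p\<in>?A. f_form M P (fst p) (snd p) ws) \<noteq> 0" using ws(2) finA by (simp add: prod_zero_iff)
  ultimately show ?thesis unfolding nonzero_form_def by blast
qed

end

theorem corollary2p2:
  fixes M P :: "(real ^ 'n) set" and a :: "nat \<Rightarrow> real" and k :: nat
  assumes "full_lattice M"
    and "lattice_polytope M P" and "simple_polytope P" and "aff_dim P = int CARD('n)"
    and ehrhart: "\<And>l::nat. l > 0 \<Longrightarrow>
      real (card (M \<inter> (\<lambda>u. real l *\<^sub>R u) ` P)) = (\<Sum>i\<le>CARD('n). a i * real l ^ (CARD('n) - i))"
    and "1 \<le> k" and "k \<le> CARD('n)"
  shows "(\<forall>J\<in>simplices M P k. rational_function (CARD('n) - k + 1) (mu M P J)) \<and>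
    rational_eq (CARD('n) - k + 1)
      (\<lambda>E. complex_of_real (a k))
      (\<lambda>E. \<Sum>J\<in>simplices M P k. mu M P J E * complex_of_real (lattice_volume M (face M P J)))"
proof -
  interpret coordinate_polytope M P
    using assms(1-4) unfolding coordinate_polytope_def simple_lattice_polytope_def by simp
  have S: "J \<in> Simp" "card J = k" "J \<noteq> {}" if "J \<in> simplices M P k" for J
    using that \<open>1 \<le> k\<close> by (auto simp: simplices_Simp)
  have rat: "rational_function (CARD('n) - k + 1) (mu M P J)" if "J \<in> simplices M P k" for J
    using mu_rational[OF S(1,3)[OF that]] S(2)[OF that] by simp
  let ?A = "SIGMA J:simplices M P k. J"
  have finA: "finite ?A" using S(1) Simp_finite by (intro finite_SigmaI) auto
  have eq: "of_real (a k) = (\<Sum>J\<in>simplices M P k. mu M P J (vec.span (set ws)) * of_real (lattice_volume M (face M P J)))"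
    if ws: "frame (CARD('n) - k + 1) ws" "(\<Prod>p\<in>?A. f_form M P (fst p) (snd p) ws) \<noteq> 0" for ws
  proof -
    have nz: "f_form M P J j ws \<noteq> 0" if "J \<in> simplices M P k" "j \<in> J" for J j
    proof
      assume "f_form M P J j ws = 0"
      then have "(\<Prod>p\<in>?A. f_form M P (fst p) (snd p) ws) = 0"
        using that finA by (intro prod_zero bexI[of _ "(J, j)"]) auto
      then show False using ws(2) by simp
    qed
    have "mu M P J (vec.span (set ws)) = mu_frame J ws" if J: "J \<in> simplices M P k" for J
      by (rule mu_eq_mu_frame[OF S(1,3)[OF J]]) (use ws(1) S(2)[OF J] nz[OF J] in auto)
    then show ?thesis
      using ehrhart_formula[OF ehrhart \<open>1 \<le> k\<close> \<open>k \<le> CARD('n)\<close> ws(1) nz] by simp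
  qed
  then show ?thesis
    using rat nonzero_form_prod_f_form[OF \<open>1 \<le> k\<close> \<open>k \<le> CARD('n)\<close>] unfolding rational_eq_def by blast
qed

end
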